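(* Let $s$ satisfy (s1)–(s5) and, in addition, suppose there is a constant $C>0$ such that for all $x\in\Omega$ and $p_1,p_2\in\mathbb{R}$, \[ |\partial_xs^*(p_1,x)-\partial_xs^*(p_2,x)|^2\le C\,|\partial_ps^*(p_1,x)-\partial_ps^*(p_2,x)|\,|s^*(p_1,x)-s^*(p_2,x)| . \] Then there exists at most one weak solution of $(P)$ with initial data $\rho_0$, in the sense that if $(\rho_1,p_1)$ and $(\rho_2,p_2)$ are two weak solutions of $(P)$ with initial data $\rho_0$, then $\rho_1=\rho_2$ a.e. in $\Omega_T$ and $m_1=m_2$ a.e. in $\Omega_T$, where $m_i=\nabla[s^*(p_i(x,t),x)]-\partial_xs^*(p_i(x,t),x)$.
   Context: $\Omega\subset\mathbb{R}^d$ bounded smooth domain, $\Omega_T=\Omega\times[0,T]$. $s:\mathbb{R}\times\Omega\to\mathbb{R}\cup\{+\infty\}$, $s^*(p,x)=\sup_z(pz-s(z,x))$, with (s1) $s(\cdot,x)$ proper, lsc, convex; (s2) $s(z,x)=+\infty$ for $z<0$, $s(0,x)=0$, $\inf s>-\infty$, $\lim_{z\to\infty}\inf_xs(z,x)/z=+\infty$; (s3) $s^*$ differentiable, $\partial_ps^*,\nabla_xs^*$ continuous in $p$, $\int_\Omega\|\nabla_xs^*(\cdot,x)\|^2_{C((-\infty,b))}dx<\infty$ for finite $b$; (s4) $\lim_{\alpha\to-\infty}\operatorname{ess\,sup}_x\partial_ps^*(\alpha,x)=0$, $\lim_{\alpha\to\infty}\operatorname{ess\,inf}_x\partial_ps^*(\alpha,x)>0$;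 (s5) $\operatorname{ess\,sup}_x\partial_ps^*(\alpha,x)\le M_\alpha\operatorname{ess\,inf}_x\partial_ps^*(\alpha,x)$ for some $M_\alpha\in(0,\infty)$. $\partial s$ is the subdifferential in $z$; $\partial_xs^*$ is the partial gradient in $x$ and $\nabla[s^*(p(x,t),x)]$ the weak total spatial gradient. Weak solution of $(P)$ with initial data $\rho_0$: a pair $(\rho,p)$ such that for every $T>0$, $\rho\in L^\infty(\Omega_T)$, $p$ is measurable with $p_+=\max\{p,0\}\in L^\infty(\Omega_T)$, $p(x,t)\in\partial s(\rho(x,t),x)$ and $\rho(x,t)=\partial_ps^*(p(x,t),x)$ a.e. in $\Omega_T$, $m:=\nabla[s^*(p(x,t),x)]-\partial_xs^*(p(x,t),x)\in L^2(\Omega_T)$, and for a.e. $t_0\in[0,T]$ and all $\phi\in C^\infty(\Omega_T)$: $\int_0^{t_0}\!\int_\Omega\rho\,\partial_t\phi-m\cdot\nabla\phi\,dx\,dt=\int_\Omega\rho(x,t_0)\phi(x,t_0)-\rho_0(x)\phi(x,0)\,dx$. *)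

theory Defs
  imports "HOL-Analysis.Analysis"
begin

fun iter_dd :: "'a::real_normed_vector list \<Rightarrow> ('a \<Rightarrow> real) \<Rightarrow> 'a \<Rightarrow> real" where
  "iter_dd [] f = f"
| "iter_dd (v # vs) f = (\<lambda>x. frechet_derivative (iter_dd vs f) (at x) v)"

text \<open>C-infinity on an open set: all iterated derivatives exist (hence are continuous).\<close>
definition Cinf_on :: "'a::real_normed_vector set \<Rightarrow> ('a \<Rightarrow> real) \<Rightarrow> bool" where
  "Cinf_on U f \<longleftrightarrow> (\<forall>vs. iter_dd vs f differentiable_on U)"

definition smooth_bounded_domain :: "'d::euclidean_space set \<Rightarrow> bool" where
  "smooth_bounded_domain \<Omega> \<longleftrightarrow> open \<Omega> \<and> bounded \<Omega> \<and> connected \<Omega> \<and> \<Omega> \<noteq> {} \<and>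
     (\<forall>z\<in>frontier \<Omega>. \<exists>U \<phi>. open U \<and> z \<in> U \<and> Cinf_on U \<phi> \<and>
        (\<forall>y\<in>U. frechet_derivative \<phi> (at y) \<noteq> (\<lambda>_. 0)) \<and>
        \<Omega> \<inter> U = {y\<in>U. \<phi> y < 0})"

definition sstar :: "(real \<Rightarrow> 'd \<Rightarrow> ereal) \<Rightarrow> real \<Rightarrow> 'd \<Rightarrow> real" where
  "sstar s p x = real_of_ereal (SUP z. ereal (p * z) - s z x)"

definition psd :: "(real \<Rightarrow> 'd::euclidean_space \<Rightarrow> ereal) \<Rightarrow> real \<Rightarrow> 'd \<Rightarrow> real" where
  "psd s p x = deriv (\<lambda>q. sstar s q x) p"

definition gxs :: "(real \<Rightarrow> 'd::euclidean_space \<Rightarrow> ereal) \<Rightarrow> real \<Rightarrow> 'd \<Rightarrow> 'd" where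
  "gxs s p x = (\<Sum>i\<in>Basis. frechet_derivative (\<lambda>y. sstar s p y) (at x) i *\<^sub>R i)"

definition subdiff :: "(real \<Rightarrow> 'd \<Rightarrow> ereal) \<Rightarrow> real \<Rightarrow> 'd \<Rightarrow> real set" where
  "subdiff s z x = {q. s z x \<noteq> \<infinity> \<and> (\<forall>w. s z x + ereal (q * (w - z)) \<le> s w x)}"

definition ess_sup_on :: "'d::euclidean_space set \<Rightarrow> ('d \<Rightarrow> real) \<Rightarrow> ereal" where
  "ess_sup_on \<Omega> f = Inf {c. AE x in lebesgue. x \<in> \<Omega> \<longrightarrow> ereal (f x) \<le> c}"

definition ess_inf_on :: "'d::euclidean_space set \<Rightarrow> ('d \<Rightarrow> real) \<Rightarrow> ereal" where
  "ess_inf_on \<Omega> f = Sup {c. AE x in lebesgue. x \<in> \<Omega> \<longrightarrow> c \<le> ereal (f x)}"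

definition hyp_s1 :: "'d set \<Rightarrow> (real \<Rightarrow> 'd \<Rightarrow> ereal) \<Rightarrow> bool" where
  "hyp_s1 \<Omega> s \<longleftrightarrow> (\<forall>x\<in>\<Omega>.
      (\<exists>z. s z x \<noteq> \<infinity>) \<and> (\<forall>z. s z x \<noteq> -\<infinity>) \<and>
      (\<forall>z. s z x \<le> Liminf (at z) (\<lambda>w. s w x)) \<and>
      (\<forall>a b t. 0 < t \<and> t < 1 \<longrightarrow>
          s (t * a + (1 - t) * b) x \<le> ereal t * s a x + ereal (1 - t) * s b x))"

definition hyp_s2 :: "'d set \<Rightarrow> (real \<Rightarrow> 'd \<Rightarrow> ereal) \<Rightarrow> bool" where
  "hyp_s2 \<Omega> s \<longleftrightarrow> (\<forall>x\<in>\<Omega>. \<forall>z<0. s z x = \<infinity>) \<and> (\<forall>x\<in>\<Omega>. s 0 x = 0) \<and>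
      (\<exists>c::real. \<forall>x\<in>\<Omega>. \<forall>z. ereal c \<le> s z x) \<and>
      ((\<lambda>z. (INF x\<in>\<Omega>. s z x) / ereal z) \<longlongrightarrow> \<infinity>) at_top"

definition hyp_s3 :: "'d::euclidean_space set \<Rightarrow> (real \<Rightarrow> 'd \<Rightarrow> ereal) \<Rightarrow> bool" where
  "hyp_s3 \<Omega> s \<longleftrightarrow>
      (\<forall>x\<in>\<Omega>. \<forall>p. (\<lambda>(q, y). sstar s q y) differentiable (at (p, x))) \<and>
      (\<forall>x\<in>\<Omega>. continuous_on UNIV (\<lambda>q. psd s q x) \<and> continuous_on UNIV (\<lambda>q. gxs s q x)) \<and>
      (\<forall>b::real. (\<integral>\<^sup>+ x. indicator \<Omega> x * (SUP q\<in>{..<b}. ennreal (norm (gxs s q x))) ^ 2 \<partial>lebesgue) < \<infinity>)"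

definition hyp_s4 :: "'d::euclidean_space set \<Rightarrow> (real \<Rightarrow> 'd \<Rightarrow> ereal) \<Rightarrow> bool" where
  "hyp_s4 \<Omega> s \<longleftrightarrow>
      ((\<lambda>\<alpha>. ess_sup_on \<Omega> (\<lambda>x. psd s \<alpha> x)) \<longlongrightarrow> 0) at_bot \<and>
      (\<exists>L::ereal. L > 0 \<and> ((\<lambda>\<alpha>. ess_inf_on \<Omega> (\<lambda>x. psd s \<alpha> x)) \<longlongrightarrow> L) at_top)"

definition hyp_s5 :: "'d::euclidean_space set \<Rightarrow> (real \<Rightarrow> 'd \<Rightarrow> ereal) \<Rightarrow> bool" where
  "hyp_s5 \<Omega> s \<longleftrightarrow> (\<forall>\<alpha>. \<exists>M::real. 0 < M \<and>
      ess_sup_on \<Omega> (\<lambda>x. psd s \<alpha> x) \<le> ereal M * ess_inf_on \<Omega> (\<lambda>x. psd s \<alpha> x))"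

definition dt :: "('d::euclidean_space \<times> real \<Rightarrow> real) \<Rightarrow> 'd \<times> real \<Rightarrow> real" where
  "dt \<phi> z = frechet_derivative \<phi> (at z) (0, 1)"

definition gradx :: "('d::euclidean_space \<times> real \<Rightarrow> real) \<Rightarrow> 'd \<times> real \<Rightarrow> 'd" where
  "gradx \<phi> z = (\<Sum>i\<in>Basis. frechet_derivative \<phi> (at z) (i, 0) *\<^sub>R i)"

definition weak_spatial_grad ::
  "('d::euclidean_space \<times> real) set \<Rightarrow> ('d \<times> real \<Rightarrow> real) \<Rightarrow> ('d \<times> real \<Rightarrow> 'd) \<Rightarrow> bool" where
  "weak_spatial_grad U u G \<longleftrightarrow>
     (\<forall>K. compact K \<and> K \<subseteq> U \<longrightarrow> set_integrable lebesgue K u \<and> set_integrable lebesgue K G) \<and>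
     (\<forall>\<phi>. Cinf_on UNIV \<phi> \<and> compact (closure {z. \<phi> z \<noteq> 0}) \<and> closure {z. \<phi> z \<noteq> 0} \<subseteq> U \<longrightarrow>
        (\<forall>i\<in>Basis. (LINT z:U|lebesgue. u z * (gradx \<phi> z \<bullet> i))
                     = - (LINT z:U|lebesgue. (G z \<bullet> i) * \<phi> z)))"

definition weak_identity ::
  "'d::euclidean_space set \<Rightarrow> ('d \<Rightarrow> real) \<Rightarrow> ('d \<times> real \<Rightarrow> real) \<Rightarrow> ('d \<times> real \<Rightarrow> 'd)
     \<Rightarrow> real \<Rightarrow> ('d \<times> real \<Rightarrow> real) \<Rightarrow> bool" where
  "weak_identity \<Omega> \<rho>0 \<rho> m t0 \<phi> \<longleftrightarrow>
     set_integrable lebesgue (\<Omega> \<times> {0..t0}) (\<lambda>z. \<rho> z * dt \<phi> z - m z \<bullet> gradx \<phi> z) \<and>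
     set_integrable lebesgue \<Omega> (\<lambda>x. \<rho> (x, t0) * \<phi> (x, t0)) \<and>
     set_integrable lebesgue \<Omega> (\<lambda>x. \<rho>0 x * \<phi> (x, 0)) \<and>
     (LINT z:\<Omega> \<times> {0..t0}|lebesgue. \<rho> z * dt \<phi> z - m z \<bullet> gradx \<phi> z)
       = (LINT x:\<Omega>|lebesgue. \<rho> (x, t0) * \<phi> (x, t0)) - (LINT x:\<Omega>|lebesgue. \<rho>0 x * \<phi> (x, 0))"

text \<open>(rho, p) is a weak solution of (P) with initial data rho0, and m is the
  associated flux  m = grad[s*(p(x,t),x)] - d_x s*(p(x,t),x).\<close>
definition weak_solution ::
  "(real \<Rightarrow> 'd::euclidean_space \<Rightarrow> ereal) \<Rightarrow> 'd set \<Rightarrow> ('d \<Rightarrow> real) \<Rightarrow>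
     ('d \<times> real \<Rightarrow> real) \<Rightarrow> ('d \<times> real \<Rightarrow> real) \<Rightarrow> ('d \<times> real \<Rightarrow> 'd) \<Rightarrow> bool" where
  "weak_solution s \<Omega> \<rho>0 \<rho> p m \<longleftrightarrow>
     weak_spatial_grad (\<Omega> \<times> {0<..}) (\<lambda>z. sstar s (p z) (fst z))
        (\<lambda>z. m z + gxs s (p z) (fst z)) \<and>
     (\<forall>T>0.
        set_borel_measurable lebesgue (\<Omega> \<times> {0..T}) \<rho> \<and>
        (\<exists>B. AE z in lebesgue. z \<in> \<Omega> \<times> {0..T} \<longrightarrow> \<bar>\<rho> z\<bar> \<le> B) \<and>
        set_borel_measurable lebesgue (\<Omega> \<times> {0..T}) p \<and>
        (\<exists>B. AE z in lebesgue. z \<in> \<Omega> \<times> {0..T} \<longrightarrow> \<bar>max (p z) 0\<bar> \<le> B) \<and>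
        (AE z in lebesgue. z \<in> \<Omega> \<times> {0..T} \<longrightarrow>
            p z \<in> subdiff s (\<rho> z) (fst z) \<and> \<rho> z = psd s (p z) (fst z)) \<and>
        set_borel_measurable lebesgue (\<Omega> \<times> {0..T}) m \<and>
        set_integrable lebesgue (\<Omega> \<times> {0..T}) (\<lambda>z. (norm (m z))\<^sup>2) \<and>
        (AE t0 in lborel. t0 \<in> {0..T} \<longrightarrow>
            (\<forall>\<phi>. Cinf_on UNIV \<phi> \<longrightarrow> weak_identity \<Omega> \<rho>0 \<rho> m t0 \<phi>)))"

end

(*
  Put u = s*(p1,x) - s*(p2,x), r = rho1 - rho2, M = m1 - m2, G = d_x s*(p1,x) - d_x s*(p2,x) and
  N(x,t) = int_0^t M(x,.).  Convexity and monotonicity of s* give r u >= 0, the extra hypothesis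
  gives |G|^2 <= C r u, and the weak gradient of u is M + G.  Time-independent test functions turn
  the weak formulation into div N(t) = r(t) with vanishing normal flux, so, after integrating over
  Omega x (0,t),
      int r u + 1/2 int |N(t)|^2 = - int G . N <= 1/2 int r u + C/2 int |N|^2.
  Gronwall yields N = 0 and r u = 0; N = 0 forces M = 0, and r u = 0 forces r = 0, because s* is
  constant between p1 and p2 wherever u = 0.

  Testing with u itself is not allowed: u is not smooth up to the boundary, and it has no regularity
  in time.  Instead the field N is tested against u, after a convolution in space-time with a
  kernel that pushes Omega into itself locally (and pushes time forward).  The kernel E(z - w)
  is an admissible test function in z for the weak gradient of u and, for a.e. time, in the space
  part of w for the equation of N, so nothing has to be known about the regularity of u or N.
*)
theory Submission
  imports Defs
begin

section \<open>Smooth functions\<close>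

text \<open>In the difference of the two weak formulations the initial data cancel, and a test
  function constant in time has no time derivative. Only the time integral of the flux survives, so
  the estimate is one for \<open>N\<close> and no time derivative of \<open>u\<close> or
  \<open>r\<close> is ever formed. The smoothness of the boundary enters through a whole ball of
  directions pointing into the domain near each point of its closure: the ball makes room for a
  kernel of positive radius. Likewise, data on (0,T+1) make room for the shift forward in time. The
  weights 1/2 and C/2 come from Young's inequality, tuned so that |G|^2/(2C) is at most ru/2. Half
  of the integral of ru is not absorbed, which is why ru = 0 can be read off once N = 0 is known.
  Two integrability facts are indirect. Only the positive part of each p is bounded, so
  \<open>u\<close> is bounded because \<open>sstar\<close> lies between 0 and a bound uniform in x
  as long as p stays below a constant. The gradient of \<open>u\<close> is square integrable because
  |M + G|^2 is at most 2|M|^2 + 2Cru.\<close>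

abbreviation dderiv :: "'a::real_normed_vector \<Rightarrow> ('a \<Rightarrow> real) \<Rightarrow> 'a \<Rightarrow> real" where
  "dderiv v f \<equiv> (\<lambda>x. frechet_derivative f (at x) v)"

lemma dderiv_eq: "(\<And>x. (f has_derivative D x) (at x)) \<Longrightarrow> dderiv v f = (\<lambda>x. D x v)"
  by (metis frechet_derivative_at)

text \<open>The recursion stacks new derivatives on the outside; smoothness of a directional
  derivative needs the first one split off on the inside.\<close>

lemma iter_dd_snoc: "iter_dd (vs @ [v]) f = iter_dd vs (dderiv v f)"
  by (induction vs) auto

text \<open>Smoothness by coinduction: a set of functions that is closed under directional derivatives
  consists of smooth functions. All closure properties below come from a suitable such set.\<close>

lemma Cinf_coinduct:
  assumes "f \<in> S"
    and S: "\<And>g. g \<in> S \<Longrightarrow> \<exists>D. (\<forall>x. (g has_derivative D x) (at x)) \<and> (\<forall>v. (\<lambda>x. D x v) \<in> S)"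
  shows "Cinf_on UNIV f"
proof -
  have "iter_dd vs f \<in> S" for vs
  proof (induction vs)
    case (Cons v vs)
    then obtain D where D: "\<And>x. (iter_dd vs f has_derivative D x) (at x)" "(\<lambda>x. D x v) \<in> S"
      using S by blast
    then show ?case by (simp add: dderiv_eq[OF D(1)])
  qed (use assms in simp)
  then show ?thesis unfolding Cinf_on_def
    by (metis S differentiableI differentiable_at_imp_differentiable_on)
qed

lemma Cinf_has_derivative:
  "Cinf_on UNIV f \<Longrightarrow> (f has_derivative frechet_derivative f (at x)) (at x)"
  unfolding Cinf_on_def
  by (metis UNIV_I differentiable_on_def frechet_derivative_works iter_dd.simps(1))

lemma Cinf_dderiv: "Cinf_on UNIV f \<Longrightarrow> Cinf_on UNIV (dderiv v f)"
  unfolding Cinf_on_def by (metis iter_dd_snoc)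

lemma Cinf_continuous_on: "Cinf_on UNIV f \<Longrightarrow> continuous_on A f"
  by (meson Cinf_has_derivative continuous_at_imp_continuous_on has_derivative_continuous)

lemma Cinf_const: "Cinf_on UNIV (\<lambda>x. c)"
proof (rule Cinf_coinduct[where S = "range (\<lambda>c x. c)"])
  fix g :: "'a \<Rightarrow> real" assume "g \<in> range (\<lambda>c x. c)"
  then obtain c where "g = (\<lambda>x. c)" by auto
  then show "\<exists>D. (\<forall>x. (g has_derivative D x) (at x)) \<and> (\<forall>v. (\<lambda>x. D x v) \<in> range (\<lambda>c x. c))"
    by (intro exI[of _ "\<lambda>_ _. 0"]) auto
qed auto

lemma Cinf_add:
  assumes "Cinf_on UNIV f" "Cinf_on UNIV g" shows "Cinf_on UNIV (\<lambda>x. f x + g x)"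
proof (rule Cinf_coinduct[where S = "{\<lambda>x. f x + g x | f g. Cinf_on UNIV f \<and> Cinf_on UNIV g}"])
  fix h :: "'a \<Rightarrow> real" assume "h \<in> {\<lambda>x. f x + g x | f g. Cinf_on UNIV f \<and> Cinf_on UNIV g}"
  then obtain f g where h: "h = (\<lambda>x. f x + g x)" "Cinf_on UNIV f" "Cinf_on UNIV g" by auto
  show "\<exists>D. (\<forall>x. (h has_derivative D x) (at x)) \<and>
      (\<forall>v. (\<lambda>x. D x v) \<in> {\<lambda>x. f x + g x | f g. Cinf_on UNIV f \<and> Cinf_on UNIV g})"
    by (intro exI[of _ "\<lambda>x v. dderiv v f x + dderiv v g x"])
      (use h in \<open>auto intro!: has_derivative_add Cinf_has_derivative Cinf_dderiv\<close>)
qed (use assms in blast)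

text \<open>Product, chain and quotient rules turn one term into a sum of terms of the same kind.
  Closing the class under addition keeps coinduction applicable, and linearity of the derivative
  reduces its hypothesis to the generators.\<close>

inductive_set sums_of :: "('a \<Rightarrow> real) set \<Rightarrow> ('a \<Rightarrow> real) set" for P where
  sums_base: "f \<in> P \<Longrightarrow> f \<in> sums_of P"
| sums_add: "f \<in> sums_of P \<Longrightarrow> g \<in> sums_of P \<Longrightarrow> (\<lambda>x. f x + g x) \<in> sums_of P"

lemma Cinf_coinduct_sums:
  assumes "f \<in> P"
    and P: "\<And>g. g \<in> P \<Longrightarrow> \<exists>D. (\<forall>x. (g has_derivative D x) (at x)) \<and> (\<forall>v. (\<lambda>x. D x v) \<in> sums_of P)"
  shows "Cinf_on UNIV f"
proof (rule Cinf_coinduct[where S = "sums_of P"])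
  fix g assume "g \<in> sums_of P"
  then show "\<exists>D. (\<forall>x. (g has_derivative D x) (at x)) \<and> (\<forall>v. (\<lambda>x. D x v) \<in> sums_of P)"
  proof induction
    case (sums_add f g)
    then obtain D E where "(\<forall>x. (f has_derivative D x) (at x)) \<and> (\<forall>v. (\<lambda>x. D x v) \<in> sums_of P)"
      "(\<forall>x. (g has_derivative E x) (at x)) \<and> (\<forall>v. (\<lambda>x. E x v) \<in> sums_of P)" by blast
    then show ?case
      by (intro exI[of _ "\<lambda>x v. D x v + E x v"]) (auto intro!: has_derivative_add sums_of.sums_add)
  qed (use P in blast)
qed (use assms in \<open>auto intro: sums_base\<close>)

lemma Cinf_mult:
  assumes "Cinf_on UNIV f" "Cinf_on UNIV g" shows "Cinf_on UNIV (\<lambda>x. f x * g x)"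
proof (rule Cinf_coinduct_sums[where P = "{\<lambda>x. f x * g x | f g. Cinf_on UNIV f \<and> Cinf_on UNIV g}"])
  let ?P = "{\<lambda>x. f x * g x | f g. Cinf_on UNIV f \<and> Cinf_on UNIV g} :: ('a \<Rightarrow> real) set"
  fix h assume "h \<in> ?P"
  then obtain f g where h: "h = (\<lambda>x. f x * g x)" "Cinf_on UNIV f" "Cinf_on UNIV g" by auto
  have *: "(\<lambda>x. f x * dderiv v g x + dderiv v f x * g x) \<in> sums_of ?P" for v
  proof (intro sums_add sums_base CollectI)
    show "\<exists>f' g'. (\<lambda>x. f x * dderiv v g x) = (\<lambda>x. f' x * g' x) \<and> Cinf_on UNIV f' \<and> Cinf_on UNIV g'"
      using h Cinf_dderiv by (intro exI[of _ f] exI[of _ "dderiv v g"]) simp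
    show "\<exists>f' g'. (\<lambda>x. dderiv v f x * g x) = (\<lambda>x. f' x * g' x) \<and> Cinf_on UNIV f' \<and> Cinf_on UNIV g'"
      using h Cinf_dderiv by (intro exI[of _ "dderiv v f"] exI[of _ g]) simp
  qed
  show "\<exists>D. (\<forall>x. (h has_derivative D x) (at x)) \<and> (\<forall>v. (\<lambda>x. D x v) \<in> sums_of ?P)"
    by (intro exI[of _ "\<lambda>x v. f x * dderiv v g x + dderiv v f x * g x"])
      (use h * in \<open>auto intro!: has_derivative_mult Cinf_has_derivative\<close>)
qed (use assms in blast)

text \<open>The affine form serves the translates of a kernel, its spatial slices y -> E(z - (y,s)),
  and functions of x alone regarded as functions of (x,t).\<close>

lemma Cinf_affine:
  fixes f :: "'b::real_normed_vector \<Rightarrow> real" and L :: "'a::real_normed_vector \<Rightarrow> 'b"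
  assumes "Cinf_on UNIV f" and L: "bounded_linear L"
  shows "Cinf_on UNIV (\<lambda>x. f (L x + b))"
proof (rule Cinf_coinduct[where S = "{\<lambda>x. f (L x + b) | f. Cinf_on UNIV f}"])
  fix h assume "h \<in> {\<lambda>x. f (L x + b) | f. Cinf_on UNIV f}"
  then obtain f where h: "h = (\<lambda>x. f (L x + b))" "Cinf_on UNIV f" by auto
  have "((\<lambda>x. f (L x + b)) has_derivative (\<lambda>v. frechet_derivative f (at (L x + b)) (L v))) (at x)" for x
    by (rule has_derivative_compose[OF _ Cinf_has_derivative[OF h(2)]])
      (auto intro!: derivative_eq_intros bounded_linear_imp_has_derivative L)
  moreover have "(\<lambda>x. dderiv (L v) f (L x + b)) \<in> {\<lambda>x. f (L x + b) | f. Cinf_on UNIV f}" for v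
    by (rule CollectI, rule exI[of _ "dderiv (L v) f"]) (use h in \<open>auto intro: Cinf_dderiv\<close>)
  ultimately show "\<exists>D. (\<forall>x. (h has_derivative D x) (at x)) \<and>
      (\<forall>v. (\<lambda>x. D x v) \<in> {\<lambda>x. f (L x + b) | f. Cinf_on UNIV f})"
    using h by (intro exI[of _ "\<lambda>x v. dderiv (L v) f (L x + b)"]) auto
qed (use assms in blast)

lemma Cinf_linear:
  assumes "bounded_linear L" shows "Cinf_on UNIV L"
proof (rule Cinf_coinduct[where S = "insert L (range (\<lambda>c x. c))"])
  fix g assume "g \<in> insert L (range (\<lambda>c x. c))"
  then consider "g = L" | c where "g = (\<lambda>x. c)" by auto
  then show "\<exists>D. (\<forall>x. (g has_derivative D x) (at x)) \<and> (\<forall>v. (\<lambda>x. D x v) \<in> insert L (range (\<lambda>c x. c)))"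
  proof cases
    case 1
    then show ?thesis using assms
      by (intro exI[of _ "\<lambda>x v. L v"]) (auto intro: bounded_linear_imp_has_derivative)
  next
    case 2
    then show ?thesis by (intro exI[of _ "\<lambda>_ _. 0"]) auto
  qed
qed auto

text \<open>The coefficient c in the class of functions c(x) H(q(x)) absorbs the inner derivatives
  thrown out by the chain rule; the outer derivative is always the one in direction 1, by linearity
  on the real line.\<close>

lemma Cinf_compose:
  fixes q :: "'a::real_normed_vector \<Rightarrow> real"
  assumes "Cinf_on UNIV H" and q: "Cinf_on UNIV q"
  shows "Cinf_on UNIV (\<lambda>x. H (q x))"
proof (rule Cinf_coinduct_sums[where P = "{\<lambda>x. c x * H (q x) | c H. Cinf_on UNIV c \<and> Cinf_on UNIV H}"])
  let ?P = "{\<lambda>x. c x * H (q x) | c H. Cinf_on UNIV c \<and> Cinf_on UNIV H}"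
  show "(\<lambda>x. H (q x)) \<in> ?P"
    using assms by (intro CollectI exI[of _ "\<lambda>x. 1"] exI[of _ H]) (simp add: Cinf_const)
  fix h assume "h \<in> ?P"
  then obtain c H where h: "h = (\<lambda>x. c x * H (q x))" "Cinf_on UNIV c" "Cinf_on UNIV H" by auto
  let ?D = "\<lambda>x v. c x * (dderiv v q x * dderiv 1 H (q x)) + dderiv v c x * H (q x)"
  have lin: "frechet_derivative H (at y) v = v * dderiv 1 H y" for y v
    using linear_scale[OF has_derivative_linear[OF Cinf_has_derivative[OF h(3), of y]], of v 1]
    by (simp only: real_scaleR_def mult_1_right)
  have "((\<lambda>x. c x * H (q x)) has_derivative
      (\<lambda>v. c x * frechet_derivative H (at (q x)) (dderiv v q x) + dderiv v c x * H (q x))) (at x)" for x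
    by (rule has_derivative_mult[OF Cinf_has_derivative[OF h(2)]
          has_derivative_compose[OF Cinf_has_derivative[OF q] Cinf_has_derivative[OF h(3)]]])
  then have "(h has_derivative ?D x) (at x)" for x
    unfolding h(1)
  proof (rule has_derivative_eq_rhs, intro ext)
    fix v
    show "c x * frechet_derivative H (at (q x)) (dderiv v q x) + dderiv v c x * H (q x) = ?D x v"
      by (subst lin[of "q x" "dderiv v q x"]) (rule refl)
  qed
  moreover have "(\<lambda>x. ?D x v) \<in> sums_of ?P" for v
  proof (intro sums_add sums_base CollectI)
    show "\<exists>c' H'. (\<lambda>x. c x * (dderiv v q x * dderiv 1 H (q x))) = (\<lambda>x. c' x * H' (q x)) \<and>
        Cinf_on UNIV c' \<and> Cinf_on UNIV H'"
      using Cinf_mult[OF h(2) Cinf_dderiv[OF q]] Cinf_dderiv[OF h(3)]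
      by (intro exI[of _ "\<lambda>x. c x * dderiv v q x"] exI[of _ "dderiv 1 H"]) (simp add: mult.assoc)
    show "\<exists>c' H'. (\<lambda>x. dderiv v c x * H (q x)) = (\<lambda>x. c' x * H' (q x)) \<and>
        Cinf_on UNIV c' \<and> Cinf_on UNIV H'"
      using h Cinf_dderiv by (intro exI[of _ "dderiv v c"] exI[of _ H]) simp
  qed
  ultimately show "\<exists>D. (\<forall>x. (h has_derivative D x) (at x)) \<and> (\<forall>v. (\<lambda>x. D x v) \<in> sums_of ?P)"
    by (intro exI[of _ ?D]) blast
qed

text \<open>Differentiating (1/f)^n raises the exponent by one, so all exponents are put into the
  coinduction class at once.\<close>

lemma Cinf_divide:
  fixes f :: "'a::real_normed_vector \<Rightarrow> real"
  assumes "Cinf_on UNIV g" and f: "Cinf_on UNIV f" and nz: "\<And>x. f x \<noteq> 0"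
  shows "Cinf_on UNIV (\<lambda>x. g x / f x)"
proof (rule Cinf_coinduct_sums[where P = "{\<lambda>x. g x * (1 / f x) ^ n | g n. Cinf_on UNIV g}"])
  let ?P = "{\<lambda>x. g x * (1 / f x) ^ n | g n. Cinf_on UNIV g}"
  fix h assume "h \<in> ?P"
  then obtain g n where h: "h = (\<lambda>x. g x * (1 / f x) ^ n)" "Cinf_on UNIV g" by auto
  let ?D = "\<lambda>x v. (- (real n * g x * dderiv v f x)) * (1 / f x) ^ Suc n + dderiv v g x * (1 / f x) ^ n"
  \<comment> \<open>For n = 0 the factor \<open>real n\<close> kills both sides, so the truncated
    exponent \<open>n - 1\<close> does no harm.\<close>
  have pw: "real n * (1 / y) ^ (n - 1) * (1 / y * (1 / y)) = real n * (1 / y) ^ Suc n" for y :: real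
    by (cases n) (auto simp: field_simps)
  have "(h has_derivative ?D x) (at x)" for x
  proof -
    have "((\<lambda>x. 1 / f x) has_derivative (\<lambda>v. - (dderiv v f x * (1 / f x * (1 / f x))))) (at x)"
      by (rule has_derivative_eq_rhs[OF has_derivative_divide[OF has_derivative_const
              Cinf_has_derivative[OF f] nz]])
        (auto simp: field_simps)
    from has_derivative_mult[OF Cinf_has_derivative[OF h(2)] has_derivative_power[OF this]]
    show ?thesis unfolding h(1)
    proof (rule has_derivative_eq_rhs, intro ext)
      fix v
      have "g x * (real n * - (dderiv v f x * (1 / f x * (1 / f x))) * (1 / f x) ^ (n - 1))
          = - (g x * dderiv v f x) * (real n * (1 / f x) ^ (n - 1) * (1 / f x * (1 / f x)))"
        by (simp add: algebra_simps)
      also have "\<dots> = - (real n * g x * dderiv v f x) * (1 / f x) ^ Suc n"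
        unfolding pw by simp
      finally show "g x * (real n * - (dderiv v f x * (1 / f x * (1 / f x))) * (1 / f x) ^ (n - 1)) +
          dderiv v g x * (1 / f x) ^ n = ?D x v" by simp
    qed
  qed
  moreover have "(\<lambda>x. ?D x v) \<in> sums_of ?P" for v
  proof (intro sums_add sums_base)
    have "Cinf_on UNIV (\<lambda>x. (-1) * (real n * g x * dderiv v f x))"
      by (intro Cinf_mult Cinf_dderiv Cinf_const h f)
    then show "(\<lambda>x. - (real n * g x * dderiv v f x) * (1 / f x) ^ Suc n) \<in> ?P"
      by (intro CollectI exI[of _ "\<lambda>x. - (real n * g x * dderiv v f x)"] exI[of _ "Suc n"]) simp
    show "(\<lambda>x. dderiv v g x * (1 / f x) ^ n) \<in> ?P"
      using h Cinf_dderiv by (intro CollectI exI[of _ "dderiv v g"] exI[of _ n]) simp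
  qed
  ultimately show "\<exists>D. (\<forall>x. (h has_derivative D x) (at x)) \<and> (\<forall>v. (\<lambda>x. D x v) \<in> sums_of ?P)"
    by (intro exI[of _ ?D]) blast
next
  show "(\<lambda>x. g x / f x) \<in> {\<lambda>x. g x * (1 / f x) ^ n | g n. Cinf_on UNIV g}"
    using assms by (intro CollectI exI[of _ g] exI[of _ "Suc 0"]) simp
qed

section \<open>A smooth function that is flat at zero, and the bumps and plateaus built from
  it\<close>

definition flat :: "real poly \<Rightarrow> real \<Rightarrow> real" where
  "flat p t = (if t > 0 then poly p (1 / t) * exp (- (1 / t)) else 0)"

lemma poly_exp_tendsto_0: "((\<lambda>y. poly p y * exp (- y)) \<longlongrightarrow> 0) (at_top :: real filter)"
proof -
  have "((\<lambda>y. \<Sum>i\<le>degree p. coeff p i * (y ^ i / exp y)) \<longlongrightarrow> (\<Sum>i\<le>degree p. coeff p i * 0)) (at_top :: real filter)"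
    by (intro tendsto_intros tendsto_power_div_exp_0)
  then show ?thesis
    by (simp add: poly_altdef exp_minus divide_inverse sum_distrib_right mult.assoc)
qed

lemma flat_tendsto_0: "(flat p \<longlongrightarrow> 0) (at 0)"
proof -
  have "((\<lambda>t. poly p (inverse t) * exp (- inverse t)) \<longlongrightarrow> 0) (at_right 0)"
    using filterlim_compose[OF poly_exp_tendsto_0 filterlim_inverse_at_top_right] .
  then have "(flat p \<longlongrightarrow> 0) (at_right 0)"
    by (rule Lim_transform_eventually)
      (auto simp: flat_def inverse_eq_divide eventually_at_right_less intro!: eventually_at_rightI[of 0 1])
  moreover have "(flat p \<longlongrightarrow> 0) (at_left 0)"
    by (rule Lim_transform_eventually[OF tendsto_const])
      (auto simp: flat_def intro!: eventually_at_leftI[of "-1"])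
  ultimately show ?thesis by (simp add: filterlim_split_at)
qed

text \<open>For positive t the derivative of P(1/t) exp(-1/t) is (P - P')(1/t) (1/t)^2 exp(-1/t),
  and \<open>[:0, 0, 1:]\<close> is the square of the variable. The family of all
  \<open>flat p\<close> is therefore closed under differentiation.\<close>

lemma has_real_derivative_flat:
  "(flat p has_real_derivative flat ((p - pderiv p) * [:0, 0, 1:]) t) (at t)"
proof (cases t "0 :: real" rule: linorder_cases)
  case less
  have "((\<lambda>_. 0 :: real) has_real_derivative 0) (at t)" by simp
  then have "(flat p has_real_derivative 0) (at t)"
    by (rule has_field_derivative_transform_within_open[where S = "{..<0}"])
      (use less in \<open>auto simp: flat_def\<close>)
  then show ?thesis using less by (simp add: flat_def)
next
  case equal
  \<comment> \<open>Dividing by h multiplies the polynomial in 1/h by its variable, so the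
    difference quotient at 0 is itself flat and tends to 0.\<close>
  have "((\<lambda>h. flat p h / h) \<longlongrightarrow> 0) (at 0)"
    by (rule Lim_transform_eventually[OF flat_tendsto_0[of "p * [:0, 1:]"]])
      (auto simp: flat_def eventually_at intro!: exI[of _ 1])
  then show ?thesis using equal by (simp add: DERIV_def flat_def)
next
  case greater
  have "((\<lambda>t. poly p (1 / t) * exp (- (1 / t))) has_real_derivative
      flat ((p - pderiv p) * [:0, 0, 1:]) t) (at t)"
    using greater unfolding flat_def
    by (auto intro!: derivative_eq_intros DERIV_chain2[of "poly p", OF poly_DERIV]
        simp: field_simps power2_eq_square)
  then show ?thesis
    by (rule has_field_derivative_transform_within_open[where S = "{0<..}"])
      (use greater in \<open>auto simp: flat_def\<close>)
qed

lemma Cinf_flat: "Cinf_on UNIV (flat p)"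
proof (rule Cinf_coinduct[where S = "range flat"])
  fix g assume "g \<in> range flat"
  then obtain p where g: "g = flat p" by auto
  \<comment> \<open>The direction v is moved into the polynomial, which keeps the directional
    derivative inside the range of \<open>flat\<close>.\<close>
  have "(g has_derivative (\<lambda>v. flat (smult v ((p - pderiv p) * [:0, 0, 1:])) t)) (at t)" for t
    using has_real_derivative_flat[of p t] unfolding g has_field_derivative_def
    by (rule has_derivative_eq_rhs) (auto simp: flat_def)
  then show "\<exists>D. (\<forall>x. (g has_derivative D x) (at x)) \<and> (\<forall>v. (\<lambda>x. D x v) \<in> range flat)"
    by (intro exI[of _ "\<lambda>t v. flat (smult v ((p - pderiv p) * [:0, 0, 1:])) t"]) auto
qed auto

text \<open>The two signs of \<open>\<beta>\<close> give functions positive inside a ball and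
  functions positive outside it.\<close>

lemma Cinf_dist_square:
  fixes a :: "'a::euclidean_space" shows "Cinf_on UNIV (\<lambda>x. \<alpha> + \<beta> * (dist x a)\<^sup>2)"
proof -
  have "Cinf_on UNIV (\<lambda>x :: 'a. x \<bullet> x)"
  proof (rule Cinf_coinduct[where S = "insert (\<lambda>x. x \<bullet> x) {f. Cinf_on UNIV f}"])
    fix g :: "'a \<Rightarrow> real" assume "g \<in> insert (\<lambda>x. x \<bullet> x) {f. Cinf_on UNIV f}"
    then consider "g = (\<lambda>x. x \<bullet> x)" | "Cinf_on UNIV g" by auto
    then show "\<exists>D. (\<forall>x. (g has_derivative D x) (at x)) \<and>
        (\<forall>v. (\<lambda>x. D x v) \<in> insert (\<lambda>x. x \<bullet> x) {f. Cinf_on UNIV f})"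
    proof cases
      case 1
      have "Cinf_on UNIV (\<lambda>x. x \<bullet> v + v \<bullet> x)" for v :: 'a
        by (intro Cinf_add Cinf_linear bounded_linear_inner_left bounded_linear_inner_right)
      then show ?thesis unfolding 1
        by (intro exI[of _ "\<lambda>x v. x \<bullet> v + v \<bullet> x"]) (auto intro!: derivative_eq_intros)
    next
      case 2
      then show ?thesis
        by (intro exI[of _ "\<lambda>x v. dderiv v g x"]) (auto intro: Cinf_has_derivative Cinf_dderiv)
    qed
  qed auto
  then have "Cinf_on UNIV (\<lambda>x. \<alpha> + \<beta> * (((x + - a) \<bullet> (x + - a))))"
    by (intro Cinf_add Cinf_mult Cinf_const Cinf_affine[where L = "\<lambda>x. x" and f = "\<lambda>x. x \<bullet> x"]
        bounded_linear_ident)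
  then show ?thesis by (simp add: dist_norm power2_norm_eq_inner)
qed

lemma bump_exists:
  fixes a :: "'a::euclidean_space" assumes "r > 0"
  obtains f where "Cinf_on UNIV f" "\<And>x. f x \<ge> 0" "\<And>x. f x > 0 \<longleftrightarrow> x \<in> ball a r"
proof
  let ?f = "\<lambda>x. flat 1 (r\<^sup>2 + (-1) * (dist x a)\<^sup>2)"
  show "Cinf_on UNIV ?f" by (intro Cinf_compose[OF Cinf_flat Cinf_dist_square])
  show "?f x \<ge> 0" for x by (simp add: flat_def)
  show "?f x > 0 \<longleftrightarrow> x \<in> ball a r" for x
  proof -
    have "(dist x a)\<^sup>2 < r\<^sup>2 \<longleftrightarrow> dist x a < r"
      using assms by (metis abs_of_nonneg abs_of_pos abs_square_less_1 power2_less_imp_less power_strict_mono zero_le_dist zero_less_numeral less_imp_le)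
    then show ?thesis by (auto simp: flat_def dist_commute)
  qed
qed

text \<open>The quotient h/(h + k), where h vanishes exactly from radius R outwards and k exactly up
  to radius r. Since r < R they have no common zero, so the denominator never vanishes.\<close>

lemma plateau_exists:
  fixes a :: "'a::euclidean_space" assumes "0 < r" "r < R"
  obtains f where "Cinf_on UNIV f" "\<And>x. x \<in> ball a r \<Longrightarrow> f x = 1" "\<And>x. x \<notin> ball a R \<Longrightarrow> f x = 0"
proof
  let ?h = "\<lambda>x. flat 1 (R\<^sup>2 + (-1) * (dist x a)\<^sup>2)"
  let ?k = "\<lambda>x. flat 1 (- r\<^sup>2 + 1 * (dist x a)\<^sup>2)"
  let ?f = "\<lambda>x. ?h x / (?h x + ?k x)"
  have h: "?h x \<ge> 0" "?h x = 0 \<longleftrightarrow> R \<le> dist x a" for x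
  proof -
    have "(dist x a)\<^sup>2 < R\<^sup>2 \<longleftrightarrow> dist x a < R"
      using assms by (metis less_trans power2_less_imp_less power_strict_mono zero_le_dist zero_less_numeral less_imp_le)
    then show "?h x \<ge> 0" "?h x = 0 \<longleftrightarrow> R \<le> dist x a" by (auto simp: flat_def)
  qed
  have k: "?k x \<ge> 0" "?k x = 0 \<longleftrightarrow> dist x a \<le> r" for x
  proof -
    have "r\<^sup>2 < (dist x a)\<^sup>2 \<longleftrightarrow> r < dist x a"
      using assms by (metis power2_less_imp_less power_strict_mono zero_le_dist zero_less_numeral less_imp_le)
    then show "?k x \<ge> 0" "?k x = 0 \<longleftrightarrow> dist x a \<le> r" by (auto simp: flat_def)
  qed
  have nz: "?h x + ?k x \<noteq> 0" for x
  proof (cases "R \<le> dist x a")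
    case True
    then have "?k x \<noteq> 0" using k(2)[of x] assms by linarith
    then show ?thesis using h(1)[of x] k(1)[of x] by linarith
  next
    case False
    then have "?h x \<noteq> 0" using h(2)[of x] by blast
    then show ?thesis using h(1)[of x] k(1)[of x] by linarith
  qed
  show "Cinf_on UNIV ?f"
    by (intro Cinf_divide Cinf_add Cinf_compose[OF Cinf_flat Cinf_dist_square] nz)
  show "?f x = 1" if "x \<in> ball a r" for x
    using nz[of x] k(2)[of x] that by (simp add: dist_commute)
  show "?f x = 0" if "x \<notin> ball a R" for x
    using h(2)[of x] that by (simp add: dist_commute)
qed

section \<open>Inward directions at the boundary\<close>

text \<open>At a boundary point choose v with negative derivative of the defining function. The
  derivative is jointly continuous in point and direction, so it stays negative for all points near
  z and all directions near v; along such a segment the function decreases and hence stays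
  negative.\<close>

lemma inward_direction:
  fixes \<Omega> :: "'d::euclidean_space set"
  assumes "smooth_bounded_domain \<Omega>" "z \<in> closure \<Omega>"
  obtains r v \<delta> e where "r > 0" "\<delta> > 0" "e > 0"
    "\<And>y w \<epsilon>. \<lbrakk>y \<in> \<Omega>; y \<in> ball z r; w \<in> cball v \<delta>; 0 < \<epsilon>; \<epsilon> < e\<rbrakk> \<Longrightarrow> y + \<epsilon> *\<^sub>R w \<in> \<Omega>"
proof (cases "z \<in> \<Omega>")
  case True
  have "open \<Omega>" using assms by (simp add: smooth_bounded_domain_def)
  then obtain r where r: "r > 0" "ball z r \<subseteq> \<Omega>" using True open_contains_ball by blast
  \<comment> \<open>At an interior point v = 0 and a ball of directions of radius 1 suffice, since a
    shift shorter than r/2 cannot leave the ball of radius r.\<close>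
  show thesis
  proof (rule that[of "r/2" 1 "r/2" 0])
    fix y w :: 'd and \<epsilon> :: real
    assume *: "y \<in> ball z (r/2)" "w \<in> cball 0 1" "0 < \<epsilon>" "\<epsilon> < r/2"
    have "norm (\<epsilon> *\<^sub>R w) \<le> \<epsilon> * 1"
      unfolding norm_scaleR using * by (intro mult_mono) auto
    moreover have "dist z (y + \<epsilon> *\<^sub>R w) \<le> norm (z - y) + norm (\<epsilon> *\<^sub>R w)"
      using norm_triangle_ineq4[of "z - y" "\<epsilon> *\<^sub>R w"] by (simp only: dist_norm diff_diff_add)
    moreover have "norm (z - y) < r / 2" using * by (simp add: dist_norm)
    ultimately have "dist z (y + \<epsilon> *\<^sub>R w) < r" using * by linarith
    then show "y + \<epsilon> *\<^sub>R w \<in> \<Omega>" using r by auto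
  qed (use r in auto)
next
  case False
  have op: "open \<Omega>" using assms by (simp add: smooth_bounded_domain_def)
  then have "z \<in> frontier \<Omega>" using assms False by (simp add: frontier_def interior_open)
  then obtain U \<phi> where U: "open U" "z \<in> U" "Cinf_on U \<phi>" 
    and nz: "frechet_derivative \<phi> (at z) \<noteq> (\<lambda>_. 0)" and \<Omega>U: "\<Omega> \<inter> U = {y\<in>U. \<phi> y < 0}"
    using assms(1) unfolding smooth_bounded_domain_def by blast
  have der: "(\<phi> has_derivative frechet_derivative \<phi> (at y)) (at y)" if "y \<in> U" for y
  proof -
    have "iter_dd [] \<phi> differentiable_on U" using U(3) unfolding Cinf_on_def by blast
    then have "\<phi> differentiable at y"
      using that U(1) by (simp add: differentiable_on_eq_differentiable_at)
    then show ?thesis using frechet_derivative_works by blast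
  qed
  have cont: "continuous (at y) (dderiv v \<phi>)" if "y \<in> U" for y v
  proof -
    have "iter_dd [v] \<phi> differentiable_on U" using U(3) unfolding Cinf_on_def by blast
    then have "(dderiv v \<phi>) differentiable at y"
      using that U(1) by (simp add: differentiable_on_eq_differentiable_at)
    then show ?thesis by (rule differentiable_imp_continuous_within)
  qed
  obtain v0 where "frechet_derivative \<phi> (at z) v0 \<noteq> 0" using nz by auto
  then obtain v where v: "frechet_derivative \<phi> (at z) v < 0"
    using linear_neg[OF has_derivative_linear[OF der[OF U(2)]], of v0]
    by (metis linorder_neqE_linordered_idom neg_less_0_iff_less)
  \<comment> \<open>Continuity in the base point is known only for each fixed direction. Expansion
    in the basis turns this into joint continuity in (y,w).\<close>
  have expand: "frechet_derivative \<phi> (at y) w = (\<Sum>i\<in>Basis. (w \<bullet> i) * frechet_derivative \<phi> (at y) i)"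
    if "y \<in> U" for y w
  proof -
    note lin = has_derivative_linear[OF der[OF that]]
    have "frechet_derivative \<phi> (at y) w = frechet_derivative \<phi> (at y) (\<Sum>i\<in>Basis. (w \<bullet> i) *\<^sub>R i)"
      by (simp add: euclidean_representation)
    then show ?thesis by (simp add: linear_sum[OF lin] linear_scale[OF lin])
  qed
  let ?G = "\<lambda>(y, w). \<Sum>i\<in>Basis. (w \<bullet> i) * frechet_derivative \<phi> (at y) i"
  have "(?G \<longlongrightarrow> ?G (z, v)) (nhds (z, v))"
  proof -
    have "((\<lambda>p. dderiv i \<phi> (fst p)) \<longlongrightarrow> dderiv i \<phi> (fst (z, v))) (at (z, v))" for i
      by (rule isCont_tendsto_compose[where g = "dderiv i \<phi>" and f = fst])
        (use cont[OF U(2)] in \<open>auto intro!: tendsto_eq_intros\<close>)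
    then have "(?G \<longlongrightarrow> ?G (z, v)) (at (z, v))"
      unfolding case_prod_unfold by (intro tendsto_intros) auto
    then show ?thesis by (rule tendsto_at_iff_tendsto_nhds[THEN iffD1])
  qed
  moreover have "?G (z, v) < 0" using v expand[OF U(2), of v] by simp
  ultimately have "\<forall>\<^sub>F p in nhds (z, v). ?G p < 0" by (rule order_tendstoD(2))
  then obtain d where d: "d > 0" "\<forall>p. dist p (z, v) < d \<longrightarrow> ?G p < 0"
    unfolding eventually_nhds_metric by (elim exE conjE)
  obtain d' where d': "d' > 0" "ball z d' \<subseteq> U" using U open_contains_ball by blast
  \<comment> \<open>Half of the minimum: two distances below \<open>\<eta>\<close> add up to less
    than d in the product, and \<open>\<eta>\<close> < d' keeps the base point in U.\<close>
  define \<eta> where "\<eta> = min d d' / 2"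
  have \<eta>: "\<eta> > 0" "\<eta> < d'" "2 * \<eta> \<le> d" using d(1) d'(1) by (auto simp: \<eta>_def)
  have neg: "frechet_derivative \<phi> (at y) w < 0" if "dist y z < \<eta>" "dist w v < \<eta>" for y w
  proof -
    have "dist (y, w) (z, v) \<le> dist y z + dist w v"
      unfolding dist_Pair_Pair using sqrt_sum_squares_le_sum_abs[of "dist y z" "dist w v"] by simp
    then have "?G (y, w) < 0" using that \<eta> by (intro d(2)[rule_format]) linarith
    moreover have "y \<in> U" using that \<eta> d' by (auto simp: dist_commute subset_iff)
    ultimately show ?thesis using expand by simp
  qed
  \<comment> \<open>Directions within \<open>\<eta>\<close>/2 of v have norm at most norm v +
    \<open>\<eta>\<close>, so this e limits the shift to \<open>\<eta>\<close>/2; starting within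
    \<open>\<eta>\<close>/2 of z, the segment stays within \<open>\<eta>\<close>.\<close>
  define e where "e = \<eta> / 2 / (norm v + \<eta>)"
  have "norm v + \<eta> > 0" using \<eta>(1) by (simp add: add_nonneg_pos)
  then have e: "e > 0" "e * (norm v + \<eta>) = \<eta> / 2"
    unfolding e_def using \<eta>(1) by (intro divide_pos_pos nonzero_eq_divide_eq[THEN iffD1]; simp)+
  show thesis
  proof (rule that[of "\<eta>/2" "\<eta>/2" e v])
    fix y w and \<epsilon> :: real
    assume y: "y \<in> \<Omega>" "y \<in> ball z (\<eta>/2)" and w: "w \<in> cball v (\<eta>/2)" and \<epsilon>: "0 < \<epsilon>" "\<epsilon> < e"
    have near: "dist (y + \<tau> *\<^sub>R w) z < \<eta>" if "0 \<le> \<tau>" "\<tau> \<le> \<epsilon>" for \<tau>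
    proof -
      have "norm w \<le> norm v + \<eta>"
        using w \<eta> norm_triangle_ineq2[of w v] by (auto simp: dist_norm norm_minus_commute)
      then have "norm (\<tau> *\<^sub>R w) \<le> e * (norm v + \<eta>)"
        using that \<epsilon> by (auto intro!: mult_mono)
      moreover have "dist (y + \<tau> *\<^sub>R w) z \<le> dist y z + norm (\<tau> *\<^sub>R w)"
        using norm_triangle_ineq[of "y - z" "\<tau> *\<^sub>R w"] unfolding dist_norm by (simp only: diff_add_eq)
      ultimately show ?thesis using y e by (simp add: dist_commute)
    qed
    have inU: "y + \<tau> *\<^sub>R w \<in> U" if "0 \<le> \<tau>" "\<tau> \<le> \<epsilon>" for \<tau>
      using near[OF that] d' \<eta> by (auto simp: dist_commute subset_iff)
    have "\<exists>D. ((\<lambda>\<tau>. \<phi> (y + \<tau> *\<^sub>R w)) has_real_derivative D) (at \<tau>) \<and> D < 0" if "0 \<le> \<tau>" "\<tau> \<le> \<epsilon>" for \<tau>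
    proof -
      have "((\<lambda>\<tau>. \<phi> (y + \<tau> *\<^sub>R w)) has_derivative (\<lambda>h. frechet_derivative \<phi> (at (y + \<tau> *\<^sub>R w)) (h *\<^sub>R w))) (at \<tau>)"
        by (rule has_derivative_compose[where f = "\<lambda>\<tau>. y + \<tau> *\<^sub>R w", OF _ der[OF inU[OF that]]])
          (auto intro!: derivative_eq_intros)
      then have "((\<lambda>\<tau>. \<phi> (y + \<tau> *\<^sub>R w)) has_real_derivative frechet_derivative \<phi> (at (y + \<tau> *\<^sub>R w)) w) (at \<tau>)"
        unfolding has_field_derivative_def
        by (rule has_derivative_eq_rhs)
          (simp add: fun_eq_iff linear_scale[OF has_derivative_linear[OF der[OF inU[OF that]]]] mult.commute)
      moreover have "dist w v < \<eta>" using w \<eta> by (simp add: dist_commute)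
      ultimately show ?thesis using neg[OF near[OF that]] by blast
    qed
    from DERIV_neg_imp_decreasing[OF \<epsilon>(1) this]
    have "\<phi> (y + \<epsilon> *\<^sub>R w) < \<phi> y" by simp
    moreover have mem: "x \<in> \<Omega> \<longleftrightarrow> \<phi> x < 0" if "x \<in> U" for x using \<Omega>U that by blast
    moreover have "y \<in> U" "y + \<epsilon> *\<^sub>R w \<in> U" using inU[of 0] inU[of \<epsilon>] \<epsilon>(1) by simp_all
    ultimately show "y + \<epsilon> *\<^sub>R w \<in> \<Omega>" using y(1) by simp
  qed (use \<eta> e in auto)
qed

section \<open>Mollification of square-integrable functions\<close>

lemmas integrable_dominated = Bochner_Integration.integrable_bound

text \<open>Integrability of f itself is demanded as well, because Fubini against a bounded kernel
  uses it. For bounded support it follows from square integrability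
  (\<open>L2_bounded_support\<close>).\<close>

definition L2fun :: "('a::euclidean_space \<Rightarrow> real) \<Rightarrow> bool" where
  "L2fun f \<longleftrightarrow> f \<in> borel_measurable borel \<and> integrable lborel f \<and> integrable lborel (\<lambda>x. (f x)\<^sup>2)"

lemma abs_mult_le_squares: "\<bar>a * b\<bar> \<le> a\<^sup>2 + b\<^sup>2" for a b :: real
proof -
  have "2 * (\<bar>a\<bar> * \<bar>b\<bar>) \<le> a\<^sup>2 + b\<^sup>2" using sum_squares_bound[of "\<bar>a\<bar>" "\<bar>b\<bar>"] by (simp add: mult.assoc)
  moreover have "0 \<le> \<bar>a\<bar> * \<bar>b\<bar>" by simp
  ultimately show ?thesis unfolding abs_mult by linarith
qed

lemma integrable_mult_L2:
  assumes "f \<in> borel_measurable M" "g \<in> borel_measurable M"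
    and "integrable M (\<lambda>x. (f x)\<^sup>2)" "integrable M (\<lambda>x. (g x)\<^sup>2 :: real)"
  shows "integrable M (\<lambda>x. f x * g x)"
proof (rule integrable_dominated[OF Bochner_Integration.integrable_add[OF assms(3,4)]])
  show "AE x in M. norm (f x * g x) \<le> norm ((f x)\<^sup>2 + (g x)\<^sup>2)"
    using abs_mult_le_squares by (auto intro: AE_I2)
qed (use assms in measurable)

lemma integrable_mult_bounded:
  fixes f k :: "'a \<Rightarrow> real"
  assumes f: "integrable M f" and k: "k \<in> borel_measurable M" and B: "\<And>x. \<bar>k x\<bar> \<le> B"
  shows "integrable M (\<lambda>x. f x * k x)"
proof (rule integrable_dominated)
  show "integrable M (\<lambda>x. B * f x)" using f by simp
  show "(\<lambda>x. f x * k x) \<in> borel_measurable M"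
    by (rule borel_measurable_times[OF borel_measurable_integrable[OF f] k])
  have "\<bar>f x * k x\<bar> \<le> \<bar>B * f x\<bar>" for x
    using mult_left_mono[OF order_trans[OF B[of x] abs_ge_self], of "\<bar>f x\<bar>"]
    by (simp add: abs_mult mult.commute)
  then show "AE x in M. norm (f x * k x) \<le> norm (B * f x)" by simp
qed

lemma integrable_lborel_product:
  fixes f :: "'a::euclidean_space \<Rightarrow> real" and g :: "'b::euclidean_space \<Rightarrow> real"
  assumes f: "integrable lborel f" and g: "integrable lborel g"
  shows "integrable (lborel \<Otimes>\<^sub>M lborel) (\<lambda>(x, y). f x * g y)"
proof (rule lborel_pair.Fubini_integrable)
  have [measurable]: "f \<in> borel_measurable borel" "g \<in> borel_measurable borel" using f g by auto
  show "(\<lambda>(x, y). f x * g y) \<in> borel_measurable (lborel \<Otimes>\<^sub>M lborel)" by measurable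
  show "integrable lborel (\<lambda>x. \<integral>y. norm (case (x, y) of (x, y) \<Rightarrow> f x * g y) \<partial>lborel)"
    using f g by (simp add: abs_mult)
  show "AE x in lborel. integrable lborel (\<lambda>y. case (x, y) of (x, y) \<Rightarrow> f x * g y)"
    using g by simp
qed

lemma integrable_reflect_translate:
  fixes f :: "'a::euclidean_space \<Rightarrow> real"
  assumes [measurable]: "f \<in> borel_measurable borel" and c: "c = 1 \<or> c = -1"
  shows "integrable lborel (\<lambda>x. f (a + c *\<^sub>R x)) \<longleftrightarrow> integrable lborel f"
    and "(\<integral>x. f (a + c *\<^sub>R x) \<partial>lborel) = (\<integral>x. f x \<partial>lborel)"
proof -
  have eq: "distr lborel borel (\<lambda>x. a + c *\<^sub>R x) = lborel"
    using lborel_affine[of c a] c by (auto simp: density_1)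
  show "integrable lborel (\<lambda>x. f (a + c *\<^sub>R x)) \<longleftrightarrow> integrable lborel f"
    using integrable_distr_eq[of "\<lambda>x. a + c *\<^sub>R x" lborel borel f] by (simp add: eq)
  show "(\<integral>x. f (a + c *\<^sub>R x) \<partial>lborel) = (\<integral>x. f x \<partial>lborel)"
    using integral_distr[of "\<lambda>x. a + c *\<^sub>R x" lborel borel f] by (simp add: eq)
qed

section \<open>Unit-mass kernels and convergence of mollification in the mean square\<close>

definition kernel :: "('a::euclidean_space \<Rightarrow> real) \<Rightarrow> bool" where
  "kernel E \<longleftrightarrow> E \<in> borel_measurable borel \<and> integrable lborel E \<and> (\<forall>h. E h \<ge> 0) \<and> integral\<^sup>L lborel E = 1"

lemma kernel_convolution_fst:
  fixes F :: "'a::euclidean_space \<Rightarrow> real"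
  assumes E: "kernel E" and F: "integrable lborel F"
  shows "integrable (lborel \<Otimes>\<^sub>M lborel) (\<lambda>(z, w). F z * E (z - w))"
    and "(\<integral>p. (case p of (z, w) \<Rightarrow> F z * E (z - w)) \<partial>(lborel \<Otimes>\<^sub>M lborel)) = integral\<^sup>L lborel F"
proof -
  have Em[measurable]: "E \<in> borel_measurable borel" and Fm[measurable]: "F \<in> borel_measurable lborel"
    using E F by (auto simp: kernel_def)
  have Ei: "integrable lborel (\<lambda>w. E (z - w))" "(\<integral>w. E (z - w) \<partial>lborel) = 1" for z
    using integrable_reflect_translate[OF Em, of "-1" z] E by (auto simp: kernel_def)
  show int: "integrable (lborel \<Otimes>\<^sub>M lborel) (\<lambda>(z, w). F z * E (z - w))"
  proof (rule lborel_pair.Fubini_integrable)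
    have "(\<lambda>z. \<integral>w. norm (case (z, w) of (z, w) \<Rightarrow> F z * E (z - w)) \<partial>lborel) = (\<lambda>z. \<bar>F z\<bar>)"
      using Ei E by (auto simp: abs_mult kernel_def)
    then show "integrable lborel (\<lambda>z. \<integral>w. norm (case (z, w) of (z, w) \<Rightarrow> F z * E (z - w)) \<partial>lborel)"
      using F by simp
    show "AE z in lborel. integrable lborel (\<lambda>w. case (z, w) of (z, w) \<Rightarrow> F z * E (z - w))"
      using Ei by auto
  qed measurable
  show "(\<integral>p. (case p of (z, w) \<Rightarrow> F z * E (z - w)) \<partial>(lborel \<Otimes>\<^sub>M lborel)) = integral\<^sup>L lborel F"
    using lborel_pair.integral_fst'[OF int] Ei by simp
qed

text \<open>The reflection of a kernel is a kernel, so swapping the two variables reduces this to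
  the previous lemma.\<close>

lemma kernel_convolution_snd:
  fixes F :: "'a::euclidean_space \<Rightarrow> real"
  assumes E: "kernel E" and F: "integrable lborel F"
  shows "integrable (lborel \<Otimes>\<^sub>M lborel) (\<lambda>(z, w). F w * E (z - w))"
    and "(\<integral>p. (case p of (z, w) \<Rightarrow> F w * E (z - w)) \<partial>(lborel \<Otimes>\<^sub>M lborel)) = integral\<^sup>L lborel F"
proof -
  have Em[measurable]: "E \<in> borel_measurable borel" and Fm[measurable]: "F \<in> borel_measurable lborel"
    using E F by (auto simp: kernel_def)
  have k: "kernel (\<lambda>h. E (- h))"
    using integrable_reflect_translate[OF Em, of "-1" 0] E by (auto simp: kernel_def)
  have int: "integrable (lborel \<Otimes>\<^sub>M lborel) (\<lambda>(z, w). F z * E (- (z - w)))"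
    and eq: "(\<integral>p. (case p of (z, w) \<Rightarrow> F z * E (- (z - w))) \<partial>(lborel \<Otimes>\<^sub>M lborel)) = integral\<^sup>L lborel F"
    using kernel_convolution_fst[OF k F] by auto
  show "integrable (lborel \<Otimes>\<^sub>M lborel) (\<lambda>(z, w). F w * E (z - w))"
    using lborel_pair.integrable_product_swap[OF int] by (simp add: case_prod_unfold)
  show "(\<integral>p. (case p of (z, w) \<Rightarrow> F w * E (z - w)) \<partial>(lborel \<Otimes>\<^sub>M lborel)) = integral\<^sup>L lborel F"
    using lborel_pair.integral_product_swap[of "\<lambda>(z, w). F z * E (- (z - w))"] eq
    by (simp add: case_prod_unfold)
qed

lemma L2_bounded_support:
  fixes f :: "'a::euclidean_space \<Rightarrow> real"
  assumes [measurable]: "f \<in> borel_measurable borel" and "integrable lborel (\<lambda>x. (f x)\<^sup>2)"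
    and S: "\<And>x. x \<notin> cball 0 R \<Longrightarrow> f x = 0"
  shows "L2fun f"
proof -
  have "integrable lborel (\<lambda>x. f x * indicator (cball 0 R) x)"
    by (rule integrable_mult_L2, measurable)
      (use assms in \<open>auto simp: power2_eq_square indicator_inter_arith[symmetric]
        intro!: integrable_real_indicator emeasure_bounded_finite\<close>)
  also have "(\<lambda>x. f x * indicator (cball 0 R) x) = f"
    using S by (auto simp: indicator_def fun_eq_iff)
  finally show ?thesis using assms by (simp add: L2fun_def)
qed

text \<open>Two stages, each with squared error below e/4, combined by (a+b)^2 <= 2a^2 + 2b^2.
  Clamping to [-k,k] makes f bounded. A measurable function is an a.e. limit of continuous ones;
  clamping these too and cutting them off outside radius R + 1 supplies the dominating function that
  upgrades a.e. convergence to convergence in the mean square.\<close>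

lemma continuous_dense_L2:
  fixes f :: "'a::euclidean_space \<Rightarrow> real"
  assumes fm[measurable]: "f \<in> borel_measurable borel" and f2: "integrable lborel (\<lambda>x. (f x)\<^sup>2)"
    and S: "\<And>x. x \<notin> cball 0 R \<Longrightarrow> f x = 0" and "e > 0"
  obtains \<phi> where "continuous_on UNIV \<phi>" "\<And>x. x \<notin> cball 0 (R + 1) \<Longrightarrow> \<phi> x = 0"
    "integrable lborel (\<lambda>x. (f x - \<phi> x)\<^sup>2)" "(\<integral>x. (f x - \<phi> x)\<^sup>2 \<partial>lborel) < e"
proof -
  define cl where "cl k t = max (- real k) (min (real k) t)" for k and t :: real
  have [measurable]: "cl k \<in> borel_measurable borel" for k unfolding cl_def by measurable
  have clb: "\<bar>cl k t\<bar> \<le> real k" for k t by (auto simp: cl_def)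
  have "(\<lambda>k. \<integral>x. (f x - cl k (f x))\<^sup>2 \<partial>lborel) \<longlonglongrightarrow> (\<integral>x. 0 \<partial>(lborel :: 'a measure))"
  proof (rule integral_dominated_convergence[OF _ _ f2])
    show "AE x in lborel. (\<lambda>k. (f x - cl k (f x))\<^sup>2) \<longlonglongrightarrow> 0"
    proof (rule AE_I2, rule tendsto_eventually)
      fix x
      obtain n where n: "\<bar>f x\<bar> \<le> real n" using real_arch_simple by blast
      show "\<forall>\<^sub>F k in sequentially. (f x - cl k (f x))\<^sup>2 = 0"
        using eventually_ge_at_top[of n] by eventually_elim (use n in \<open>auto simp: cl_def max_def min_def\<close>)
    qed
    show "AE x in lborel. norm ((f x - cl k (f x))\<^sup>2) \<le> (f x)\<^sup>2" for k
    proof (rule AE_I2)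
      fix x
      have "\<bar>f x - cl k (f x)\<bar> \<le> \<bar>f x\<bar>" by (auto simp: cl_def max_def min_def)
      then show "norm ((f x - cl k (f x))\<^sup>2) \<le> (f x)\<^sup>2" by (simp add: abs_le_square_iff)
    qed
  qed measurable
  then have "(\<lambda>k. \<integral>x. (f x - cl k (f x))\<^sup>2 \<partial>lborel) \<longlonglongrightarrow> 0" by simp
  then have "\<forall>\<^sub>F k in sequentially. (\<integral>x. (f x - cl k (f x))\<^sup>2 \<partial>lborel) < e / 4"
    using \<open>e > 0\<close> by (intro order_tendstoD) auto
  then obtain k where k: "(\<integral>x. (f x - cl k (f x))\<^sup>2 \<partial>lborel) < e / 4"
    by (meson eventually_sequentially order_refl)
  have i1: "integrable lborel (\<lambda>x. (f x - cl k (f x))\<^sup>2)"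
  proof (rule integrable_dominated[OF f2])
    show "AE x in lborel. norm ((f x - cl k (f x))\<^sup>2) \<le> norm ((f x)\<^sup>2)"
    proof (rule AE_I2)
      fix x
      have "\<bar>f x - cl k (f x)\<bar> \<le> \<bar>f x\<bar>" by (auto simp: cl_def max_def min_def)
      then show "norm ((f x - cl k (f x))\<^sup>2) \<le> norm ((f x)\<^sup>2)" by (simp add: abs_le_square_iff)
    qed
  qed measurable
  have "f measurable_on UNIV"
    by (rule lebesgue_measurable_imp_measurable_on) (auto intro!: measurable_completion)
  then obtain N g where N: "negligible N" and g: "\<And>n. continuous_on UNIV (g n)"
    "\<And>x. x \<notin> N \<Longrightarrow> (\<lambda>n. g n x) \<longlonglongrightarrow> f x"
    unfolding measurable_on_def by auto
  have [measurable]: "g n \<in> borel_measurable borel" for n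
    using g(1) by (rule borel_measurable_continuous_onI)
  have AEg: "AE x in lborel. (\<lambda>n. g n x) \<longlonglongrightarrow> f x"
  proof -
    have "AE x in lebesgue. x \<notin> N"
      using N by (simp add: AE_not_in negligible_iff_null_sets)
    then have "AE x in lebesgue. (\<lambda>n. g n x) \<longlonglongrightarrow> f x"
      by eventually_elim (use g in auto)
    then show ?thesis by (simp add: AE_completion_iff)
  qed
  define cut :: "'a \<Rightarrow> real" where "cut x = max 0 (min 1 (R + 1 - norm x))" for x
  have cut: "0 \<le> cut x" "cut x \<le> 1" "x \<in> cball 0 R \<Longrightarrow> cut x = 1" "x \<notin> cball 0 (R + 1) \<Longrightarrow> cut x = 0" for x
    by (auto simp: cut_def)
  have cutc: "continuous_on UNIV cut" unfolding cut_def by (intro continuous_intros)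
  have [measurable]: "cut \<in> borel_measurable borel" using cutc by (rule borel_measurable_continuous_onI)
  define \<phi> where "\<phi> n x = cl k (g n x) * cut x" for n x
  have \<phi>c: "continuous_on UNIV (\<phi> n)" for n
    unfolding \<phi>_def cl_def by (intro continuous_intros g cutc)
  have [measurable]: "\<phi> n \<in> borel_measurable borel" for n using \<phi>c by (rule borel_measurable_continuous_onI)
  have cl0: "cl k 0 = 0" by (simp add: cl_def)
  have bd: "norm ((cl k (f x) - \<phi> n x)\<^sup>2) \<le> (2 * real k)\<^sup>2 * indicator (cball 0 (R + 1)) x" for n x
  proof (cases "x \<in> cball 0 (R + 1)")
    case True
    have "\<bar>\<phi> n x\<bar> \<le> real k * 1"
      unfolding \<phi>_def abs_mult using clb cut by (intro mult_mono) auto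
    then have "\<bar>cl k (f x) - \<phi> n x\<bar> \<le> 2 * real k" using clb[of k "f x"] by linarith
    then have "(cl k (f x) - \<phi> n x)\<^sup>2 \<le> (2 * real k)\<^sup>2" by (intro abs_le_square_iff[THEN iffD1]) simp
    then show ?thesis using True by simp
  next
    case False
    then show ?thesis using S[of x] cut(4)[of x] by (auto simp: \<phi>_def cl0)
  qed
  have ib: "integrable lborel (\<lambda>x. (2 * real k)\<^sup>2 * indicator (cball 0 (R + 1) :: 'a set) x :: real)"
    by (intro integrable_mult_right integrable_real_indicator emeasure_bounded_finite) auto
  have "(\<lambda>n. \<integral>x. (cl k (f x) - \<phi> n x)\<^sup>2 \<partial>lborel) \<longlonglongrightarrow> (\<integral>x. 0 \<partial>(lborel :: 'a measure))"
  proof (rule integral_dominated_convergence[OF _ _ ib])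
    show "AE x in lborel. (\<lambda>n. (cl k (f x) - \<phi> n x)\<^sup>2) \<longlonglongrightarrow> 0"
      using AEg
    proof eventually_elim
      case (elim x)
      have "(\<lambda>n. cl k (g n x)) \<longlonglongrightarrow> cl k (f x)"
        unfolding cl_def by (intro tendsto_intros elim)
      then have "(\<lambda>n. \<phi> n x) \<longlonglongrightarrow> cl k (f x) * cut x"
        unfolding \<phi>_def by (intro tendsto_intros)
      also have "cl k (f x) * cut x = cl k (f x)"
        using cut(3)[of x] S[of x] cl0 by (cases "x \<in> cball 0 R") auto
      finally have "(\<lambda>n. (cl k (f x) - \<phi> n x)\<^sup>2) \<longlonglongrightarrow> (cl k (f x) - cl k (f x))\<^sup>2"
        by (intro tendsto_intros)
      then show ?case by simp
    qed
  qed (use bd in auto)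
  then have "(\<lambda>n. \<integral>x. (cl k (f x) - \<phi> n x)\<^sup>2 \<partial>lborel) \<longlonglongrightarrow> 0" by simp
  then have "\<forall>\<^sub>F n in sequentially. (\<integral>x. (cl k (f x) - \<phi> n x)\<^sup>2 \<partial>lborel) < e / 4"
    using \<open>e > 0\<close> by (intro order_tendstoD) auto
  then obtain n where n: "(\<integral>x. (cl k (f x) - \<phi> n x)\<^sup>2 \<partial>lborel) < e / 4"
    by (meson eventually_sequentially order_refl)
  have i2: "integrable lborel (\<lambda>x. (cl k (f x) - \<phi> n x)\<^sup>2)"
    by (rule integrable_dominated[OF ib]) (use bd[of _ n] in \<open>auto intro: order_trans\<close>)
  have i3: "integrable lborel (\<lambda>x. 2 * (f x - cl k (f x))\<^sup>2 + 2 * (cl k (f x) - \<phi> n x)\<^sup>2)"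
    using i1 i2 by auto
  have le: "(f x - \<phi> n x)\<^sup>2 \<le> 2 * (f x - cl k (f x))\<^sup>2 + 2 * (cl k (f x) - \<phi> n x)\<^sup>2" for x
  proof -
    have "0 \<le> ((f x - cl k (f x)) - (cl k (f x) - \<phi> n x))\<^sup>2" by simp
    then show ?thesis by (simp add: power2_eq_square algebra_simps)
  qed
  have i4: "integrable lborel (\<lambda>x. (f x - \<phi> n x)\<^sup>2)"
    by (rule integrable_dominated[OF i3]) (use le in \<open>auto intro: order_trans\<close>)
  have "(\<integral>x. (f x - \<phi> n x)\<^sup>2 \<partial>lborel)
      \<le> (\<integral>x. 2 * (f x - cl k (f x))\<^sup>2 + 2 * (cl k (f x) - \<phi> n x)\<^sup>2 \<partial>lborel)"
    by (rule integral_mono[OF i4 i3 le])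
  also have "\<dots> < e" using i1 i2 k n by simp
  finally show thesis
    by (intro that[of "\<phi> n"] \<phi>c i4) (use cut(4) in \<open>auto simp: \<phi>_def\<close>)
qed

text \<open>With \<open>\<phi>\<close> continuous and close to f, write f(z) - f(w) = (f -
  \<open>\<phi>\<close>)(z) + (\<open>\<phi>\<close>(z) - \<open>\<phi>\<close>(w)) - (f -
  \<open>\<phi>\<close>)(w). After Young's inequality every error term depends on z alone or on w
  alone, so the unit mass of the kernel integrates the other variable away. Hence d depends on f, g
  and e but not on the kernel.\<close>

lemma kernel_approx:
  fixes f g :: "'a::euclidean_space \<Rightarrow> real"
  assumes f: "f \<in> borel_measurable borel" "integrable lborel (\<lambda>x. (f x)\<^sup>2)"
    and S: "\<And>x. x \<notin> cball 0 R \<Longrightarrow> f x = 0" and g: "L2fun g" and "e > 0"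
  obtains d where "d > 0" "\<And>E. \<lbrakk>kernel E; \<And>h. E h \<noteq> 0 \<Longrightarrow> norm h < d\<rbrakk> \<Longrightarrow>
    \<bar>(\<integral>p. (case p of (z, w) \<Rightarrow> f z * g w * E (z - w)) \<partial>(lborel \<Otimes>\<^sub>M lborel)) - (\<integral>x. f x * g x \<partial>lborel)\<bar> < e"
proof -
  have [measurable]: "f \<in> borel_measurable borel" "g \<in> borel_measurable borel" using f g by (auto simp: L2fun_def)
  have gi: "integrable lborel g" "integrable lborel (\<lambda>x. (g x)\<^sup>2)" using g by (auto simp: L2fun_def)
  define A where "A = (\<integral>x. (g x)\<^sup>2 \<partial>lborel) + 1"
  define B where "B = (\<integral>x. \<bar>g x\<bar> \<partial>lborel) + 1"
  have AB: "A > 0" "B > 0" "(\<integral>x. (g x)\<^sup>2 \<partial>lborel) \<le> A" "(\<integral>x. \<bar>g x\<bar> \<partial>lborel) \<le> B"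
    unfolding A_def B_def by (auto intro!: add_nonneg_pos)
  \<comment> \<open>The weight in Young's inequality. With the squared distance of f and
    \<open>\<phi>\<close> below e/(4a) and the oscillation of \<open>\<phi>\<close> at most e/(4B),
    the errors are e/4, A/a = e/2 and e/4.\<close>
  define a where "a = 2 * A / e"
  have a: "a > 0" "A / a = e / 2" using AB \<open>e > 0\<close> by (auto simp: a_def)
  obtain \<phi> where \<phi>: "continuous_on UNIV \<phi>" "\<And>x. x \<notin> cball 0 (R + 1) \<Longrightarrow> \<phi> x = 0"
    "integrable lborel (\<lambda>x. (f x - \<phi> x)\<^sup>2)" "(\<integral>x. (f x - \<phi> x)\<^sup>2 \<partial>lborel) < e / (4 * a)"
    using continuous_dense_L2[OF f S, of R "e / (4 * a)"] \<open>e > 0\<close> a by auto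
  have [measurable]: "\<phi> \<in> borel_measurable borel" using \<phi>(1) by (rule borel_measurable_continuous_onI)
  have eB: "e / (4 * B) > 0" using AB \<open>e > 0\<close> by simp
  \<comment> \<open>Radius R + 3 suffices for all of space: since d <= 1, a point outside radius R +
    2 has only neighbours outside radius R + 1, where \<open>\<phi>\<close> is zero.\<close>
  have "uniformly_continuous_on (cball 0 (R + 3)) \<phi>"
    using \<phi>(1) by (intro compact_uniformly_continuous) (auto intro: continuous_on_subset)
  then obtain d0 where d0: "d0 > 0" "\<And>x x'. x \<in> cball 0 (R + 3) \<Longrightarrow> x' \<in> cball 0 (R + 3) \<Longrightarrow>
      dist x' x < d0 \<Longrightarrow> dist (\<phi> x') (\<phi> x) < e / (4 * B)"
    using eB unfolding uniformly_continuous_on_def by meson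
  define d where "d = min d0 1"
  have d: "d > 0" "dist x' x < d \<Longrightarrow> dist (\<phi> x') (\<phi> x) < e / (4 * B)" for x x'
  proof -
    show "d > 0" using d0(1) by (simp add: d_def)
    assume *: "dist x' x < d"
    show "dist (\<phi> x') (\<phi> x) < e / (4 * B)"
    proof (cases "x \<in> cball 0 (R + 2)")
      case True
      then have "x' \<in> cball 0 (R + 3)"
        using * norm_triangle_ineq[of "x' - x" x] by (simp add: dist_norm d_def)
      then show ?thesis using True * by (intro d0) (auto simp: d_def)
    next
      case False
      then have "x' \<notin> cball 0 (R + 1)"
        using * norm_triangle_ineq2[of x "x'"] by (simp add: dist_norm norm_minus_commute d_def)
      then show ?thesis using \<phi>(2) False eB by simp
    qed
  qed
  show thesis
  proof (rule that[OF d(1)])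
    fix E :: "'a \<Rightarrow> real" assume E: "kernel E" and supp: "\<And>h. E h \<noteq> 0 \<Longrightarrow> norm h < d"
    have [measurable]: "E \<in> borel_measurable borel" and E0: "E h \<ge> 0" for h using E by (auto simp: kernel_def)
    let ?P = "lborel \<Otimes>\<^sub>M lborel :: ('a \<times> 'a) measure"
    let ?J = "\<lambda>p :: 'a \<times> 'a. case p of (z, w) \<Rightarrow> f z * g w * E (z - w)"
    note cf = kernel_convolution_fst[OF E \<phi>(3)]
    note cg = kernel_convolution_snd[OF E gi(2)]
    note cg1 = kernel_convolution_snd[OF E integrable_abs[OF gi(1)]]
    have i_fg: "integrable ?P (\<lambda>(z, w). f w * g w * E (z - w))"
      and e_fg: "(\<integral>p. (case p of (z, w) \<Rightarrow> f w * g w * E (z - w)) \<partial>?P) = (\<integral>x. f x * g x \<partial>lborel)"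
      using kernel_convolution_snd[OF E integrable_mult_L2[OF _ _ f(2) gi(2)]] by auto
    have i_f: "integrable ?P (\<lambda>(z, w). (f z)\<^sup>2 * E (z - w))" using kernel_convolution_fst[OF E f(2)] by simp
    note cf' = kernel_convolution_snd[OF E \<phi>(3)]
    let ?D = "\<lambda>p :: 'a \<times> 'a. case p of (z, w) \<Rightarrow> 
        (a / 2) * ((f z - \<phi> z)\<^sup>2 * E (z - w)) + (a / 2) * ((f w - \<phi> w)\<^sup>2 * E (z - w)) + (1 / a) * ((g w)\<^sup>2 * E (z - w))
          + e / (4 * B) * (\<bar>g w\<bar> * E (z - w))"
    have iJ: "integrable ?P ?J"
    proof (rule integrable_dominated[OF Bochner_Integration.integrable_add[OF i_f cg(1)]])
      have "\<bar>f z * g w * E (z - w)\<bar> \<le> (f z)\<^sup>2 * E (z - w) + (g w)\<^sup>2 * E (z - w)" for z w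
      proof -
        from mult_right_mono[OF abs_mult_le_squares[of "f z" "g w"] E0[of "z - w"]] show ?thesis
          using E0[of "z - w"] by (simp add: abs_mult distrib_right)
      qed
      then show "AE p in ?P. norm (?J p) \<le> norm ((case p of (z, w) \<Rightarrow> (f z)\<^sup>2 * E (z - w)) + (case p of (z, w) \<Rightarrow> (g w)\<^sup>2 * E (z - w)))"
        by (auto intro!: AE_I2 order_trans[OF _ abs_ge_self])
    qed measurable
    have iD: "integrable ?P ?D"
      unfolding case_prod_unfold
      using cf(1) cf'(1) cg(1) cg1(1) unfolding case_prod_unfold by auto
    have pw: "\<bar>f z * g w * E (z - w) - f w * g w * E (z - w)\<bar> \<le> ?D (z, w)" for z w
    proof (cases "E (z - w) = 0")
      case False
      then have "dist z w < d" using supp by (simp add: dist_norm)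
      then have 1: "\<bar>\<phi> z - \<phi> w\<bar> \<le> e / (4 * B)" using d(2)[of z w] by (simp add: dist_norm)
      have am: "\<bar>x * y\<bar> \<le> (a / 2) * x\<^sup>2 + (1 / (2 * a)) * y\<^sup>2" for x y :: real
      proof -
        have "0 \<le> (a * \<bar>x\<bar> - \<bar>y\<bar>)\<^sup>2 / (2 * a)" using a by simp
        also have "\<dots> = (a / 2) * x\<^sup>2 + (1 / (2 * a)) * y\<^sup>2 - \<bar>x\<bar> * \<bar>y\<bar>"
          using a by (simp add: power2_diff power_mult_distrib) (simp add: field_simps power2_eq_square)
        finally show ?thesis by (simp add: abs_mult)
      qed
      have "\<bar>f z * g w - f w * g w\<bar> = \<bar>(f z - \<phi> z) * g w + (\<phi> z - \<phi> w) * g w - (f w - \<phi> w) * g w\<bar>"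
        by (simp add: algebra_simps)
      also have "\<dots> \<le> \<bar>(f z - \<phi> z) * g w\<bar> + \<bar>(\<phi> z - \<phi> w) * g w\<bar> + \<bar>(f w - \<phi> w) * g w\<bar>" by linarith
      also have "\<dots> \<le> ((a / 2) * (f z - \<phi> z)\<^sup>2 + (1 / (2 * a)) * (g w)\<^sup>2) + e / (4 * B) * \<bar>g w\<bar>
          + ((a / 2) * (f w - \<phi> w)\<^sup>2 + (1 / (2 * a)) * (g w)\<^sup>2)"
        unfolding abs_mult[of "\<phi> z - \<phi> w"] by (intro add_mono am mult_right_mono 1) auto
      also have "\<dots> = (a / 2) * (f z - \<phi> z)\<^sup>2 + (a / 2) * (f w - \<phi> w)\<^sup>2 + (1 / a) * (g w)\<^sup>2 + e / (4 * B) * \<bar>g w\<bar>"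
        by (simp add: field_simps)
      finally have "\<bar>f z * g w - f w * g w\<bar> * E (z - w) \<le> \<dots> * E (z - w)"
        using E0 by (intro mult_right_mono) auto
      moreover have "\<bar>f z * g w * E (z - w) - f w * g w * E (z - w)\<bar> = \<bar>f z * g w - f w * g w\<bar> * E (z - w)"
        using E0[of "z - w"] by (simp add: left_diff_distrib[symmetric] abs_mult)
      ultimately show ?thesis by (simp add: distrib_right mult.assoc)
    qed simp
    have "\<bar>(\<integral>p. ?J p \<partial>?P) - (\<integral>x. f x * g x \<partial>lborel)\<bar>
        = \<bar>\<integral>p. ?J p - (case p of (z, w) \<Rightarrow> f w * g w * E (z - w)) \<partial>?P\<bar>"
      unfolding Bochner_Integration.integral_diff[OF iJ i_fg] e_fg ..
    also have "\<dots> \<le> (\<integral>p. ?D p \<partial>?P)"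
      using pw by (intro order_trans[OF integral_abs_bound integral_mono] integrable_abs
        Bochner_Integration.integrable_diff iJ i_fg iD) (auto split: prod.split)
    also have "\<dots> = (a / 2) * (\<integral>x. (f x - \<phi> x)\<^sup>2 \<partial>lborel) + (a / 2) * (\<integral>x. (f x - \<phi> x)\<^sup>2 \<partial>lborel)
        + (1 / a) * (\<integral>x. (g x)\<^sup>2 \<partial>lborel) + e / (4 * B) * (\<integral>x. \<bar>g x\<bar> \<partial>lborel)"
      using cf cf' cg cg1 unfolding case_prod_unfold by simp
    also have "\<dots> < e / 4 + e / 2 + e / 4"
    proof -
      have "a * (\<integral>x. (f x - \<phi> x)\<^sup>2 \<partial>lborel) < e / 4"
        using mult_strict_left_mono[OF \<phi>(4) a(1)] a by simp
      moreover have "(1 / a) * (\<integral>x. (g x)\<^sup>2 \<partial>lborel) \<le> (1 / a) * A" using AB a by (intro mult_left_mono) auto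
      moreover have "e / (4 * B) * (\<integral>x. \<bar>g x\<bar> \<partial>lborel) \<le> e / (4 * B) * B"
        using AB \<open>e > 0\<close> by (intro mult_left_mono) auto
      ultimately show ?thesis using a AB by simp
    qed
    finally show "\<bar>(\<integral>p. ?J p \<partial>?P) - (\<integral>x. f x * g x \<partial>lborel)\<bar> < e" by simp
  qed
qed

lemma Cinf_borel: "Cinf_on UNIV f \<Longrightarrow> f \<in> borel_measurable borel" for f :: "'a::euclidean_space \<Rightarrow> real"
  by (intro borel_measurable_continuous_onI Cinf_continuous_on)

lemma Cinf_continuous_on_fst:
  "Cinf_on UNIV \<psi> \<Longrightarrow> continuous_on UNIV (\<lambda>w :: 'a::euclidean_space \<times> real. \<psi> (fst w))"
  using Cinf_affine[OF _ bounded_linear_fst, of \<psi> 0] Cinf_continuous_on by fastforce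

lemma dderiv_eq_0_outside:
  fixes f :: "'a::real_normed_vector \<Rightarrow> real"
  assumes "open U" "x \<in> U" "\<And>y. y \<in> U \<Longrightarrow> f y = 0"
  shows "dderiv v f x = 0"
proof -
  have "(f has_derivative (\<lambda>_. 0)) (at x)"
    by (rule has_derivative_transform_within_open[OF has_derivative_const assms(1,2)]) (use assms in auto)
  then show ?thesis by (metis frechet_derivative_at)
qed

lemma bounded_of_compact_support:
  fixes f :: "'a::euclidean_space \<Rightarrow> real"
  assumes "continuous_on UNIV f" "compact K" "\<And>x. x \<notin> K \<Longrightarrow> f x = 0"
  obtains B where "\<And>x. \<bar>f x\<bar> \<le> B"
proof -
  have "bounded (f ` K)"
    using assms by (intro compact_imp_bounded compact_continuous_image) (auto intro: continuous_on_subset)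
  then obtain B where "\<And>x. x \<in> K \<Longrightarrow> \<bar>f x\<bar> \<le> B" unfolding bounded_iff by auto
  then have "\<bar>f x\<bar> \<le> max B 0" for x using assms(3)[of x] by (cases "x \<in> K") (auto intro: le_max_iff_disj[THEN iffD2])
  then show thesis by (rule that)
qed

lemma L2fun_mult_continuous:
  fixes f c :: "'a::euclidean_space \<Rightarrow> real"
  assumes f: "L2fun f" and c: "continuous_on UNIV c" and S: "\<And>x. x \<notin> cball 0 R \<Longrightarrow> f x = 0"
  shows "L2fun (\<lambda>x. f x * c x)"
proof -
  have [measurable]: "f \<in> borel_measurable borel" "c \<in> borel_measurable borel"
    using f c by (auto simp: L2fun_def borel_measurable_continuous_onI)
  have "bounded (c ` cball 0 R)"
    using c by (intro compact_imp_bounded compact_continuous_image) (auto intro: continuous_on_subset)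
  then obtain B where "\<forall>y\<in>c ` cball 0 R. norm y \<le> B" unfolding bounded_iff by blast
  then have B: "\<bar>c x\<bar> \<le> B" if "x \<in> cball 0 R" for x using that by (metis imageI real_norm_def)
  have le: "\<bar>f x * c x\<bar> \<le> \<bar>B * f x\<bar>" for x
  proof (cases "x \<in> cball 0 R")
    case True
    have "\<bar>f x\<bar> * \<bar>c x\<bar> \<le> \<bar>f x\<bar> * \<bar>B\<bar>" using B[OF True] by (intro mult_left_mono) auto
    then show ?thesis by (simp add: abs_mult mult.commute)
  qed (use S in simp)
  have "integrable lborel (\<lambda>x. B * f x)" "integrable lborel (\<lambda>x. B\<^sup>2 * (f x)\<^sup>2)"
    using f by (auto simp: L2fun_def)
  then show ?thesis
    unfolding L2fun_def
  proof (intro conjI)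
    show "integrable lborel (\<lambda>x. f x * c x)" if "integrable lborel (\<lambda>x. B * f x)"
      by (rule integrable_dominated[OF that]) (use le in auto)
    show "integrable lborel (\<lambda>x. (f x * c x)\<^sup>2)" if "integrable lborel (\<lambda>x. B\<^sup>2 * (f x)\<^sup>2)"
    proof (rule integrable_dominated[OF that])
      have "(f x * c x)\<^sup>2 \<le> (B * f x)\<^sup>2" for x using le[of x] by (simp only: abs_le_square_iff)
      then show "AE x in lborel. norm ((f x * c x)\<^sup>2) \<le> norm (B\<^sup>2 * (f x)\<^sup>2)"
        by (simp add: power_mult_distrib)
    qed measurable
  qed measurable
qed

text \<open>The pairing of f with the convolution of g and k, kept as a double integral so that
  either variable can be integrated first.\<close>

definition conv :: "('a::euclidean_space \<Rightarrow> real) \<Rightarrow> ('a \<Rightarrow> real) \<Rightarrow> ('a \<Rightarrow> real) \<Rightarrow> real" where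
  "conv f g k = (\<integral>p. (case p of (z, w) \<Rightarrow> f z * g w * k (z - w)) \<partial>(lborel \<Otimes>\<^sub>M lborel))"

lemma integrable_conv:
  fixes f g k :: "'a::euclidean_space \<Rightarrow> real"
  assumes f: "integrable lborel f" and g: "integrable lborel g"
    and k[measurable]: "k \<in> borel_measurable borel" and B: "\<And>x. \<bar>k x\<bar> \<le> B"
  shows "integrable (lborel \<Otimes>\<^sub>M lborel) (\<lambda>(z, w). f z * g w * k (z - w))"
proof -
  have [measurable]: "f \<in> borel_measurable borel" "g \<in> borel_measurable borel" using f g by auto
  have "(\<lambda>p. k (fst p - snd p)) \<in> borel_measurable (lborel \<Otimes>\<^sub>M lborel)" by measurable
  from integrable_mult_bounded[OF integrable_lborel_product[OF f g] this B]
  show ?thesis by (simp add: case_prod_unfold)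
qed

lemma conv_iterated:
  fixes f g k :: "'a::euclidean_space \<Rightarrow> real"
  assumes "integrable lborel f" "integrable lborel g" "k \<in> borel_measurable borel" "\<And>x. \<bar>k x\<bar> \<le> B"
  shows "(\<integral>w. g w * (\<integral>z. f z * k (z - w) \<partial>lborel) \<partial>lborel) = conv f g k"
    and "(\<integral>z. f z * (\<integral>w. g w * k (z - w) \<partial>lborel) \<partial>lborel) = conv f g k"
proof -
  have int: "integrable (lborel \<Otimes>\<^sub>M lborel) (\<lambda>(z, w). f z * g w * k (z - w))"
    by (rule integrable_conv[OF assms])
  show "(\<integral>w. g w * (\<integral>z. f z * k (z - w) \<partial>lborel) \<partial>lborel) = conv f g k"
    using lborel_pair.integral_snd[OF int] by (simp add: conv_def mult_ac flip: integral_mult_right_zero)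
  show "(\<integral>z. f z * (\<integral>w. g w * k (z - w) \<partial>lborel) \<partial>lborel) = conv f g k"
    using lborel_pair.integral_fst[OF int] by (simp add: conv_def mult_ac flip: integral_mult_right_zero)
qed

lemma conv_tendsto:
  fixes f g :: "'a::euclidean_space \<Rightarrow> real"
  assumes f: "L2fun f" and S: "\<And>x. x \<notin> cball 0 R \<Longrightarrow> f x = 0" and g: "L2fun g"
    and E: "\<And>n. kernel (E n)" and supp: "\<And>d. d > 0 \<Longrightarrow> \<forall>\<^sub>F n in sequentially. \<forall>h. E n h \<noteq> 0 \<longrightarrow> norm h < d"
  shows "(\<lambda>n. conv f g (E n)) \<longlonglongrightarrow> (\<integral>x. f x * g x \<partial>lborel)"
proof (rule tendstoI)
  fix e :: real assume "e > 0"
  have f': "f \<in> borel_measurable borel" "integrable lborel (\<lambda>x. (f x)\<^sup>2)" using f by (auto simp: L2fun_def)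
  obtain d where d: "d > 0" "\<And>E. \<lbrakk>kernel E; \<And>h. E h \<noteq> 0 \<Longrightarrow> norm h < d\<rbrakk> \<Longrightarrow>
    \<bar>conv f g E - (\<integral>x. f x * g x \<partial>lborel)\<bar> < e"
    unfolding conv_def using kernel_approx[OF f' S g \<open>e > 0\<close>] by blast
  show "\<forall>\<^sub>F n in sequentially. dist (conv f g (E n)) (\<integral>x. f x * g x \<partial>lborel) < e"
    using supp[OF d(1)] by eventually_elim (use d(2) E in \<open>auto simp: dist_real_def\<close>)
qed

text \<open>The centre is arbitrary because the kernels used near the boundary are displaced from
  the origin. A bump positive exactly on the ball has positive mass, by which it can be
  normalised.\<close>

lemma smooth_kernel_exists:
  fixes c :: "'a::euclidean_space" assumes "\<rho> > 0"
  obtains E where "kernel E" "Cinf_on UNIV E" "\<And>h. h \<notin> cball c \<rho> \<Longrightarrow> E h = 0"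
proof -
  obtain f where f: "Cinf_on UNIV f" "\<And>x. f x \<ge> 0" "\<And>x. f x > 0 \<longleftrightarrow> x \<in> ball c \<rho>"
    using bump_exists[OF assms] by blast
  have f0: "f x = 0" if "x \<notin> cball c \<rho>" for x
  proof -
    have "\<not> f x > 0" using f(3) that ball_subset_cball by blast
    then show ?thesis using f(2)[of x] by linarith
  qed
  obtain B where B: "\<And>x. \<bar>f x\<bar> \<le> B"
    using bounded_of_compact_support[OF Cinf_continuous_on[OF f(1)] compact_cball f0] by blast
  have [measurable]: "f \<in> borel_measurable borel" using f(1) by (rule Cinf_borel)
  have "integrable lborel (\<lambda>x. B * indicator (cball c \<rho>) x)"
    by (intro integrable_mult_right integrable_real_indicator emeasure_bounded_finite) auto
  then have int: "integrable lborel f"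
    by (rule integrable_dominated)
      (use B f0 in \<open>auto simp: indicator_def intro: order_trans[OF _ abs_ge_self]\<close>)
  have "integral\<^sup>L lborel f \<noteq> 0"
  proof
    assume "integral\<^sup>L lborel f = 0"
    then have "AE x in lborel. f x = 0" using int f(2) by (subst (asm) integral_nonneg_eq_0_iff_AE) auto
    then have "AE x in lborel. x \<notin> ball c \<rho>" by eventually_elim (use f(3) in force)
    then have "emeasure lborel (ball c \<rho>) = 0" by (subst (asm) AE_iff_measurable[OF _ refl]) (auto simp: ball_def)
    then show False using content_ball_pos[OF assms, of c] by (simp add: measure_def)
  qed
  moreover have "integral\<^sup>L lborel f \<ge> 0" using f(2) by (intro Bochner_Integration.integral_nonneg)
  ultimately have pos: "integral\<^sup>L lborel f > 0" by linarith
  show thesis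
  proof
    show "kernel (\<lambda>x. inverse (integral\<^sup>L lborel f) * f x)"
      unfolding kernel_def using int f(2) pos by auto
    show "Cinf_on UNIV (\<lambda>x. inverse (integral\<^sup>L lborel f) * f x)"
      by (intro Cinf_mult Cinf_const f)
  qed (use f0 in auto)
qed

lemma dderiv_translate:
  fixes f :: "'b::real_normed_vector \<Rightarrow> real" and L :: "'a::real_normed_vector \<Rightarrow> 'b"
  assumes "Cinf_on UNIV f" and L: "bounded_linear L"
  shows "dderiv v (\<lambda>x. f (L x + b)) x = dderiv (L v) f (L x + b)"
proof -
  have "((\<lambda>x. f (L x + b)) has_derivative (\<lambda>v. frechet_derivative f (at (L x + b)) (L v))) (at x)"
    by (rule has_derivative_compose[OF _ Cinf_has_derivative[OF assms(1)]])
      (auto intro!: derivative_eq_intros bounded_linear_imp_has_derivative L)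
  then show ?thesis by (metis frechet_derivative_at)
qed

lemma dderiv_mult:
  fixes f g :: "'a::real_normed_vector \<Rightarrow> real"
  assumes "Cinf_on UNIV f" "Cinf_on UNIV g"
  shows "dderiv v (\<lambda>x. f x * g x) x = f x * dderiv v g x + dderiv v f x * g x"
  using frechet_derivative_at[OF has_derivative_mult[OF assms[THEN Cinf_has_derivative], of x]] by metis

section \<open>Testing the flux against the gradient\<close>

text \<open>\<open>D\<close> is the spatial gradient of \<open>u\<close>, and \<open>weak_eq\<close> says that \<open>div N = r\<close> with vanishing
  normal component at the boundary. Since \<open>r\<close> and \<open>N\<close> live on a shorter time interval than \<open>u\<close>,
  there is room to shift time forward.\<close>

locale weak_pair =
  fixes \<Omega> :: "'d::euclidean_space set" and T R :: real
    and u r :: "'d \<times> real \<Rightarrow> real" and D N :: "'d \<Rightarrow> 'd \<times> real \<Rightarrow> real"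
  assumes domain: "smooth_bounded_domain \<Omega>"
    and L2: "L2fun u" "L2fun r" "\<And>i. i \<in> Basis \<Longrightarrow> L2fun (D i)" "\<And>i. i \<in> Basis \<Longrightarrow> L2fun (N i)"
    and bdd: "\<Omega> \<times> {0<..<T + 1} \<subseteq> cball 0 R"
    and supp: "\<And>z. z \<notin> \<Omega> \<times> {0<..<T + 1} \<Longrightarrow> u z = 0" "\<And>z i. i \<in> Basis \<Longrightarrow> z \<notin> \<Omega> \<times> {0<..<T + 1} \<Longrightarrow> D i z = 0"
      "\<And>z. z \<notin> \<Omega> \<times> {0<..<T} \<Longrightarrow> r z = 0" "\<And>z i. i \<in> Basis \<Longrightarrow> z \<notin> \<Omega> \<times> {0<..<T} \<Longrightarrow> N i z = 0"
    and weak_grad: "\<And>i \<phi> K. \<lbrakk>i \<in> Basis; Cinf_on UNIV \<phi>; compact K; K \<subseteq> \<Omega> \<times> {0<..<T + 1};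
        \<And>z. z \<notin> K \<Longrightarrow> \<phi> z = 0\<rbrakk> \<Longrightarrow>
        (\<integral>z. u z * dderiv (i, 0) \<phi> z \<partial>lborel) = - (\<integral>z. D i z * \<phi> z \<partial>lborel)"
    and weak_eq: "AE s in lborel. \<forall>\<psi>. Cinf_on UNIV \<psi> \<longrightarrow>
        (\<integral>y. r (y, s) * \<psi> y \<partial>lborel) = - (\<Sum>i\<in>Basis. \<integral>y. N i (y, s) * dderiv i \<psi> y \<partial>lborel)"
begin

text \<open>Formally \<open>balance \<zeta>\<close> is the integral of \<open>div (\<zeta> u N)\<close>. It is additive in \<open>\<zeta>\<close>, which permits
  a localization near boundary points.\<close>

definition balance :: "('d \<Rightarrow> real) \<Rightarrow> real" where
  "balance \<zeta> = (\<integral>w. u w * (r w * \<zeta> (fst w)) \<partial>lborel)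
     + (\<Sum>i\<in>Basis. \<integral>w. u w * (N i w * dderiv i \<zeta> (fst w)) \<partial>lborel)
     + (\<Sum>i\<in>Basis. \<integral>w. D i w * (N i w * \<zeta> (fst w)) \<partial>lborel)"

lemma L2fun_weight:
  assumes "L2fun f" "\<And>z. z \<notin> \<Omega> \<times> {0<..<T} \<Longrightarrow> f z = 0" "Cinf_on UNIV \<zeta>"
  shows "L2fun (\<lambda>w. f w * \<zeta> (fst w))"
proof (rule L2fun_mult_continuous[OF assms(1), where R = R])
  show "continuous_on UNIV (\<lambda>w :: 'd \<times> real. \<zeta> (fst w))"
    by (rule Cinf_continuous_on_fst[OF assms(3)])
  show "f x = 0" if "x \<notin> cball 0 R" for x
  proof (rule assms(2))
    show "x \<notin> \<Omega> \<times> {0<..<T}" using that bdd by (cases x) force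
  qed
qed

text \<open>An exact identity, before any limit. The equation for \<open>N\<close> and the weak
  gradient of \<open>u\<close> both produce the pairing of \<open>u\<close> with
  \<open>\<zeta>\<close> \<open>N\<close> against a derivative of E; eliminating this term between
  the two leaves the mollified balance. Support of the shifted kernel inside the cylinder is needed
  only where \<open>\<zeta>\<close> \<open>N\<close> does not vanish.\<close>

lemma balance_kernel:
  assumes \<zeta>: "Cinf_on UNIV \<zeta>" and E: "Cinf_on UNIV E" "\<And>h. h \<notin> cball c \<rho> \<Longrightarrow> E h = 0"
    and inside: "\<And>w. \<lbrakk>w \<in> \<Omega> \<times> {0<..<T}; \<zeta> (fst w) \<noteq> 0\<rbrakk> \<Longrightarrow> cball (w + c) \<rho> \<subseteq> \<Omega> \<times> {0<..<T + 1}"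
  shows "conv u (\<lambda>w. r w * \<zeta> (fst w)) E + (\<Sum>i\<in>Basis. conv u (\<lambda>w. N i w * dderiv i \<zeta> (fst w)) E)
     + (\<Sum>i\<in>Basis. conv (D i) (\<lambda>w. N i w * \<zeta> (fst w)) E) = 0"
proof -
  let ?E = "\<lambda>i. dderiv (i, 0) E"
  have Em: "E \<in> borel_measurable borel" "?E i \<in> borel_measurable borel" for i
    by (intro Cinf_borel Cinf_dderiv E)+
  obtain B where B: "\<And>h. \<bar>E h\<bar> \<le> B"
    using bounded_of_compact_support[OF Cinf_continuous_on[OF E(1)] compact_cball E(2)] by blast
  have E0: "?E i h = 0" if "h \<notin> cball c \<rho>" for i h
    by (rule dderiv_eq_0_outside[of "- cball c \<rho>"]) (use E(2) that in auto)
  have "\<exists>B. \<forall>h. \<bar>?E i h\<bar> \<le> B" for i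
    using bounded_of_compact_support[OF Cinf_continuous_on[OF Cinf_dderiv[OF E(1)]] compact_cball E0] by metis
  then obtain B' where B': "\<And>i h. \<bar>?E i h\<bar> \<le> B' i" by metis
  define r\<zeta> where "r\<zeta> = (\<lambda>w. r w * \<zeta> (fst w))"
  define Nd where "Nd i = (\<lambda>w. N i w * dderiv i \<zeta> (fst w))" for i
  define N\<zeta> where "N\<zeta> i = (\<lambda>w. N i w * \<zeta> (fst w))" for i
  have int: "integrable lborel u" "integrable lborel r\<zeta>"
    "\<And>i. i \<in> Basis \<Longrightarrow> integrable lborel (D i)" "\<And>i. i \<in> Basis \<Longrightarrow> integrable lborel (Nd i)" "\<And>i. i \<in> Basis \<Longrightarrow> integrable lborel (N\<zeta> i)"
    using L2 L2fun_weight[OF _ _ \<zeta>] L2fun_weight[OF _ _ Cinf_dderiv[OF \<zeta>]] supp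
    unfolding L2fun_def r\<zeta>_def Nd_def N\<zeta>_def by auto
  have I: "conv u (N\<zeta> i) (?E i) = - conv (D i) (N\<zeta> i) E" if i: "i \<in> Basis" for i
  proof -
    \<comment> \<open>Where this factor vanishes there is nothing to show; elsewhere
      \<open>inside\<close> makes the kernel shifted by w a compactly supported test
      function.\<close>
    have "N\<zeta> i w * (\<integral>z. u z * ?E i (z - w) \<partial>lborel) = - (N\<zeta> i w * (\<integral>z. D i z * E (z - w) \<partial>lborel))" for w
    proof (cases "N\<zeta> i w = 0")
      case False
      then have w: "w \<in> \<Omega> \<times> {0<..<T}" "\<zeta> (fst w) \<noteq> 0"
        using supp(4)[OF i, of w] by (auto simp: N\<zeta>_def)
      have "(\<integral>z. u z * dderiv (i, 0) (\<lambda>z. E (z + - w)) z \<partial>lborel) = - (\<integral>z. D i z * E (z + - w) \<partial>lborel)"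
      proof (rule weak_grad[OF i _ compact_cball inside[OF w]])
        show "Cinf_on UNIV (\<lambda>z. E (z + - w))"
          by (rule Cinf_affine[OF E(1) bounded_linear_ident])
        show "E (z + - w) = 0" if "z \<notin> cball (w + c) \<rho>" for z
          using that by (intro E(2)) (simp add: dist_norm algebra_simps)
      qed
      moreover have "dderiv (i, 0) (\<lambda>z. E (z + - w)) z = ?E i (z - w)" for z
        using dderiv_translate[OF E(1) bounded_linear_ident, where v = "(i, 0)" and b = "- w" and x = z] by simp
      ultimately show ?thesis by simp
    qed simp
    then have "(\<integral>w. N\<zeta> i w * (\<integral>z. u z * ?E i (z - w) \<partial>lborel) \<partial>lborel) = - (\<integral>w. N\<zeta> i w * (\<integral>z. D i z * E (z - w) \<partial>lborel) \<partial>lborel)"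
      by simp
    then show ?thesis
      unfolding conv_iterated(1)[OF int(1) int(5)[OF i] Em(2) B'] conv_iterated(1)[OF int(3)[OF i] int(5)[OF i] Em(1) B] .
  qed
  have slice: "integrable lborel (\<lambda>w. g w * k (z - w))"
    "AE s in lborel. integrable lborel (\<lambda>y. g (y, s) * k (z - (y, s)))"
    "integrable lborel (\<lambda>s. \<integral>y. g (y, s) * k (z - (y, s)) \<partial>lborel)"
    "(\<integral>w. g w * k (z - w) \<partial>lborel) = (\<integral>s. (\<integral>y. g (y, s) * k (z - (y, s)) \<partial>lborel) \<partial>lborel)"
    if g: "integrable lborel g" and k: "k \<in> borel_measurable borel" "\<And>h. \<bar>k h\<bar> \<le> B0" for g k :: "'d \<times> real \<Rightarrow> real" and B0 :: real and z
  proof -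
    have [measurable]: "g \<in> borel_measurable borel" "k \<in> borel_measurable borel" using g k by auto
    show 1: "integrable lborel (\<lambda>w. g w * k (z - w))"
      by (rule integrable_mult_bounded[OF g _ k(2)]) measurable
    then have 2: "integrable (lborel \<Otimes>\<^sub>M lborel) (\<lambda>(y, s). g (y, s) * k (z - (y, s)))"
      by (simp add: lborel_prod case_prod_unfold)
    show "AE s in lborel. integrable lborel (\<lambda>y. g (y, s) * k (z - (y, s)))"
      by (rule lborel_pair.AE_integrable_snd[OF 2])
    show "integrable lborel (\<lambda>s. \<integral>y. g (y, s) * k (z - (y, s)) \<partial>lborel)"
      by (rule lborel_pair.integrable_snd[OF 2])
    show "(\<integral>w. g w * k (z - w) \<partial>lborel) = (\<integral>s. (\<integral>y. g (y, s) * k (z - (y, s)) \<partial>lborel) \<partial>lborel)"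
      using lborel_pair.integral_snd[OF 2] by (simp add: lborel_prod case_prod_unfold)
  qed
  have II: "(\<integral>w. r\<zeta> w * E (z - w) \<partial>lborel) = - (\<Sum>i\<in>Basis. \<integral>w. Nd i w * E (z - w) \<partial>lborel)
      + (\<Sum>i\<in>Basis. \<integral>w. N\<zeta> i w * ?E i (z - w) \<partial>lborel)" for z
  proof -
    let ?a = "\<lambda>s. \<integral>y. r\<zeta> (y, s) * E (z - (y, s)) \<partial>lborel"
    let ?b = "\<lambda>i s. \<integral>y. Nd i (y, s) * E (z - (y, s)) \<partial>lborel"
    let ?c = "\<lambda>i s. \<integral>y. N\<zeta> i (y, s) * ?E i (z - (y, s)) \<partial>lborel"
    have "AE s in lborel. \<forall>i\<in>Basis. integrable lborel (\<lambda>y. Nd i (y, s) * E (z - (y, s)))"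
      by (subst AE_finite_all) (auto intro!: slice(2)[OF int(4) Em(1) B])
    moreover have "AE s in lborel. \<forall>i\<in>Basis. integrable lborel (\<lambda>y. N\<zeta> i (y, s) * ?E i (z - (y, s)))"
      by (subst AE_finite_all) (auto intro!: slice(2)[OF int(5) Em(2) B'])
    \<comment> \<open>The test function \<open>\<zeta>\<close>(y) E(z - (y,s)) changes with s. This
      is legitimate because the exceptional null set in \<open>weak_eq\<close> does not depend on
      the test function.\<close>
    ultimately have "AE s in lborel. ?a s = - (\<Sum>i\<in>Basis. ?b i s) + (\<Sum>i\<in>Basis. ?c i s)"
      using weak_eq
    proof eventually_elim
      case (elim s)
      let ?L = "\<lambda>y :: 'd. (- y, 0 :: real)" and ?h = "(fst z, snd z - s)"
      have L: "bounded_linear ?L"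
        by (intro bounded_linear_Pair bounded_linear_minus bounded_linear_ident bounded_linear_zero)
      have LE: "?L y + ?h = z - (y, s)" for y by (cases z) simp
      have CE: "Cinf_on UNIV (\<lambda>y. E (z - (y, s)))"
        using Cinf_affine[OF E(1) L, of ?h] unfolding LE .
      \<comment> \<open>The variable y enters E with a minus sign; this sign makes the derivative
        terms of the two equations cancel.\<close>
      have dE: "dderiv i (\<lambda>y. E (z - (y, s))) y = - ?E i (z - (y, s))" for i y
      proof -
        have "dderiv i (\<lambda>y. E (?L y + ?h)) y = frechet_derivative E (at (?L y + ?h)) (- (i, 0))"
          using dderiv_translate[OF E(1) L, where v = i and b = ?h and x = y] by simp
        then show ?thesis
          unfolding LE using linear_neg[OF has_derivative_linear[OF Cinf_has_derivative[OF E(1)]]] by metis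
      qed
      have "?a s = (\<integral>y. r (y, s) * (\<zeta> y * E (z - (y, s))) \<partial>lborel)"
        by (simp add: r\<zeta>_def mult.assoc)
      also have "\<dots> = - (\<Sum>i\<in>Basis. \<integral>y. N i (y, s) * dderiv i (\<lambda>y. \<zeta> y * E (z - (y, s))) y \<partial>lborel)"
        using elim(3) Cinf_mult[OF \<zeta> CE] by blast
      also have "\<dots> = - (\<Sum>i\<in>Basis. ?b i s - ?c i s)"
      proof -
        have "(\<integral>y. N i (y, s) * dderiv i (\<lambda>y. \<zeta> y * E (z - (y, s))) y \<partial>lborel) = ?b i s - ?c i s" if "i \<in> Basis" for i
        proof -
          have "N i (y, s) * dderiv i (\<lambda>y. \<zeta> y * E (z - (y, s))) y
              = Nd i (y, s) * E (z - (y, s)) - N\<zeta> i (y, s) * ?E i (z - (y, s))" for y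
            unfolding dderiv_mult[OF \<zeta> CE] dE by (simp add: Nd_def N\<zeta>_def algebra_simps)
          then show ?thesis using elim(1,2) that by simp
        qed
        then show ?thesis by simp
      qed
      finally show ?case by (simp add: sum_subtractf)
    qed
    moreover have R: "integrable lborel (\<lambda>s. - (\<Sum>i\<in>Basis. ?b i s))" "integrable lborel (\<lambda>s. \<Sum>i\<in>Basis. ?c i s)"
      by (intro integrable_minus Bochner_Integration.integrable_sum
          slice(3)[OF int(4) Em(1) B] slice(3)[OF int(5) Em(2) B']; assumption)+
    ultimately have "(\<integral>s. ?a s \<partial>lborel) = (\<integral>s. - (\<Sum>i\<in>Basis. ?b i s) + (\<Sum>i\<in>Basis. ?c i s) \<partial>lborel)"
      by (intro integral_cong_AE borel_measurable_integrable slice(3)[OF int(2) Em(1) B]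
          Bochner_Integration.integrable_add)
    also have "\<dots> = - (\<Sum>i\<in>Basis. \<integral>s. ?b i s \<partial>lborel) + (\<Sum>i\<in>Basis. \<integral>s. ?c i s \<partial>lborel)"
      using slice(3)[OF int(4) Em(1) B] slice(3)[OF int(5) Em(2) B']
      by (simp only: Bochner_Integration.integral_add[OF R] integral_minus Bochner_Integration.integral_sum)
    finally show ?thesis
      using slice(4)[OF int(2) Em(1) B] slice(4)[OF int(4) Em(1) B] slice(4)[OF int(5) Em(2) B'] by simp
  qed
  have sl4: "integrable lborel (\<lambda>z. u z * (\<integral>w. g w * k (z - w) \<partial>lborel))" 
    if g: "integrable lborel g" and k: "k \<in> borel_measurable borel" "\<And>h. \<bar>k h\<bar> \<le> B0" for g k :: "'d \<times> real \<Rightarrow> real" and B0 :: real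
    using lborel_pair.integrable_fst[OF integrable_conv[OF int(1) g k]]
    by (simp add: mult.assoc)
  have R: "integrable lborel (\<lambda>z. - (\<Sum>i\<in>Basis. u z * (\<integral>w. Nd i w * E (z - w) \<partial>lborel)))"
    "integrable lborel (\<lambda>z. \<Sum>i\<in>Basis. u z * (\<integral>w. N\<zeta> i w * ?E i (z - w) \<partial>lborel))"
    by (intro integrable_minus Bochner_Integration.integrable_sum
        sl4[OF int(4) Em(1) B] sl4[OF int(5) Em(2) B']; assumption)+
  have "conv u r\<zeta> E = (\<integral>z. u z * (\<integral>w. r\<zeta> w * E (z - w) \<partial>lborel) \<partial>lborel)"
    by (rule conv_iterated(2)[OF int(1,2) Em(1) B, symmetric])
  also have "\<dots> = (\<integral>z. - (\<Sum>i\<in>Basis. u z * (\<integral>w. Nd i w * E (z - w) \<partial>lborel))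
      + (\<Sum>i\<in>Basis. u z * (\<integral>w. N\<zeta> i w * ?E i (z - w) \<partial>lborel)) \<partial>lborel)"
    unfolding II by (simp only: distrib_left mult_minus_right sum_distrib_left)
  also have "\<dots> = - (\<Sum>i\<in>Basis. \<integral>z. u z * (\<integral>w. Nd i w * E (z - w) \<partial>lborel) \<partial>lborel)
      + (\<Sum>i\<in>Basis. \<integral>z. u z * (\<integral>w. N\<zeta> i w * ?E i (z - w) \<partial>lborel) \<partial>lborel)"
    using sl4[OF int(4) Em(1) B] sl4[OF int(5) Em(2) B']
    by (simp only: Bochner_Integration.integral_add[OF R] integral_minus Bochner_Integration.integral_sum)
  also have "\<dots> = - (\<Sum>i\<in>Basis. conv u (Nd i) E) + (\<Sum>i\<in>Basis. conv u (N\<zeta> i) (?E i))"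
    using conv_iterated(2)[OF int(1) int(4) Em(1) B] conv_iterated(2)[OF int(1) int(5) Em(2) B'] by simp
  also have "\<dots> = - (\<Sum>i\<in>Basis. conv u (Nd i) E) - (\<Sum>i\<in>Basis. conv (D i) (N\<zeta> i) E)"
    using I by (simp add: sum_negf)
  finally show ?thesis by (simp add: r\<zeta>_def Nd_def N\<zeta>_def)
qed

text \<open>Kernels centred at \<open>\<epsilon>\<close> (v,1) with radius proportional to
  \<open>\<epsilon>\<close> move every point of the support of \<open>\<zeta>\<close> in the domain
  inwards in space and forwards in time. The mollified balance is then exactly zero, and it
  converges to \<open>balance \<zeta>\<close> as the kernels shrink to the origin.\<close>

lemma balance_local:
  assumes \<zeta>: "Cinf_on UNIV \<zeta>" and "\<delta> > 0" "e > 0" and T: "T > 0"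
    and inward: "\<And>y w \<epsilon>. \<lbrakk>y \<in> \<Omega>; \<zeta> y \<noteq> 0; w \<in> cball v \<delta>; 0 < \<epsilon>; \<epsilon> < e\<rbrakk> \<Longrightarrow> y + \<epsilon> *\<^sub>R w \<in> \<Omega>"
  shows "balance \<zeta> = 0"
proof -
  \<comment> \<open>The caps concern time: radius at most 1/2 keeps the time component of the
    direction in [1/2, 3/2], and \<open>\<epsilon>\<close> < 1/2 then bounds the time shift by 3/4,
    below the spare unit.\<close>
  define \<delta>' where "\<delta>' = min \<delta> (1/2)"
  have \<delta>': "\<delta>' > 0" "\<delta>' \<le> \<delta>" "\<delta>' \<le> 1/2" using assms(2) by (auto simp: \<delta>'_def)
  define e' where "e' = min e (1/2)"
  have e': "e' > 0" "e' \<le> e" "e' \<le> 1/2" using assms(3) by (auto simp: e'_def)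
  define \<epsilon> where "\<epsilon> n = e' / (real n + 2)" for n :: nat
  have \<epsilon>: "0 < \<epsilon> n" "\<epsilon> n < e'" for n
    using e'(1) divide_strict_left_mono[of 1 "real n + 2" e'] by (auto simp: \<epsilon>_def)
  define c where "c n = \<epsilon> n *\<^sub>R (v, 1 :: real)" for n
  have "\<exists>E. kernel E \<and> Cinf_on UNIV E \<and> (\<forall>h. h \<notin> cball (c n) (\<epsilon> n * \<delta>') \<longrightarrow> E h = 0)" for n
    using smooth_kernel_exists[of "\<epsilon> n * \<delta>'" "c n"] \<epsilon>(1)[of n] \<delta>'(1) by (metis mult_pos_pos)
  then obtain E where E: "\<And>n. kernel (E n)" "\<And>n. Cinf_on UNIV (E n)"
    "\<And>n h. h \<notin> cball (c n) (\<epsilon> n * \<delta>') \<Longrightarrow> E n h = 0" by metis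
  have inside: "cball (w + c n) (\<epsilon> n * \<delta>') \<subseteq> \<Omega> \<times> {0<..<T + 1}"
    if w: "w \<in> \<Omega> \<times> {0<..<T}" "\<zeta> (fst w) \<noteq> 0" for w n
  proof
    fix z assume z: "z \<in> cball (w + c n) (\<epsilon> n * \<delta>')"
    \<comment> \<open>The displacement with the scale \<open>\<epsilon>\<close> removed; it lies
      within \<open>\<delta>'\<close> of (v,1).\<close>
    define h where "h = (1 / \<epsilon> n) *\<^sub>R (z - w)"
    have zh: "z = w + \<epsilon> n *\<^sub>R h" using \<epsilon>(1)[of n] by (simp add: h_def)
    have "\<epsilon> n * dist (v, 1) h = dist (c n) (\<epsilon> n *\<^sub>R h)"
      using \<epsilon>(1)[of n] unfolding c_def dist_norm scaleR_diff_right[symmetric] norm_scaleR by simp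
    also have "\<dots> = dist (w + c n) z" unfolding zh by (simp add: dist_norm)
    also have "\<dots> \<le> \<epsilon> n * \<delta>'" using z by simp
    finally have "dist (v, 1) h \<le> \<delta>'" using \<epsilon>(1)[of n] by simp
    then have h: "dist v (fst h) \<le> \<delta>'" "\<bar>1 - snd h\<bar> \<le> \<delta>'"
      using dist_fst_le[of "(v, 1)" h] dist_snd_le[of "(v, 1)" h] by (auto simp: dist_real_def)
    have "fst w + \<epsilon> n *\<^sub>R fst h \<in> \<Omega>"
      using w h \<epsilon>[of n] \<delta>' e' by (intro inward) auto
    moreover have "0 < snd w + \<epsilon> n * snd h" "snd w + \<epsilon> n * snd h < T + 1"
    proof -
      have "1/2 \<le> snd h" "snd h \<le> 3/2" using h(2) \<delta>'(3) by linarith+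
      then have "0 < \<epsilon> n * snd h" "\<epsilon> n * snd h \<le> 1/2 * (3/2)"
        using \<epsilon>[of n] e' mult_mono[of "\<epsilon> n" "1/2" "snd h" "3/2"] by (simp_all del: times_divide_eq_left)
      then show "0 < snd w + \<epsilon> n * snd h" "snd w + \<epsilon> n * snd h < T + 1" using w(1) by (auto simp: mem_Times_iff)
    qed
    ultimately show "z \<in> \<Omega> \<times> {0<..<T + 1}" unfolding zh by (simp add: mem_Times_iff)
  qed
  have shrink: "\<forall>\<^sub>F n in sequentially. \<forall>h. E n h \<noteq> 0 \<longrightarrow> norm h < d" if "d > 0" for d
  proof -
    have "\<epsilon> \<longlonglongrightarrow> 0" unfolding \<epsilon>_def
      using LIMSEQ_ignore_initial_segment[OF lim_const_over_n[of e'], of 2] by (simp add: add.commute)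
    then have "(\<lambda>n. \<epsilon> n * (norm (v, 1 :: real) + \<delta>')) \<longlonglongrightarrow> 0 * (norm (v, 1 :: real) + \<delta>')"
      by (intro tendsto_intros)
    then have "\<forall>\<^sub>F n in sequentially. \<epsilon> n * (norm (v, 1 :: real) + \<delta>') < d"
      using \<open>d > 0\<close> by (intro order_tendstoD) auto
    then show ?thesis
    proof eventually_elim
      case (elim n)
      show ?case
      proof (intro allI impI)
        fix h assume "E n h \<noteq> 0"
        then have "h \<in> cball (c n) (\<epsilon> n * \<delta>')" using E(3) by blast
        then have "norm h \<le> norm (c n) + \<epsilon> n * \<delta>'"
          using norm_triangle_ineq2[of h "c n"] by (simp add: dist_norm norm_minus_commute)
        also have "norm (c n) = \<epsilon> n * norm (v, 1 :: real)"
          unfolding c_def norm_scaleR using \<epsilon>(1)[of n] by simp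
        finally show "norm h < d" using elim by (simp add: distrib_left)
      qed
    qed
  qed
  have out: "u x = 0" "i \<in> Basis \<Longrightarrow> D i x = 0" if "x \<notin> cball 0 R" for x i
    using that bdd supp(1,2) by blast+
  have "(\<lambda>n. conv u (\<lambda>w. r w * \<zeta> (fst w)) (E n) + (\<Sum>i\<in>Basis. conv u (\<lambda>w. N i w * dderiv i \<zeta> (fst w)) (E n))
     + (\<Sum>i\<in>Basis. conv (D i) (\<lambda>w. N i w * \<zeta> (fst w)) (E n))) \<longlonglongrightarrow> balance \<zeta>"
    unfolding balance_def
    by (intro tendsto_add tendsto_sum conv_tendsto[where R = R] L2 out L2fun_weight[OF _ _ \<zeta>] supp
        L2fun_weight[OF _ _ Cinf_dderiv[OF \<zeta>]] E(1) shrink)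
  moreover have "conv u (\<lambda>w. r w * \<zeta> (fst w)) (E n) + (\<Sum>i\<in>Basis. conv u (\<lambda>w. N i w * dderiv i \<zeta> (fst w)) (E n))
     + (\<Sum>i\<in>Basis. conv (D i) (\<lambda>w. N i w * \<zeta> (fst w)) (E n)) = 0" for n
    by (rule balance_kernel[OF \<zeta> E(2) E(3) inside])
  ultimately show ?thesis by (simp add: LIMSEQ_const_iff)
qed

lemma integrable_balance:
  assumes \<zeta>: "Cinf_on UNIV \<zeta>"
  shows "integrable lborel (\<lambda>w. u w * (r w * \<zeta> (fst w)))"
    "i \<in> Basis \<Longrightarrow> integrable lborel (\<lambda>w. u w * (N i w * \<zeta> (fst w)))"
    "i \<in> Basis \<Longrightarrow> integrable lborel (\<lambda>w. D i w * (N i w * \<zeta> (fst w)))"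
  using L2 L2fun_weight[OF L2(2) supp(3) \<zeta>] L2fun_weight[OF L2(4) supp(4) \<zeta>, of i]
  by (auto simp: L2fun_def intro!: integrable_mult_L2)

lemma balance_add:
  assumes "Cinf_on UNIV \<zeta>" "Cinf_on UNIV \<xi>"
  shows "balance (\<lambda>x. \<zeta> x + \<xi> x) = balance \<zeta> + balance \<xi>"
proof -
  have d: "dderiv i (\<lambda>x. \<zeta> x + \<xi> x) y = dderiv i \<zeta> y + dderiv i \<xi> y" for i y
    using frechet_derivative_at[OF has_derivative_add[OF assms[THEN Cinf_has_derivative], of y]] by metis
  note I = integrable_balance[OF assms(1)] integrable_balance[OF assms(2)]
    integrable_balance[OF Cinf_dderiv[OF assms(1)]] integrable_balance[OF Cinf_dderiv[OF assms(2)]]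
  show ?thesis
    unfolding balance_def d using I
    by (simp add: distrib_left sum.distrib)
qed

text \<open>Splitting off \<open>\<omega> \<zeta>\<^sub>a\<close> and continuing with \<open>\<omega> (1 - \<zeta>\<^sub>a)\<close> replaces a partition of unity.\<close>

lemma balance_cover:
  assumes "finite A"
    and cover: "\<And>a. a \<in> A \<Longrightarrow> Cinf_on UNIV (\<zeta> a)" "\<And>a x. a \<in> A \<Longrightarrow> x \<in> W a \<Longrightarrow> \<zeta> a x = 1"
      "\<And>a \<omega>. a \<in> A \<Longrightarrow> Cinf_on UNIV \<omega> \<Longrightarrow> balance (\<lambda>x. \<omega> x * \<zeta> a x) = 0"
    and "Cinf_on UNIV \<omega>" "\<And>y. y \<in> \<Omega> \<Longrightarrow> \<omega> y \<noteq> 0 \<Longrightarrow> y \<in> (\<Union>a\<in>A. W a)"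
  shows "balance \<omega> = 0"
  using assms
proof (induction A arbitrary: \<omega> rule: finite_induct)
  case empty
  have op: "open \<Omega>" using domain by (simp add: smooth_bounded_domain_def)
  \<comment> \<open>With no set left, the weight vanishes on the open domain, and so do its
    derivatives there, although it may be nonzero outside.\<close>
  have z: "\<omega> y = 0" "dderiv i \<omega> y = 0" if "y \<in> \<Omega>" for i y
    using empty(5) that dderiv_eq_0_outside[OF op that, of \<omega>] by auto
  have zz: "r w * \<omega> (fst w) = 0" "i \<in> Basis \<Longrightarrow> N i w * \<omega> (fst w) = 0" "i \<in> Basis \<Longrightarrow> N i w * dderiv i \<omega> (fst w) = 0" for i w
    using z supp(3)[of w] supp(4)[of i w] by (auto simp: mem_Times_iff)
  show ?case by (simp add: balance_def zz cong: sum.cong_simp del: mult_eq_0_iff)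
next
  case (insert a A)
  have C: "Cinf_on UNIV (\<lambda>x. 1 + (-1) * \<zeta> a x)"
    by (intro Cinf_add Cinf_mult Cinf_const insert.prems(1)) simp
  have C1: "Cinf_on UNIV (\<lambda>x. \<omega> x * \<zeta> a x)" "Cinf_on UNIV (\<lambda>x. \<omega> x * (1 + (-1) * \<zeta> a x))"
    by (intro Cinf_mult C insert.prems(1,4); simp)+
  have "balance (\<lambda>x. \<omega> x * (1 + (-1) * \<zeta> a x)) = 0"
  proof (rule insert.IH[OF insert.prems(1-3) C1(2)])
    fix y assume y: "y \<in> \<Omega>" "\<omega> y * (1 + (-1) * \<zeta> a y) \<noteq> 0"
    then have "y \<in> (\<Union>a\<in>insert a A. W a)" using insert.prems(5) by auto
    moreover have "y \<notin> W a" using insert.prems(2)[of a y] y(2) by auto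
    ultimately show "y \<in> (\<Union>a\<in>A. W a)" by auto
  qed auto
  moreover have "balance (\<lambda>x. \<omega> x * \<zeta> a x) = 0" by (intro insert.prems) simp_all
  moreover have "balance (\<lambda>x. \<omega> x * \<zeta> a x + \<omega> x * (1 + (-1) * \<zeta> a x)) = balance \<omega>"
    by (simp add: algebra_simps)
  ultimately show ?case using balance_add[OF C1] by simp
qed

text \<open>With the constant weight 1 the terms containing the gradient of the weight drop out. The
  closure is compact, so finitely many half-radius balls cover it; each plateau is 1 on its
  half-radius ball and 0 outside the full ball, where the inward direction need not work.\<close>

lemma balance_global:
  assumes T: "T > 0"
  shows "(\<integral>w. u w * r w \<partial>lborel) + (\<Sum>i\<in>Basis. \<integral>w. D i w * N i w \<partial>lborel) = 0"
proof -
  have ex: "\<exists>\<rho> v \<delta> e. \<rho> > 0 \<and> \<delta> > 0 \<and> e > 0 \<and>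
    (\<forall>y w \<epsilon>. y \<in> \<Omega> \<longrightarrow> y \<in> ball z \<rho> \<longrightarrow> w \<in> cball v \<delta> \<longrightarrow> 0 < \<epsilon> \<longrightarrow> \<epsilon> < e \<longrightarrow> y + \<epsilon> *\<^sub>R w \<in> \<Omega>)"
    if "z \<in> closure \<Omega>" for z
    using inward_direction[OF domain that] by metis
  then obtain \<rho> v \<delta> e where \<rho>: "\<And>z. z \<in> closure \<Omega> \<Longrightarrow> \<rho> z > 0 \<and> \<delta> z > 0 \<and> e z > (0 :: real)"
    and inw: "\<And>z y w \<epsilon>. z \<in> closure \<Omega> \<Longrightarrow> y \<in> \<Omega> \<Longrightarrow> y \<in> ball z (\<rho> z) \<Longrightarrow> w \<in> cball (v z) (\<delta> z) \<Longrightarrow> 0 < \<epsilon> \<Longrightarrow>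
      \<epsilon> < e z \<Longrightarrow> y + \<epsilon> *\<^sub>R w \<in> \<Omega>"
    by metis
  have "\<exists>f. Cinf_on UNIV f \<and> (\<forall>x \<in> ball z (\<rho> z / 2). f x = 1) \<and> (\<forall>x. x \<notin> ball z (\<rho> z) \<longrightarrow> f x = 0)"
    if "z \<in> closure \<Omega>" for z
    using plateau_exists[of "\<rho> z / 2" "\<rho> z" z] \<rho>[OF that] by (metis field_sum_of_halves half_gt_zero less_add_same_cancel1)
  then obtain \<zeta> where \<zeta>: "\<And>z. z \<in> closure \<Omega> \<Longrightarrow> Cinf_on UNIV (\<zeta> z)"
    "\<And>z x. z \<in> closure \<Omega> \<Longrightarrow> x \<in> ball z (\<rho> z / 2) \<Longrightarrow> \<zeta> z x = 1"
    "\<And>z x. z \<in> closure \<Omega> \<Longrightarrow> x \<notin> ball z (\<rho> z) \<Longrightarrow> \<zeta> z x = 0" by metis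
  have cpt: "compact (closure \<Omega>)" using domain by (simp add: smooth_bounded_domain_def)
  have cov: "closure \<Omega> \<subseteq> (\<Union>z\<in>closure \<Omega>. ball z (\<rho> z / 2))" using \<rho> by force
  obtain A where A: "A \<subseteq> closure \<Omega>" "finite A" "closure \<Omega> \<subseteq> (\<Union>z\<in>A. ball z (\<rho> z / 2))"
    using compactE_image[OF cpt _ cov] by (metis open_ball)
  have "balance (\<lambda>_. 1) = 0"
  proof (rule balance_cover[OF A(2), where \<zeta> = \<zeta> and W = "\<lambda>z. ball z (\<rho> z / 2)"])
    show "balance (\<lambda>x. \<omega> x * \<zeta> a x) = 0" if "a \<in> A" "Cinf_on UNIV \<omega>" for a \<omega>
    proof (rule balance_local[where v = "v a" and \<delta> = "\<delta> a" and e = "e a"])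
      have a: "a \<in> closure \<Omega>" using that A by auto
      show "Cinf_on UNIV (\<lambda>x. \<omega> x * \<zeta> a x)" by (intro Cinf_mult that \<zeta> a)
      show "\<delta> a > 0" "e a > 0" using \<rho>[OF a] by auto
      show "y + \<epsilon> *\<^sub>R w \<in> \<Omega>" if "y \<in> \<Omega>" "\<omega> y * \<zeta> a y \<noteq> 0" "w \<in> cball (v a) (\<delta> a)" "0 < \<epsilon>" "\<epsilon> < e a" for y w \<epsilon>
        by (rule inw[OF a that(1) _ that(3-5)]) (use that(2) \<zeta>(3)[OF a] in auto)
    qed (rule T)
    show "Cinf_on UNIV (\<zeta> a)" "x \<in> ball a (\<rho> a / 2) \<Longrightarrow> \<zeta> a x = 1" if "a \<in> A" for a x
      using \<zeta> A(1) that by auto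
    show "y \<in> (\<Union>a\<in>A. ball a (\<rho> a / 2))" if "y \<in> \<Omega>" for y
      using A(3) that closure_subset by blast
  qed (rule Cinf_const)
  then show ?thesis
    by (simp add: balance_def frechet_derivative_const)
qed

end

section \<open>Primitives on the real line and Gronwall\<close>

text \<open>The triangles above and below the diagonal contribute equally to the square of the
  integral, and the diagonal is null. This replaces differentiating the square of the
  primitive.\<close>

lemma integral_primitive_mult:
  fixes g :: "real \<Rightarrow> real"
  assumes g: "integrable lborel g"
  shows "(\<integral>s. g s * (\<integral>\<tau>. indicator {..<s} \<tau> * g \<tau> \<partial>lborel) \<partial>lborel) = (integral\<^sup>L lborel g)\<^sup>2 / 2"
proof -
  have [measurable]: "g \<in> borel_measurable borel" using g by auto
  let ?P = "lborel \<Otimes>\<^sub>M lborel :: (real \<times> real) measure"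
  have int: "integrable ?P (\<lambda>(s, \<tau>). g s * g \<tau>)" by (rule integrable_lborel_product[OF g g])
  have [measurable]: "Measurable.pred (borel \<Otimes>\<^sub>M borel) (\<lambda>p :: real \<times> real. snd p < fst p)"
    "Measurable.pred (borel \<Otimes>\<^sub>M borel) (\<lambda>p :: real \<times> real. fst p < snd p)" by measurable
  let ?L = "\<lambda>(s, \<tau>). indicator {..<s} \<tau> * (g s * g \<tau>)"
  let ?U = "\<lambda>(s, \<tau>). indicator {..<\<tau>} s * (g s * g \<tau>)"
  have iL: "integrable ?P ?L"
    by (rule integrable_dominated[OF int]) (auto simp: indicator_def case_prod_unfold)
  have iU: "integrable ?P ?U"
    by (rule integrable_dominated[OF int]) (auto simp: indicator_def case_prod_unfold)
  have L: "(\<integral>s. g s * (\<integral>\<tau>. indicator {..<s} \<tau> * g \<tau> \<partial>lborel) \<partial>lborel) = integral\<^sup>L ?P ?L"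
    using lborel_pair.integral_fst[OF iL] by (simp add: mult_ac flip: integral_mult_right_zero)
  have U: "(\<integral>s. g s * (\<integral>\<tau>. indicator {..<s} \<tau> * g \<tau> \<partial>lborel) \<partial>lborel) = integral\<^sup>L ?P ?U"
    using lborel_pair.integral_snd[OF iU] by (simp add: mult_ac flip: integral_mult_right_zero)
  have "integral\<^sup>L ?P ?L + integral\<^sup>L ?P ?U = (\<integral>p. ?L p + ?U p \<partial>?P)"
    using iL iU by simp
  also have "\<dots> = (\<integral>s. \<integral>\<tau>. ?L (s, \<tau>) + ?U (s, \<tau>) \<partial>lborel \<partial>lborel)"
    by (rule lborel_pair.integral_fst'[symmetric, OF Bochner_Integration.integrable_add[OF iL iU]])
  also have "\<dots> = (\<integral>s. \<integral>\<tau>. g s * g \<tau> \<partial>lborel \<partial>lborel)"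
  proof (rule Bochner_Integration.integral_cong[OF refl])
    fix s :: real
    show "(\<integral>\<tau>. ?L (s, \<tau>) + ?U (s, \<tau>) \<partial>lborel) = (\<integral>\<tau>. g s * g \<tau> \<partial>lborel)"
    proof (rule integral_cong_AE)
      show "AE \<tau> in lborel. ?L (s, \<tau>) + ?U (s, \<tau>) = g s * g \<tau>"
        using AE_lborel_singleton[of s] by eventually_elim (auto simp: indicator_def)
    qed (auto simp: indicator_def)
  qed
  also have "\<dots> = (integral\<^sup>L lborel g)\<^sup>2" by (simp add: power2_eq_square)
  finally show ?thesis using L U by simp
qed

text \<open>Cauchy-Schwarz on an interval of length L, read off from the nonnegative integral of the
  squared deviation of f from its mean.\<close>

lemma integral_square_le:
  fixes f :: "real \<Rightarrow> real"
  assumes f: "integrable lborel f" "integrable lborel (\<lambda>x. (f x)\<^sup>2)"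
    and S: "\<And>x. x \<notin> {0<..<L} \<Longrightarrow> f x = 0" and "L > 0"
  shows "(\<integral>x. f x \<partial>lborel)\<^sup>2 \<le> L * (\<integral>x. (f x)\<^sup>2 \<partial>lborel)"
proof -
  define a where "a = (\<integral>x. f x \<partial>lborel)"
  have i: "integrable lborel (\<lambda>x. indicator {0<..<L} x :: real)"
    by (intro integrable_real_indicator emeasure_bounded_finite) auto
  have "0 \<le> (\<integral>x. (f x - a / L * indicator {0<..<L} x)\<^sup>2 \<partial>lborel)" by simp
  also have "\<dots> = (\<integral>x. (f x)\<^sup>2 - 2 * (a / L) * f x + (a / L)\<^sup>2 * indicator {0<..<L} x \<partial>lborel)"
    by (rule Bochner_Integration.integral_cong) (use S in \<open>auto simp: power2_diff indicator_def\<close>)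
  also have "\<dots> = (\<integral>x. (f x)\<^sup>2 \<partial>lborel) - 2 * (a / L) * a + (a / L)\<^sup>2 * L"
    using f i \<open>L > 0\<close> by (simp add: a_def)
  also have "\<dots> = (\<integral>x. (f x)\<^sup>2 \<partial>lborel) - a\<^sup>2 / L"
    using \<open>L > 0\<close> by (simp add: field_simps power2_eq_square)
  finally show ?thesis using \<open>L > 0\<close> by (simp add: a_def field_simps)
qed

text \<open>Averaging f over [w, w + \<open>\<epsilon>\<close>) gives a difference quotient of the
  primitive, hence zero for a.e. w. Pairing this average with f and letting
  \<open>\<epsilon>\<close> tend to 0 shows that the integral of the square of f is zero.\<close>

lemma primitive_eq_0_imp_AE_0:
  fixes f :: "real \<Rightarrow> real"
  assumes f: "L2fun f" and S: "\<And>x. x \<notin> cball 0 R \<Longrightarrow> f x = 0"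
    and F: "AE s in lborel. (\<integral>\<tau>. indicator {..<s} \<tau> * f \<tau> \<partial>lborel) = 0"
  shows "AE x in lborel. f x = 0"
proof -
  have fi: "integrable lborel f" "integrable lborel (\<lambda>x. (f x)\<^sup>2)" and [measurable]: "f \<in> borel_measurable borel"
    using f by (auto simp: L2fun_def)
  define \<epsilon> where "\<epsilon> n = 1 / (real n + 1)" for n
  have \<epsilon>: "\<epsilon> n > 0" for n by (simp add: \<epsilon>_def)
  define E where "E n h = indicator {0..<\<epsilon> n} h / \<epsilon> n" for n and h :: real
  have [measurable]: "E n \<in> borel_measurable borel" for n unfolding E_def by measurable
  have i: "integrable lborel (\<lambda>x. indicator {0..<\<epsilon> n} x :: real)" for n
    by (intro integrable_real_indicator emeasure_bounded_finite) auto
  have E: "kernel (E n)" for n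
    unfolding kernel_def E_def using i[of n] \<epsilon>[of n] by auto
  have EB: "\<bar>E n h\<bar> \<le> 1 / \<epsilon> n" for n h using \<epsilon>[of n] by (auto simp: E_def indicator_def)
  have shrink: "\<forall>\<^sub>F n in sequentially. \<forall>h. E n h \<noteq> 0 \<longrightarrow> norm h < d" if "d > 0" for d
  proof -
    have "\<epsilon> \<longlonglongrightarrow> 0" unfolding \<epsilon>_def using LIMSEQ_inverse_real_of_nat by (simp add: inverse_eq_divide add.commute)
    then have "\<forall>\<^sub>F n in sequentially. \<epsilon> n < d" using that by (rule order_tendstoD)
    then show ?thesis by eventually_elim (auto simp: E_def indicator_def split: if_splits)
  qed
  have ind: "integrable lborel (\<lambda>\<tau>. indicator {..<s} \<tau> * f \<tau>)" for s
    by (rule integrable_dominated[OF fi(1)]) (auto simp: indicator_def)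
  have "conv f f (E n) = 0" for n
  proof -
    let ?F = "\<lambda>s. \<integral>\<tau>. indicator {..<s} \<tau> * f \<tau> \<partial>lborel"
    have [measurable]: "?F \<in> borel_measurable borel"
    proof -
      have [measurable]: "Measurable.pred (borel \<Otimes>\<^sub>M borel) (\<lambda>p :: real \<times> real. snd p < fst p)" by measurable
      have "(\<lambda>(s, \<tau>). indicator {..<s} \<tau> * f \<tau>) \<in> borel_measurable (borel \<Otimes>\<^sub>M lborel)"
        by (auto simp: indicator_def case_prod_unfold)
      then show ?thesis by (rule lborel.borel_measurable_lebesgue_integral)
    qed
    \<comment> \<open>Null sets are translation invariant, so for a.e. w the primitive vanishes at w
      and at w + \<open>\<epsilon>\<close> simultaneously.\<close>
    have "AE s in lborel. ?F (\<epsilon> n + 1 * s) = 0"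
      by (rule AE_borel_affine[OF _ _ F]) auto
    then have "AE w in lborel. f w * (\<integral>z. f z * E n (z - w) \<partial>lborel) = 0"
      using F
    proof eventually_elim
      case (elim w)
      have "f z * E n (z - w) = (indicator {..<\<epsilon> n + 1 * w} z * f z - indicator {..<w} z * f z) / \<epsilon> n" for z
        using \<epsilon>[of n] by (auto simp: E_def indicator_def)
      then have "(\<integral>z. f z * E n (z - w) \<partial>lborel) = (?F (\<epsilon> n + 1 * w) - ?F w) / \<epsilon> n"
        using ind by simp
      then show ?case using elim by simp
    qed
    then have "(\<integral>w. f w * (\<integral>z. f z * E n (z - w) \<partial>lborel) \<partial>lborel) = 0"
      by (rule integral_eq_zero_AE)
    then show ?thesis using conv_iterated(1)[OF fi(1) fi(1), of "E n" "1 / \<epsilon> n"] EB by simp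
  qed
  moreover have "(\<lambda>n. conv f f (E n)) \<longlonglongrightarrow> (\<integral>x. f x * f x \<partial>lborel)"
    by (rule conv_tendsto[OF f S f E shrink])
  ultimately have "(\<integral>x. (f x)\<^sup>2 \<partial>lborel) = 0" by (simp add: LIMSEQ_const_iff power2_eq_square)
  then show ?thesis using fi(2) by (subst (asm) integral_nonneg_eq_0_iff_AE) auto
qed

text \<open>Iterating the inequality from y <= Y gives y(t) <= Y (Ct)^n / n! for every n.
  Boundedness and measurability of y suffice, so no continuity of the energy has to be
  shown.\<close>

lemma gronwall_zero:
  fixes y :: "real \<Rightarrow> real"
  assumes [measurable]: "y \<in> borel_measurable borel" and y0: "\<And>t. 0 \<le> y t" and Y: "\<And>t. y t \<le> Y"
    and C: "C \<ge> 0" and ineq: "\<And>t. 0 < t \<Longrightarrow> t \<le> T \<Longrightarrow> y t \<le> C * (\<integral>s. indicator {0<..<t} s * y s \<partial>lborel)"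
    and t: "0 < t" "t \<le> T"
  shows "y t = 0"
proof -
  have "y t \<le> Y * (C * t) ^ n / fact n" if "0 < t" "t \<le> T" for n t
    using that
  proof (induction n arbitrary: t)
    case (Suc n)
    have "continuous_on {0..t} (\<lambda>s. s ^ n)" by (intro continuous_intros)
    from borel_integrable_atLeastAtMost'[OF this]
    have ip: "integrable lborel (\<lambda>s. s ^ n * indicator {0..t} s)"
      by (simp add: set_integrable_def mult.commute)
    have i1: "integrable lborel (\<lambda>s. indicator {0<..<t} s * y s)"
    proof (rule integrable_dominated)
      show "integrable lborel (\<lambda>s. Y * indicator {0<..<t} s)"
        by (intro integrable_mult_right integrable_real_indicator emeasure_bounded_finite) auto
      show "AE s in lborel. norm (indicator {0<..<t} s * y s) \<le> norm (Y * indicator {0<..<t} s)"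
        using y0 Y by (auto simp: indicator_def intro: order_trans[OF _ abs_ge_self])
    qed measurable
    have "y t \<le> C * (\<integral>s. indicator {0<..<t} s * y s \<partial>lborel)" by (rule ineq) (use Suc.prems in auto)
    also have "\<dots> \<le> C * (\<integral>s. Y * C ^ n / fact n * (s ^ n * indicator {0..t} s) \<partial>lborel)"
    proof (intro mult_left_mono integral_mono)
      have "Y \<ge> 0" using order_trans[OF y0 Y] .
      show "indicator {0<..<t} s * y s \<le> Y * C ^ n / fact n * (s ^ n * indicator {0..t} s)" for s
        using Suc.IH[of s] Suc.prems \<open>Y \<ge> 0\<close> C by (auto simp: indicator_def power_mult_distrib)
    qed (use i1 ip C in auto)
    also have "\<dots> = C * (Y * C ^ n / fact n * (t ^ Suc n / Suc n))"
      using Suc.prems by (simp add: integral_power)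
    also have "\<dots> = Y * (C * t) ^ Suc n / fact (Suc n)"
      by (simp add: power_mult_distrib field_simps)
    finally show ?case .
  qed (use Y in simp)
  then have "y t \<le> Y * (C * t) ^ n / fact n" for n using t by blast
  moreover have "(\<lambda>n. Y * (C * t) ^ n / fact n) \<longlonglongrightarrow> 0"
    using tendsto_mult_left[OF summable_LIMSEQ_zero[OF summable_exp[of "C * t"]], of Y]
    by (simp add: field_simps)
  ultimately have "y t \<le> 0" by (intro LIMSEQ_le_const) auto
  then show ?thesis using y0[of t] by simp
qed

section \<open>The energy estimate\<close>

lemma integrable_cut_test:
  fixes f :: "'d::euclidean_space \<times> real \<Rightarrow> real"
  assumes f: "L2fun f" and S: "\<And>z. z \<notin> cball 0 R \<Longrightarrow> f z = 0" and c: "Cinf_on UNIV c"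
  shows "integrable lborel (\<lambda>w. indicator {..<t} (snd w) * f w * c (fst w))"
proof -
  have 1: "L2fun (\<lambda>w. f w * c (fst w))"
    by (rule L2fun_mult_continuous[OF f Cinf_continuous_on_fst[OF c] S])
  then have [measurable]: "(\<lambda>w. f w * c (fst w)) \<in> borel_measurable borel" by (simp add: L2fun_def)
  have [measurable]: "snd \<in> borel_measurable (borel :: ('d \<times> real) measure)"
    by (intro borel_measurable_continuous_onI continuous_intros)
  have m: "(\<lambda>w. indicator {..<t} (snd w) * (f w * c (fst w))) \<in> borel_measurable lborel" by measurable
  have "integrable lborel (\<lambda>w. f w * c (fst w))" using 1 by (simp add: L2fun_def)
  then have "integrable lborel (\<lambda>w. indicator {..<t} (snd w) * (f w * c (fst w)))"
    by (rule integrable_dominated[OF _ m]) (auto simp: indicator_def)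
  then show ?thesis by (simp add: mult.assoc)
qed

text \<open>Borel data extended by zero: \<open>D\<close> is the weak gradient of \<open>u\<close>
  and \<open>M\<close> the difference of the fluxes, so that \<open>D i - M i\<close> are the
  components of the difference of the partial gradients of \<open>sstar\<close>. Since
  \<open>M\<close> vanishes at times up to 0, the factor \<open>indicator {..<t}\<close> encodes
  integration from 0 to t.\<close>

locale flux_system =
  fixes \<Omega> :: "'d::euclidean_space set" and T R C :: real
    and u r :: "'d \<times> real \<Rightarrow> real" and D M :: "'d \<Rightarrow> 'd \<times> real \<Rightarrow> real"
  assumes domain: "smooth_bounded_domain \<Omega>" and T: "T > 0" and C: "C > 0"
    and L2: "L2fun u" "L2fun r" "\<And>i. i \<in> Basis \<Longrightarrow> L2fun (D i)" "\<And>i. i \<in> Basis \<Longrightarrow> L2fun (M i)"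
    and bdd: "\<Omega> \<times> {0<..<T + 1} \<subseteq> cball 0 R"
    and supp: "\<And>z. z \<notin> \<Omega> \<times> {0<..<T + 1} \<Longrightarrow> u z = 0" "\<And>z. z \<notin> \<Omega> \<times> {0<..<T + 1} \<Longrightarrow> r z = 0"
      "\<And>z i. i \<in> Basis \<Longrightarrow> z \<notin> \<Omega> \<times> {0<..<T + 1} \<Longrightarrow> D i z = 0"
      "\<And>z i. i \<in> Basis \<Longrightarrow> z \<notin> \<Omega> \<times> {0<..<T + 1} \<Longrightarrow> M i z = 0"
    and weak_grad: "\<And>i \<phi> K. \<lbrakk>i \<in> Basis; Cinf_on UNIV \<phi>; compact K; K \<subseteq> \<Omega> \<times> {0<..<T + 1};
        \<And>z. z \<notin> K \<Longrightarrow> \<phi> z = 0\<rbrakk> \<Longrightarrow>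
        (\<integral>z. u z * dderiv (i, 0) \<phi> z \<partial>lborel) = - (\<integral>z. D i z * \<phi> z \<partial>lborel)"
    and weak_eq: "AE t in lborel. 0 < t \<longrightarrow> t < T + 1 \<longrightarrow> (\<forall>\<psi>. Cinf_on UNIV \<psi> \<longrightarrow>
        (\<integral>y. r (y, t) * \<psi> y \<partial>lborel)
          = - (\<Sum>i\<in>Basis. \<integral>w. indicator {..<t} (snd w) * M i w * dderiv i \<psi> (fst w) \<partial>lborel))"
    and coercive: "AE z in lborel. 0 \<le> r z * u z \<and> (\<Sum>i\<in>Basis. (D i z - M i z)\<^sup>2) \<le> C * (r z * u z)"
begin

definition N :: "'d \<Rightarrow> 'd \<times> real \<Rightarrow> real" where
  "N i w = (\<integral>\<tau>. indicator {..<snd w} \<tau> * M i (fst w, \<tau>) \<partial>lborel)"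

text \<open>Cutting \<open>r\<close> and \<open>N\<close> at time t, rather than using a weight that
  depends on time, yields the balance on (0,t) for each t while \<open>u\<close> and
  \<open>D\<close> keep their longer time interval.\<close>

definition cut :: "real \<Rightarrow> ('d \<times> real \<Rightarrow> real) \<Rightarrow> 'd \<times> real \<Rightarrow> real" where
  "cut t f w = indicator {0<..<t} (snd w) * f w"

lemma measurable_M [measurable]: "i \<in> Basis \<Longrightarrow> M i \<in> borel_measurable borel"
  using L2 by (simp add: L2fun_def)

lemma measurable_N [measurable]: "i \<in> Basis \<Longrightarrow> N i \<in> borel_measurable borel"
proof -
  assume i: "i \<in> Basis"
  note [measurable] = measurable_M[OF i]
  have "{p :: ('d \<times> real) \<times> real. snd p < snd (fst p)} \<in> sets borel"
    by (intro borel_open open_Collect_less continuous_intros)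
  moreover have "(\<lambda>p :: ('d \<times> real) \<times> real. M i (fst (fst p), snd p)) \<in> borel_measurable borel"
    by (rule measurable_compose[OF borel_measurable_continuous_onI measurable_M[OF i]]) (intro continuous_intros)
  ultimately have "(\<lambda>p :: ('d \<times> real) \<times> real. indicator {p. snd p < snd (fst p)} p * M i (fst (fst p), snd p)) \<in> borel_measurable borel"
    by measurable
  also have "(\<lambda>p. indicator {p. snd p < snd (fst p)} p * M i (fst (fst p), snd p)) = (\<lambda>(w, \<tau>). indicator {..<snd w} \<tau> * M i (fst w, \<tau>))"
    by (auto simp: indicator_def)
  finally have "(\<lambda>(w, \<tau>). indicator {..<snd w} \<tau> * M i (fst w, \<tau>)) \<in> borel_measurable (borel \<Otimes>\<^sub>M lborel)"
    by (simp flip: borel_prod)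
  then show "N i \<in> borel_measurable borel"
    unfolding N_def by (rule lborel.borel_measurable_lebesgue_integral)
qed

lemma M_slice:
  assumes i: "i \<in> Basis"
  shows "AE y in lborel. integrable lborel (\<lambda>\<tau>. M i (y, \<tau>)) \<and> integrable lborel (\<lambda>\<tau>. (M i (y, \<tau>))\<^sup>2)"
    and "integrable lborel (\<lambda>y. \<integral>\<tau>. (M i (y, \<tau>))\<^sup>2 \<partial>lborel)"
proof -
  have 1: "integrable (lborel \<Otimes>\<^sub>M lborel) (\<lambda>(y, \<tau>). M i (y, \<tau>))" "integrable (lborel \<Otimes>\<^sub>M lborel) (\<lambda>(y, \<tau>). (M i (y, \<tau>))\<^sup>2)"
    using L2(4)[OF i] by (auto simp: lborel_prod case_prod_unfold L2fun_def)
  show "AE y in lborel. integrable lborel (\<lambda>\<tau>. M i (y, \<tau>)) \<and> integrable lborel (\<lambda>\<tau>. (M i (y, \<tau>))\<^sup>2)"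
    using lborel_pair.AE_integrable_fst[OF 1(1)] lborel_pair.AE_integrable_fst[OF 1(2)] by simp
  show "integrable lborel (\<lambda>y. \<integral>\<tau>. (M i (y, \<tau>))\<^sup>2 \<partial>lborel)"
    by (rule lborel_pair.integrable_fst[OF 1(2)])
qed

text \<open>Cauchy-Schwarz in time, over an interval of length T + 1. The null set of y is the same
  for all t, and the bound is free of t; it gives both square integrability of \<open>N\<close> and
  the a priori bound for Gronwall.\<close>

lemma N_square_le:
  assumes i: "i \<in> Basis"
  shows "AE y in lborel. \<forall>t. (N i (y, t))\<^sup>2 \<le> (T + 1) * (\<integral>\<tau>. (M i (y, \<tau>))\<^sup>2 \<partial>lborel)"
  using M_slice(1)[OF i]
proof eventually_elim
  case (elim y)
  note [measurable] = measurable_M[OF i]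
  show ?case
  proof
    fix t
    have [measurable]: "(\<lambda>\<tau>. M i (y, \<tau>)) \<in> borel_measurable borel" using elim by auto
    let ?f = "\<lambda>\<tau>. indicator {..<t} \<tau> * M i (y, \<tau>)"
    have f: "integrable lborel ?f" "integrable lborel (\<lambda>\<tau>. (?f \<tau>)\<^sup>2)"
      by (rule integrable_dominated[OF elim[THEN conjunct1]], auto simp: indicator_def)
        (rule integrable_dominated[OF elim[THEN conjunct2]], auto simp: indicator_def)
    have "(N i (y, t))\<^sup>2 \<le> (T + 1) * (\<integral>\<tau>. (?f \<tau>)\<^sup>2 \<partial>lborel)"
      unfolding N_def fst_conv snd_conv by (rule integral_square_le[OF f]) (use supp(4)[OF i] T in auto)
    also have "(\<integral>\<tau>. (?f \<tau>)\<^sup>2 \<partial>lborel) \<le> (\<integral>\<tau>. (M i (y, \<tau>))\<^sup>2 \<partial>lborel)"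
      by (rule integral_mono[OF f(2) elim[THEN conjunct2]]) (auto simp: indicator_def)
    finally show "(N i (y, t))\<^sup>2 \<le> (T + 1) * (\<integral>\<tau>. (M i (y, \<tau>))\<^sup>2 \<partial>lborel)"
      using T by (simp add: mult_left_mono)
  qed
qed

lemma N_outside: "i \<in> Basis \<Longrightarrow> y \<notin> \<Omega> \<Longrightarrow> N i (y, t) = 0"
  using supp(4) by (simp add: N_def)

lemma N_nonpos: "i \<in> Basis \<Longrightarrow> t \<le> 0 \<Longrightarrow> N i (y, t) = 0"
proof -
  assume "i \<in> Basis" "t \<le> 0"
  then have "indicator {..<t} \<tau> * M i (y, \<tau>) = 0" for \<tau>
    using supp(4)[of i "(y, \<tau>)"] by (auto simp: indicator_def)
  then show ?thesis by (simp only: N_def fst_conv snd_conv integral_zero)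
qed

lemma integrable_N_slice:
  assumes i: "i \<in> Basis"
  shows "integrable lborel (\<lambda>y. (N i (y, t))\<^sup>2)"
    and "(\<integral>y. (N i (y, t))\<^sup>2 \<partial>lborel) \<le> (T + 1) * (\<integral>y. \<integral>\<tau>. (M i (y, \<tau>))\<^sup>2 \<partial>lborel \<partial>lborel)"
proof -
  note [measurable] = measurable_N[OF i]
  have I: "integrable lborel (\<lambda>y. (T + 1) * (\<integral>\<tau>. (M i (y, \<tau>))\<^sup>2 \<partial>lborel))"
    using M_slice(2)[OF i] by simp
  have AE: "AE y in lborel. (N i (y, t))\<^sup>2 \<le> (T + 1) * (\<integral>\<tau>. (M i (y, \<tau>))\<^sup>2 \<partial>lborel)"
    using N_square_le[OF i] by auto
  show 1: "integrable lborel (\<lambda>y. (N i (y, t))\<^sup>2)"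
    by (rule integrable_dominated[OF I]) (use AE in \<open>auto elim!: eventually_mono intro: order_trans[OF _ abs_ge_self]\<close>)
  show "(\<integral>y. (N i (y, t))\<^sup>2 \<partial>lborel) \<le> (T + 1) * (\<integral>y. \<integral>\<tau>. (M i (y, \<tau>))\<^sup>2 \<partial>lborel \<partial>lborel)"
    using integral_mono_AE[OF 1 I AE] by simp
qed

lemma measurable_cut:
  assumes [measurable]: "f \<in> borel_measurable borel"
  shows "cut t f \<in> borel_measurable borel"
proof -
  have [measurable]: "snd \<in> borel_measurable (borel :: ('d \<times> real) measure)"
    by (intro borel_measurable_continuous_onI continuous_intros)
  show ?thesis unfolding cut_def[abs_def] by measurable
qed

lemma L2fun_cut: "L2fun f \<Longrightarrow> L2fun (cut t f)"
proof -
  assume f: "L2fun f"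
  then have [measurable]: "f \<in> borel_measurable borel" by (simp add: L2fun_def)
  have m: "cut t f \<in> borel_measurable borel"
    by (rule measurable_cut) measurable
  show "L2fun (cut t f)"
    unfolding L2fun_def
  proof (intro conjI m)
    show "integrable lborel (cut t f)"
      by (rule integrable_dominated[of _ f]) (use f m in \<open>auto simp: L2fun_def cut_def indicator_def\<close>)
    show "integrable lborel (\<lambda>x. (cut t f x)\<^sup>2)"
    proof (rule integrable_dominated[of _ "\<lambda>x. (f x)\<^sup>2"])
      show "(\<lambda>x. (cut t f x)\<^sup>2) \<in> borel_measurable lborel" using m by measurable
    qed (use f in \<open>auto simp: L2fun_def cut_def indicator_def\<close>)
  qed
qed

lemma cut_N:
  assumes i: "i \<in> Basis" and t: "t \<le> T"
  shows "L2fun (cut t (N i))" "z \<notin> \<Omega> \<times> {0<..<T} \<Longrightarrow> cut t (N i) z = 0"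
    and "(\<integral>w. (cut t (N i) w)\<^sup>2 \<partial>lborel) = (\<integral>s. indicator {0<..<t} s * (\<integral>y. (N i (y, s))\<^sup>2 \<partial>lborel) \<partial>lborel)"
    and "integrable lborel (\<lambda>s. indicator {0<..<t} s * (\<integral>y. (N i (y, s))\<^sup>2 \<partial>lborel))"
proof -
  note [measurable] = measurable_N[OF i] measurable_M[OF i]
  show out: "cut t (N i) z = 0" if "z \<notin> \<Omega> \<times> {0<..<T}" for z
    using that N_outside[OF i] t by (cases z) (auto simp: cut_def indicator_def)
  have m: "cut t (N i) \<in> borel_measurable borel"
    by (rule measurable_cut) measurable
  let ?B = "\<lambda>y. (T + 1) * (\<integral>\<tau>. (M i (y, \<tau>))\<^sup>2 \<partial>lborel)"
  have [measurable]: "?B \<in> borel_measurable borel"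
    using M_slice(2)[OF i] by auto
  have IB: "integrable lborel ?B" using M_slice(2)[OF i] by simp
  have it: "integrable lborel (\<lambda>s. indicator {0<..<t} s :: real)"
    by (intro integrable_real_indicator emeasure_bounded_finite) auto
  have int: "integrable (lborel \<Otimes>\<^sub>M lborel) (\<lambda>(y, s). ?B y * indicator {0<..<t} s)"
    by (rule integrable_lborel_product[OF IB it])
  have "AE z in lborel \<Otimes>\<^sub>M lborel. (cut t (N i) z)\<^sup>2 \<le> (case z of (y, s) \<Rightarrow> ?B y * indicator {0<..<t} s)"
  proof (rule lborel_pair.AE_pair_measure)
    have [measurable]: "cut t (N i) \<in> borel_measurable (lborel \<Otimes>\<^sub>M lborel)"
      using m by (simp add: lborel_prod)
    show "{z \<in> space (lborel \<Otimes>\<^sub>M lborel). (cut t (N i) z)\<^sup>2 \<le> (case z of (y, s) \<Rightarrow> ?B y * indicator {0<..<t} s)}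
        \<in> sets (lborel \<Otimes>\<^sub>M lborel)" by measurable
    show "AE y in lborel. AE s in lborel. (cut t (N i) (y, s))\<^sup>2 \<le> (case (y, s) of (y, s) \<Rightarrow> ?B y * indicator {0<..<t} s)"
      using N_square_le[OF i] by eventually_elim (auto simp: cut_def indicator_def)
  qed
  then have AE: "AE z in lborel. norm ((cut t (N i) z)\<^sup>2) \<le> norm (case z of (y, s) \<Rightarrow> ?B y * indicator {0<..<t} s)"
    unfolding lborel_prod by eventually_elim auto
  have i2: "integrable lborel (\<lambda>z. (cut t (N i) z)\<^sup>2)"
    by (rule integrable_dominated[OF int[unfolded lborel_prod]]) (use m AE in auto)
  show "L2fun (cut t (N i))"
  proof (rule L2_bounded_support[OF m i2])
    show "cut t (N i) x = 0" if "x \<notin> cball 0 R" for x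
    proof (rule out)
      show "x \<notin> \<Omega> \<times> {0<..<T}" using that bdd by (cases x) force
    qed
  qed
  have i2': "integrable (lborel \<Otimes>\<^sub>M lborel) (\<lambda>(y, s). (cut t (N i) (y, s))\<^sup>2)"
    using i2 by (simp add: lborel_prod case_prod_unfold)
  have eq: "(\<integral>y. (cut t (N i) (y, s))\<^sup>2 \<partial>lborel) = indicator {0<..<t} s * (\<integral>y. (N i (y, s))\<^sup>2 \<partial>lborel)" for s
    by (simp add: cut_def indicator_def)
  show "(\<integral>w. (cut t (N i) w)\<^sup>2 \<partial>lborel) = (\<integral>s. indicator {0<..<t} s * (\<integral>y. (N i (y, s))\<^sup>2 \<partial>lborel) \<partial>lborel)"
    using lborel_pair.integral_snd[OF i2'] unfolding eq by (simp add: lborel_prod case_prod_unfold)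
  show "integrable lborel (\<lambda>s. indicator {0<..<t} s * (\<integral>y. (N i (y, s))\<^sup>2 \<partial>lborel))"
    using lborel_pair.integrable_snd[OF i2'] unfolding eq .
qed

text \<open>At times s in (0,t), Fubini turns the space-time integral of \<open>M\<close> against a
  gradient constant in time into the spatial integral of \<open>N\<close> at time s. At all other
  times both sides vanish by the cut.\<close>

lemma weak_pair_cut:
  assumes t: "t \<le> T"
  shows "weak_pair \<Omega> T R u (cut t r) D (\<lambda>i. cut t (N i))"
proof
  show "cut t r z = 0" if "z \<notin> \<Omega> \<times> {0<..<T}" for z
    using that supp(2)[of z] t by (cases z) (auto simp: cut_def indicator_def)
  show "AE s in lborel. \<forall>\<psi>. Cinf_on UNIV \<psi> \<longrightarrow> (\<integral>y. cut t r (y, s) * \<psi> y \<partial>lborel)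
      = - (\<Sum>i\<in>Basis. \<integral>y. cut t (N i) (y, s) * dderiv i \<psi> y \<partial>lborel)"
    using weak_eq
  proof eventually_elim
    case (elim s)
    show ?case
    proof (intro allI impI)
      fix \<psi> :: "'d \<Rightarrow> real" assume \<psi>: "Cinf_on UNIV \<psi>"
      show "(\<integral>y. cut t r (y, s) * \<psi> y \<partial>lborel) = - (\<Sum>i\<in>Basis. \<integral>y. cut t (N i) (y, s) * dderiv i \<psi> y \<partial>lborel)"
      proof (cases "0 < s \<and> s < t")
        case False
        then have "cut t f (y, s) = 0" for f y by (auto simp: cut_def)
        then show ?thesis by simp
      next
        case True
        then have c: "cut t f (y, s) = f (y, s)" for f y by (auto simp: cut_def)
        have "(\<integral>w. indicator {..<s} (snd w) * M i w * dderiv i \<psi> (fst w) \<partial>lborel) = (\<integral>y. N i (y, s) * dderiv i \<psi> y \<partial>lborel)"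
          if i: "i \<in> Basis" for i
        proof -
          have "M i z = 0" if "z \<notin> cball 0 R" for z using supp(4)[OF i] bdd that by blast
          from integrable_cut_test[OF L2(4)[OF i] this Cinf_dderiv[OF \<psi>]]
          have "integrable (lborel \<Otimes>\<^sub>M lborel) (\<lambda>(y, \<tau>). indicator {..<s} \<tau> * M i (y, \<tau>) * dderiv i \<psi> y)"
            by (simp add: lborel_prod case_prod_unfold)
          from lborel_pair.integral_fst[OF this]
          show ?thesis by (simp add: N_def lborel_prod case_prod_unfold)
        qed
        then show ?thesis using elim \<psi> True t by (simp add: c cong: sum.cong_simp)
      qed
    qed
  qed
  show "L2fun (cut t r)" by (rule L2fun_cut[OF L2(2)])
  show "L2fun (cut t (N i))" if "i \<in> Basis" for i by (rule cut_N(1)[OF that t])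
  show "cut t (N i) z = 0" if "i \<in> Basis" "z \<notin> \<Omega> \<times> {0<..<T}" for i z by (rule cut_N(2)[OF that(1) t that(2)])
  show "(\<integral>z. u z * dderiv (i, 0) \<phi> z \<partial>lborel) = - (\<integral>z. D i z * \<phi> z \<partial>lborel)"
    if "i \<in> Basis" "Cinf_on UNIV \<phi>" "compact K" "K \<subseteq> \<Omega> \<times> {0<..<T + 1}" "\<And>z. z \<notin> K \<Longrightarrow> \<phi> z = 0" for i \<phi> K
    by (rule weak_grad[OF that])
qed (fact domain L2 bdd supp)+

section \<open>The energy of the integrated flux and its vanishing\<close>

definition energy :: "real \<Rightarrow> real" where
  "energy t = (\<Sum>i\<in>Basis. \<integral>y. (N i (y, t))\<^sup>2 \<partial>lborel)"

text \<open>On a.e. line y = const, \<open>N\<close> is the primitive of \<open>M\<close>, so the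
  one-dimensional triangle identity applies to \<open>M\<close> truncated at time t.\<close>

lemma integral_M_N:
  assumes i: "i \<in> Basis" and t: "0 < t" "t \<le> T"
  shows "(\<integral>w. M i w * cut t (N i) w \<partial>lborel) = (\<integral>y. (N i (y, t))\<^sup>2 \<partial>lborel) / 2"
proof -
  have "integrable lborel (\<lambda>w. M i w * cut t (N i) w)"
    using L2(4)[OF i] cut_N(1)[OF i t(2)] by (auto simp: L2fun_def intro!: integrable_mult_L2)
  then have int: "integrable (lborel \<Otimes>\<^sub>M lborel) (\<lambda>(y, s). M i (y, s) * cut t (N i) (y, s))"
    by (simp add: lborel_prod case_prod_unfold)
  have "(\<integral>w. M i w * cut t (N i) w \<partial>lborel) = (\<integral>y. (\<integral>s. M i (y, s) * cut t (N i) (y, s) \<partial>lborel) \<partial>lborel)"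
    using lborel_pair.integral_fst[OF int] by (simp add: lborel_prod case_prod_unfold)
  also have "\<dots> = (\<integral>y. (N i (y, t))\<^sup>2 / 2 \<partial>lborel)"
  proof (rule integral_cong_AE)
    show "(\<lambda>y. \<integral>s. M i (y, s) * cut t (N i) (y, s) \<partial>lborel) \<in> borel_measurable lborel"
      using lborel_pair.integrable_fst[OF int] by auto
    show "(\<lambda>y. (N i (y, t))\<^sup>2 / 2) \<in> borel_measurable lborel"
      using integrable_N_slice(1)[OF i, of t] by auto
    show "AE y in lborel. (\<integral>s. M i (y, s) * cut t (N i) (y, s) \<partial>lborel) = (N i (y, t))\<^sup>2 / 2"
      using M_slice(1)[OF i]
    proof eventually_elim
      case (elim y)
      then have [measurable]: "(\<lambda>\<tau>. M i (y, \<tau>)) \<in> borel_measurable borel" by auto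
      let ?g = "\<lambda>\<tau>. indicator {..<t} \<tau> * M i (y, \<tau>)"
      have g: "integrable lborel ?g"
        by (rule integrable_dominated[OF elim[THEN conjunct1]]) (auto simp: indicator_def)
      \<comment> \<open>For s < t, truncating at t does not alter the primitive up to s, so both
        factors can be written with the same function.\<close>
      have pw: "M i (y, s) * cut t (N i) (y, s) = ?g s * (\<integral>\<tau>. indicator {..<s} \<tau> * ?g \<tau> \<partial>lborel)" for s
      proof (cases "0 < s \<and> s < t")
        case True
        then have eq: "(\<lambda>\<tau>. indicator {..<s} \<tau> * ?g \<tau>) = (\<lambda>\<tau>. indicator {..<s} \<tau> * M i (y, \<tau>))"
          by (auto simp: indicator_def)
        show ?thesis unfolding eq using True by (simp add: cut_def N_def)
      next
        case False
        then show ?thesis using supp(4)[OF i, of "(y, s)"] by (auto simp: cut_def indicator_def)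
      qed
      show ?case unfolding pw integral_primitive_mult[OF g] by (simp add: N_def)
    qed
  qed
  finally show ?thesis by simp
qed

text \<open>Write \<open>D\<close> as \<open>M\<close> plus (\<open>D\<close> - \<open>M\<close>) in
  the global balance: the first part gives half the energy, the second is estimated by Young and
  \<open>coercive\<close>. Half of the product term is absorbed on the left, and the result is
  multiplied by 2.\<close>

lemma energy_inequality:
  assumes t: "0 < t" "t \<le> T"
  shows "(\<integral>w. u w * cut t r w \<partial>lborel) + energy t \<le> C * (\<integral>s. indicator {0<..<t} s * energy s \<partial>lborel)"
proof -
  interpret weak_pair \<Omega> T R u "cut t r" D "\<lambda>i. cut t (N i)" by (rule weak_pair_cut[OF t(2)])
  let ?n = "\<lambda>i. cut t (N i)"
  have IN: "L2fun (?n i)" if "i \<in> Basis" for i by (rule cut_N(1)[OF that t(2)])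
  have I1: "integrable lborel (\<lambda>w. M i w * ?n i w)" "integrable lborel (\<lambda>w. D i w * ?n i w)"
    "integrable lborel (\<lambda>w. (?n i w)\<^sup>2)" if "i \<in> Basis" for i
    using flux_system.L2[OF flux_system_axioms] IN that by (auto simp: L2fun_def intro!: integrable_mult_L2)
  have Iu: "integrable lborel (\<lambda>w. u w * cut t r w)"
    using L2 by (auto simp: L2fun_def intro!: integrable_mult_L2)
  have IS: "integrable lborel (\<lambda>w. \<Sum>i\<in>Basis. (D i w - M i w) * ?n i w)"
    "integrable lborel (\<lambda>w. \<Sum>i\<in>Basis. (?n i w)\<^sup>2)"
    using I1 by (auto simp: left_diff_distrib)
  have "(\<integral>w. u w * cut t r w \<partial>lborel) + (\<Sum>i\<in>Basis. \<integral>w. D i w * ?n i w \<partial>lborel) = 0"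
    by (rule balance_global[OF T])
  moreover have "(\<integral>w. D i w * ?n i w \<partial>lborel) = (\<integral>y. (N i (y, t))\<^sup>2 \<partial>lborel) / 2 + (\<integral>w. (D i w - M i w) * ?n i w \<partial>lborel)"
    if "i \<in> Basis" for i
    using I1[OF that] integral_M_N[OF that t] by (simp add: left_diff_distrib)
  moreover have "(\<Sum>i\<in>Basis. \<integral>w. (D i w - M i w) * ?n i w \<partial>lborel) = (\<integral>w. (\<Sum>i\<in>Basis. (D i w - M i w) * ?n i w) \<partial>lborel)"
    using I1 by (subst Bochner_Integration.integral_sum) (auto simp: left_diff_distrib)
  ultimately have "(\<integral>w. u w * cut t r w \<partial>lborel) + energy t / 2 = - (\<integral>w. (\<Sum>i\<in>Basis. (D i w - M i w) * ?n i w) \<partial>lborel)"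
    by (simp add: energy_def sum.distrib sum_divide_distrib cong: sum.cong_simp)
  also have "\<dots> \<le> (\<integral>w. (1/2) * (u w * cut t r w) + (C/2) * (\<Sum>i\<in>Basis. (?n i w)\<^sup>2) \<partial>lborel)"
    unfolding integral_minus[symmetric]
  proof (rule integral_mono_AE)
    show "AE w in lborel. - (\<Sum>i\<in>Basis. (D i w - M i w) * ?n i w) \<le> (1/2) * (u w * cut t r w) + (C/2) * (\<Sum>i\<in>Basis. (?n i w)\<^sup>2)"
      using coercive
    proof eventually_elim
      case (elim w)
      show ?case
      proof (cases "snd w \<in> {0<..<t}")
        case True
        \<comment> \<open>The weight 1/(2C) is the one for which \<open>coercive\<close> bounds the
          first term by half of \<open>r\<close> times \<open>u\<close>.\<close>
        have am: "- (a * b) \<le> a\<^sup>2 / (2 * C) + (C / 2) * b\<^sup>2" for a b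
        proof -
          have "0 \<le> (a + C * b)\<^sup>2 / (2 * C)" using C by simp
          also have "\<dots> = a\<^sup>2 / (2 * C) + a * b + (C / 2) * b\<^sup>2"
            using C by (simp add: power2_eq_square field_simps)
          finally show ?thesis by simp
        qed
        have "- (\<Sum>i\<in>Basis. (D i w - M i w) * ?n i w) = (\<Sum>i\<in>Basis. - ((D i w - M i w) * ?n i w))"
          by (simp add: sum_negf)
        also have "\<dots> \<le> (\<Sum>i\<in>Basis. (D i w - M i w)\<^sup>2 / (2 * C) + (C / 2) * (?n i w)\<^sup>2)"
          by (intro sum_mono am)
        also have "\<dots> = (\<Sum>i\<in>Basis. (D i w - M i w)\<^sup>2) / (2 * C) + (C / 2) * (\<Sum>i\<in>Basis. (?n i w)\<^sup>2)"
          by (simp add: sum.distrib sum_divide_distrib sum_distrib_left)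
        also have "\<dots> \<le> C * (r w * u w) / (2 * C) + (C / 2) * (\<Sum>i\<in>Basis. (?n i w)\<^sup>2)"
          using elim C by (intro add_mono divide_right_mono) auto
        also have "\<dots> = (1/2) * (u w * cut t r w) + (C/2) * (\<Sum>i\<in>Basis. (?n i w)\<^sup>2)"
          using C True by (simp add: cut_def)
        finally show ?thesis .
      qed (simp add: cut_def)
    qed
  qed (use IS Iu in auto)
  also have "\<dots> = (1/2) * (\<integral>w. u w * cut t r w \<partial>lborel) + (C/2) * (\<integral>w. (\<Sum>i\<in>Basis. (?n i w)\<^sup>2) \<partial>lborel)"
    using IS Iu by simp
  also have "(\<integral>w. (\<Sum>i\<in>Basis. (?n i w)\<^sup>2) \<partial>lborel) = (\<Sum>i\<in>Basis. \<integral>s. indicator {0<..<t} s * (\<integral>y. (N i (y, s))\<^sup>2 \<partial>lborel) \<partial>lborel)"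
    using I1 by (simp add: cut_N(3)[OF _ t(2)] cong: sum.cong_simp)
  also have "\<dots> = (\<integral>s. indicator {0<..<t} s * energy s \<partial>lborel)"
    unfolding energy_def sum_distrib_left
    by (rule Bochner_Integration.integral_sum[symmetric]) (rule cut_N(4)[OF _ t(2)])
  finally show ?thesis by simp
qed

lemma measurable_energy: "energy \<in> borel_measurable borel"
proof -
  have "(\<lambda>s. \<integral>y. (N i (y, s))\<^sup>2 \<partial>lborel) \<in> borel_measurable borel" if i: "i \<in> Basis" for i
  proof (rule lborel.borel_measurable_lebesgue_integral)
    note [measurable] = measurable_N[OF i]
    have "(\<lambda>p. (N i (snd p, fst p))\<^sup>2) \<in> borel_measurable (borel \<Otimes>\<^sub>M lborel)"
      using measurable_N[OF i] unfolding borel_prod[symmetric] by measurable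
    then show "(\<lambda>(s, y). (N i (y, s))\<^sup>2) \<in> borel_measurable (borel \<Otimes>\<^sub>M lborel)"
      by (simp add: case_prod_unfold)
  qed
  then show ?thesis unfolding energy_def[abs_def] by (intro borel_measurable_sum)
qed

lemma cut_product_nonneg: "0 \<le> (\<integral>w. u w * cut t r w \<partial>lborel)"
proof (rule integral_nonneg_AE)
  show "AE w in lborel. 0 \<le> u w * cut t r w"
    using coercive by eventually_elim (auto simp: cut_def indicator_def mult.commute)
qed

lemma energy_zero:
  assumes "0 < t" "t \<le> T" shows "energy t = 0"
proof (rule gronwall_zero[OF measurable_energy _ _ less_imp_le[OF C] _ assms])
  show "0 \<le> energy t" for t by (simp add: energy_def sum_nonneg)
  show "energy t \<le> (\<Sum>i\<in>Basis. (T + 1) * (\<integral>y. \<integral>\<tau>. (M i (y, \<tau>))\<^sup>2 \<partial>lborel \<partial>lborel))" for t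
    unfolding energy_def by (intro sum_mono integrable_N_slice(2))
  show "energy t \<le> C * (\<integral>s. indicator {0<..<t} s * energy s \<partial>lborel)" if "0 < t" "t \<le> T" for t
    using energy_inequality[OF that] cut_product_nonneg[of t] by linarith
qed

text \<open>Once the energy is zero, the energy inequality at time T leaves a nonnegative function
  with integral at most zero.\<close>

lemma product_zero: "AE w in lborel. snd w \<in> {0<..<T} \<longrightarrow> r w * u w = 0"
proof -
  have "(\<integral>s. indicator {0<..<T} s * energy s \<partial>lborel) = 0"
  proof -
    have "indicator {0<..<T} s * energy s = 0" for s using energy_zero[of s] by (auto simp: indicator_def)
    then show ?thesis by (simp only: integral_zero)
  qed
  then have 0: "(\<integral>w. u w * cut T r w \<partial>lborel) = 0"
    using energy_inequality[OF T order_refl] cut_product_nonneg[of T] energy_zero[OF T order_refl] by simp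
  have "integrable lborel (\<lambda>w. u w * cut T r w)"
    using L2 L2fun_cut[OF L2(2)] by (auto simp: L2fun_def intro!: integrable_mult_L2)
  moreover have "AE w in lborel. 0 \<le> u w * cut T r w"
    using coercive by eventually_elim (auto simp: cut_def indicator_def mult.commute)
  ultimately have "AE w in lborel. u w * cut T r w = 0"
    using 0 by (simp add: integral_nonneg_eq_0_iff_AE)
  then show ?thesis by eventually_elim (auto simp: cut_def)
qed

text \<open>Zero energy makes \<open>N\<close> vanish at each time for a.e. y, with a null set that
  depends on the time. Fubini exchanges the quantifiers, and on a.e. line the primitive lemma
  recovers \<open>M\<close> = 0.\<close>

lemma flux_zero:
  assumes i: "i \<in> Basis"
  shows "AE w in lborel. snd w \<in> {0<..<T} \<longrightarrow> M i w = 0"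
proof -
  note [measurable] = measurable_N[OF i] measurable_M[OF i]
  have slice0: "AE y in lborel. N i (y, t) = 0" if "t \<le> T" for t
  proof (cases "0 < t")
    case True
    have "(\<Sum>i\<in>Basis. \<integral>y. (N i (y, t))\<^sup>2 \<partial>lborel) = 0" using energy_zero[OF True that] by (simp add: energy_def)
    then have "(\<integral>y. (N i (y, t))\<^sup>2 \<partial>lborel) = 0"
      using i by (subst (asm) sum_nonneg_eq_0_iff) auto
    then show ?thesis
      using integrable_N_slice(1)[OF i, of t] by (subst (asm) integral_nonneg_eq_0_iff_AE) auto
  qed (use N_nonpos[OF i] in auto)
  have Nm: "(\<lambda>p. N i (snd p, min (fst p) T)) \<in> borel_measurable (lborel \<Otimes>\<^sub>M lborel)"
  proof -
    have "(\<lambda>p :: real \<times> 'd. (snd p, min (fst p) T)) \<in> borel_measurable borel"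
      by (intro borel_measurable_continuous_onI continuous_intros)
    from measurable_compose[OF this measurable_N[OF i]] show ?thesis by (simp add: lborel_prod)
  qed
  \<comment> \<open>The energy is controlled only up to T. With \<open>min s T\<close> the statement
    covers every s, and N at this time is the primitive of \<open>M\<close> truncated at T.\<close>
  have "AE s in lborel. AE y in lborel. N i (y, min s T) = 0"
    using slice0 by auto
  moreover have "{p \<in> space (lborel \<Otimes>\<^sub>M lborel). N i (snd p, min (fst p) T) = 0} \<in> sets (lborel \<Otimes>\<^sub>M lborel)"
    using Nm by measurable
  ultimately have "AE y in lborel. AE s in lborel. N i (y, min s T) = 0"
    using lborel_pair.AE_commute[of "\<lambda>s y. N i (y, min s T) = 0"] by simp
  then have "AE y in lborel. AE s in lborel. s \<in> {0<..<T} \<longrightarrow> M i (y, s) = 0"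
    using M_slice(1)[OF i]
  proof eventually_elim
    case (elim y)
    then have [measurable]: "(\<lambda>\<tau>. M i (y, \<tau>)) \<in> borel_measurable borel" by auto
    let ?f = "\<lambda>\<tau>. indicator {..<T} \<tau> * M i (y, \<tau>)"
    have "L2fun ?f"
      unfolding L2fun_def
    proof (intro conjI)
      show "integrable lborel ?f"
        by (rule integrable_dominated[OF elim(2)[THEN conjunct1]]) (auto simp: indicator_def)
      show "integrable lborel (\<lambda>x. (?f x)\<^sup>2)"
        by (rule integrable_dominated[OF elim(2)[THEN conjunct2]]) (auto simp: indicator_def)
    qed measurable
    then have "AE s in lborel. ?f s = 0"
    proof (rule primitive_eq_0_imp_AE_0)
      show "?f x = 0" if "x \<notin> cball 0 (T + 1)" for x
      proof -
        have "M i (y, x) = 0" by (rule supp(4)[OF i]) (use that in \<open>auto simp: dist_real_def\<close>)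
        then show ?thesis by simp
      qed
      have eq: "(\<lambda>\<tau>. indicator {..<s} \<tau> * ?f \<tau>) = (\<lambda>\<tau>. indicator {..<min s T} \<tau> * M i (y, \<tau>))" for s
        by (auto simp: indicator_def)
      show "AE s in lborel. (\<integral>\<tau>. indicator {..<s} \<tau> * ?f \<tau> \<partial>lborel) = 0"
        unfolding eq using elim(1) by (simp only: N_def fst_conv snd_conv)
    qed
    then show ?case by eventually_elim auto
  qed
  then have "AE w in lborel \<Otimes>\<^sub>M lborel. snd w \<in> {0<..<T} \<longrightarrow> M i w = 0"
  proof (intro lborel_pair.AE_pair_measure)
    have [measurable]: "M i \<in> borel_measurable (lborel \<Otimes>\<^sub>M lborel)"
      using measurable_M[OF i] by (simp add: lborel_prod)
    show "{w \<in> space (lborel \<Otimes>\<^sub>M lborel). snd w \<in> {0<..<T} \<longrightarrow> M i w = 0} \<in> sets (lborel \<Otimes>\<^sub>M lborel)"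
      by measurable
  qed simp
  then show ?thesis unfolding lborel_prod .
qed

end

section \<open>The convex conjugate\<close>

text \<open>Negative z contribute minus infinity; for large z the superlinear growth, uniform in x,
  beats bz; in between the lower bound of \<open>s\<close> is enough. An upper bound on p suffices
  since z is nonnegative in the relevant cases.\<close>

lemma legendre_upper_bound:
  assumes "hyp_s2 \<Omega> s"
  shows "\<exists>K. \<forall>x\<in>\<Omega>. \<forall>p z. p \<le> b \<longrightarrow> ereal (p * z) - s z x \<le> ereal K"
proof -
  have neg: "s z x = \<infinity>" if "x \<in> \<Omega>" "z < 0" for x z
    using assms that unfolding hyp_s2_def by blast
  obtain c where c: "\<And>x z. x \<in> \<Omega> \<Longrightarrow> ereal c \<le> s z x"
    using assms unfolding hyp_s2_def by blast
  have "((\<lambda>z. (INF x\<in>\<Omega>. s z x) / ereal z) \<longlongrightarrow> \<infinity>) at_top"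
    using assms unfolding hyp_s2_def by blast
  then have "\<forall>\<^sub>F z in at_top. ereal b < (INF x\<in>\<Omega>. s z x) / ereal z"
    unfolding tendsto_PInfty by blast
  then obtain Z0 where Z0: "\<And>z. Z0 \<le> z \<Longrightarrow> ereal b < (INF x\<in>\<Omega>. s z x) / ereal z"
    unfolding eventually_at_top_linorder by blast
  \<comment> \<open>The maximum with 1 makes z positive, as needed to multiply the growth inequality
    by z.\<close>
  define Z where "Z = max Z0 1"
  have big: "ereal (b * z) \<le> s z x" if "x \<in> \<Omega>" "Z \<le> z" for x z
  proof -
    have "ereal z * ereal b < (INF x\<in>\<Omega>. s z x)"
      using Z0[of z] that ereal_less_divide_pos[of "ereal z" "ereal b"] by (auto simp: Z_def)
    also have "\<dots> \<le> s z x" using that(1) by (rule INF_lower)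
    finally show ?thesis by (simp add: mult.commute)
  qed
  show ?thesis
  proof (intro exI[of _ "\<bar>b\<bar> * Z + \<bar>c\<bar>"] ballI allI impI)
    fix x p z assume *: "x \<in> \<Omega>" "p \<le> b"
    have Zp: "Z \<ge> 1" by (simp add: Z_def)
    then have K0: "\<bar>b\<bar> * Z + \<bar>c\<bar> \<ge> 0" by simp
    consider "z < 0" | "0 \<le> z" "z \<le> Z" | "Z \<le> z" by linarith
    then show "ereal (p * z) - s z x \<le> ereal (\<bar>b\<bar> * Z + \<bar>c\<bar>)"
    proof cases
      case 1
      then show ?thesis using neg[OF *(1)] by simp
    next
      case 2
      have "p * z \<le> b * z" using * 2 by (intro mult_right_mono)
      also have "\<dots> \<le> \<bar>b\<bar> * Z" using 2 by (intro mult_mono) auto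
      finally have "p * z - c \<le> \<bar>b\<bar> * Z + \<bar>c\<bar>" by linarith
      then show ?thesis using c[OF *(1), of z] by (cases "s z x") auto
    next
      case 3
      have "p * z \<le> b * z" using * 3 Zp by (intro mult_right_mono) auto
      then show ?thesis using big[OF *(1) 3] K0 by (cases "s z x") auto
    qed
  qed
qed

text \<open>\<open>real_of_ereal\<close> maps infinite values to 0, so finiteness of the supremum
  must be shown before \<open>sstar\<close> is the conjugate. The lower bound 0 comes from z = 0,
  where \<open>s\<close> is 0.\<close>

lemma ereal_sstar:
  assumes "hyp_s2 \<Omega> s" "x \<in> \<Omega>"
  shows "ereal (sstar s p x) = (SUP z. ereal (p * z) - s z x)" "0 \<le> sstar s p x"
proof -
  obtain K where "\<forall>y\<in>\<Omega>. \<forall>q z. q \<le> p \<longrightarrow> ereal (q * z) - s z y \<le> ereal K"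
    using legendre_upper_bound[OF assms(1)] by blast
  then have K: "ereal (p * z) - s z x \<le> ereal K" for z using assms(2) by simp
  have "s 0 x = 0" using assms unfolding hyp_s2_def by blast
  then have "(0 :: ereal) \<le> ereal (p * 0) - s 0 x" by simp
  also have "\<dots> \<le> (SUP z. ereal (p * z) - s z x)" by (rule SUP_upper) simp
  finally have 0: "0 \<le> (SUP z. ereal (p * z) - s z x)" .
  have "(SUP z. ereal (p * z) - s z x) \<le> ereal K" using K by (intro SUP_least)
  with 0 show "ereal (sstar s p x) = (SUP z. ereal (p * z) - s z x)" "0 \<le> sstar s p x"
    unfolding sstar_def by (cases "SUP z. ereal (p * z) - s z x"; auto)+
qed

lemma sstar_upper:
  assumes "hyp_s2 \<Omega> s" "x \<in> \<Omega>"
  shows "ereal (p * z) - s z x \<le> ereal (sstar s p x)"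
  unfolding ereal_sstar(1)[OF assms] by (rule SUP_upper) simp

lemma sstar_least:
  assumes "hyp_s2 \<Omega> s" "x \<in> \<Omega>" "\<And>z. ereal (p * z) - s z x \<le> ereal B"
  shows "sstar s p x \<le> B"
proof -
  have "ereal (sstar s p x) \<le> ereal B"
    unfolding ereal_sstar(1)[OF assms(1,2)] using assms(3) by (intro SUP_least)
  then show ?thesis by simp
qed

text \<open>Only nonnegative slopes z compete in the supremum, because \<open>s\<close> is infinite
  for negative z.\<close>

lemma sstar_mono:
  assumes s2: "hyp_s2 \<Omega> s" and x: "x \<in> \<Omega>" and "p \<le> q"
  shows "sstar s p x \<le> sstar s q x"
proof (rule sstar_least[OF s2 x])
  fix z
  show "ereal (p * z) - s z x \<le> ereal (sstar s q x)"
  proof (cases "z < 0")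
    case True
    then have "s z x = \<infinity>" using s2 x unfolding hyp_s2_def by blast
    then show ?thesis by simp
  next
    case False
    then have "p * z \<le> q * z" using \<open>p \<le> q\<close> by (intro mult_right_mono) auto
    then have "ereal (p * z) - s z x \<le> ereal (q * z) - s z x" by (intro ereal_minus_mono) auto
    also have "\<dots> \<le> ereal (sstar s q x)" by (rule sstar_upper[OF s2 x])
    finally show ?thesis .
  qed
qed

lemma convex_sstar:
  assumes s2: "hyp_s2 \<Omega> s" and x: "x \<in> \<Omega>"
  shows "convex_on UNIV (\<lambda>p. sstar s p x)"
proof (rule convex_onI)
  fix t p q :: real assume t: "0 < t" "t < 1"
  show "sstar s ((1 - t) *\<^sub>R p + t *\<^sub>R q) x \<le> (1 - t) * sstar s p x + t * sstar s q x"
  proof (rule sstar_least[OF s2 x])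
    fix z
    obtain c where "ereal c \<le> s z x" using s2 x unfolding hyp_s2_def by blast
    then have ninf: "s z x \<noteq> -\<infinity>" by auto
    show "ereal (((1 - t) *\<^sub>R p + t *\<^sub>R q) * z) - s z x \<le> ereal ((1 - t) * sstar s p x + t * sstar s q x)"
    proof (cases "s z x")
      case (real a)
      have "p * z - a \<le> sstar s p x" "q * z - a \<le> sstar s q x"
        using sstar_upper[OF s2 x, of p z] sstar_upper[OF s2 x, of q z] real by auto
      then have "(1 - t) * (p * z - a) + t * (q * z - a) \<le> (1 - t) * sstar s p x + t * sstar s q x"
        using t by (intro add_mono mult_left_mono) auto
      then show ?thesis using real by (simp add: algebra_simps)
    qed (use ninf in auto)
  qed
qed simp

lemma has_derivative_sstar:
  fixes s :: "real \<Rightarrow> 'd::euclidean_space \<Rightarrow> ereal"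
  assumes "hyp_s3 \<Omega> s" "x \<in> \<Omega>"
  shows "((\<lambda>q. sstar s q x) has_real_derivative psd s p x) (at p)"
proof -
  have "(\<lambda>(q, y). sstar s q y) differentiable (at (p, x))"
    using assms unfolding hyp_s3_def by blast
  then obtain F where F: "((\<lambda>(q, y). sstar s q y) has_derivative F) (at (p, x))"
    unfolding differentiable_def by blast
  have "((\<lambda>q. (q, x)) has_derivative (\<lambda>h. (h, 0))) (at p)"
    by (intro has_derivative_Pair has_derivative_ident has_derivative_const)
  from has_derivative_compose[OF this F]
  have "(\<lambda>q. sstar s q x) differentiable (at p)" unfolding differentiable_def by auto
  then show ?thesis unfolding psd_def by (simp add: DERIV_deriv_iff_real_differentiable)
qed

lemma sstar_tangent:
  fixes s :: "real \<Rightarrow> 'd::euclidean_space \<Rightarrow> ereal"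
  assumes "hyp_s2 \<Omega> s" "hyp_s3 \<Omega> s" "x \<in> \<Omega>"
  shows "sstar s q x - sstar s p x \<ge> psd s p x * (q - p)"
  using convex_on_imp_above_tangent[OF convex_sstar[OF assms(1,3)], of p q "psd s p x"]
    has_derivative_sstar[OF assms(2,3), of p] by simp

lemma psd_mono:
  fixes s :: "real \<Rightarrow> 'd::euclidean_space \<Rightarrow> ereal"
  assumes "hyp_s2 \<Omega> s" "hyp_s3 \<Omega> s" "x \<in> \<Omega>" "p \<le> q"
  shows "psd s p x \<le> psd s q x"
proof (cases "p = q")
  case False
  have "psd s p x * (q - p) \<le> psd s q x * (q - p)"
    using sstar_tangent[OF assms(1-3), where p = p and q = q] sstar_tangent[OF assms(1-3), where p = q and q = p]
    by (simp add: algebra_simps)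
  then show ?thesis using False assms(4) by simp
qed simp

lemma psd_sstar_product_nonneg:
  fixes s :: "real \<Rightarrow> 'd::euclidean_space \<Rightarrow> ereal"
  assumes "hyp_s2 \<Omega> s" "hyp_s3 \<Omega> s" "x \<in> \<Omega>"
  shows "0 \<le> (psd s p x - psd s q x) * (sstar s p x - sstar s q x)"
proof (cases "p \<le> q")
  case True
  then show ?thesis using psd_mono[OF assms True] sstar_mono[OF assms(1,3) True]
    by (intro mult_nonpos_nonpos) auto
next
  case False
  then have "q \<le> p" by simp
  then show ?thesis using psd_mono[OF assms \<open>q \<le> p\<close>] sstar_mono[OF assms(1,3) \<open>q \<le> p\<close>]
    by (intro mult_nonneg_nonneg) auto
qed

text \<open>Monotonicity forces \<open>sstar\<close> to be constant on [p,q]. The derivative at p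
  cannot be negative, seen from the right, and the one at q cannot be positive, seen from the left;
  as the derivative is nondecreasing, the two coincide.\<close>

lemma psd_eq_if_sstar_eq:
  fixes s :: "real \<Rightarrow> 'd::euclidean_space \<Rightarrow> ereal"
  assumes s2: "hyp_s2 \<Omega> s" and s3: "hyp_s3 \<Omega> s" and x: "x \<in> \<Omega>"
    and "p < q" and eq: "sstar s p x = sstar s q x"
  shows "psd s p x = psd s q x"
proof -
  have const: "sstar s h x = sstar s q x" if "p \<le> h" "h \<le> q" for h
    using sstar_mono[OF s2 x that(1)] sstar_mono[OF s2 x that(2)] eq by simp
  have "psd s p x \<ge> 0"
  proof (rule ccontr)
    assume "\<not> psd s p x \<ge> 0"
    then obtain d where d: "d > 0" "\<And>h. 0 < h \<Longrightarrow> h < d \<Longrightarrow> sstar s (p + h) x < sstar s p x"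
      using DERIV_neg_dec_right[OF has_derivative_sstar[OF s3 x, of p]] by auto
    then have "sstar s (p + d / 2) x < sstar s p x" by simp
    then show False using sstar_mono[OF s2 x, of p "p + d / 2"] d(1) by simp
  qed
  moreover have "psd s q x \<le> 0"
  proof (rule ccontr)
    assume "\<not> psd s q x \<le> 0"
    then obtain d where d: "d > 0" "\<And>h. 0 < h \<Longrightarrow> h < d \<Longrightarrow> sstar s (q - h) x < sstar s q x"
      using DERIV_pos_inc_left[OF has_derivative_sstar[OF s3 x, of q]] by auto
    define h where "h = min d (q - p) / 2"
    have "0 < h" "h < d" "p \<le> q - h" using d(1) \<open>p < q\<close> by (auto simp: h_def min_def field_simps)
    then show False using d(2)[of h] const[of "q - h"] by simp
  qed
  ultimately show ?thesis using psd_mono[OF s2 s3 x less_imp_le[OF \<open>p < q\<close>]] by simp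
qed

text \<open>If the factor with \<open>sstar\<close> is the vanishing one, p and q may still differ,
  but then they lie in a common flat piece, where the densities agree.\<close>

lemma psd_eq_of_product_zero:
  fixes s :: "real \<Rightarrow> 'd::euclidean_space \<Rightarrow> ereal"
  assumes s2: "hyp_s2 \<Omega> s" and s3: "hyp_s3 \<Omega> s" and x: "x \<in> \<Omega>"
    and "(psd s p x - psd s q x) * (sstar s p x - sstar s q x) = 0"
  shows "psd s p x = psd s q x"
proof (cases "sstar s p x = sstar s q x")
  case True
  show ?thesis
  proof (cases p q rule: linorder_cases)
    case less
    then show ?thesis using psd_eq_if_sstar_eq[OF s2 s3 x _ True] by blast
  next
    case greater
    then show ?thesis using psd_eq_if_sstar_eq[OF s2 s3 x _ True[symmetric]] by simp
  qed simp
qed (use assms in simp)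

section \<open>From weak solutions to Borel data\<close>

text \<open>The measure \<open>lebesgue\<close> on a product is not a product measure; Fubini is therefore only used
  for Borel representatives and \<open>lborel\<close>.\<close>

lemma borel_representative:
  fixes f :: "'a::euclidean_space \<Rightarrow> real"
  assumes "(\<lambda>z. indicator Z z * f z) \<in> borel_measurable lebesgue" and Z: "Z \<in> sets borel"
  shows "\<exists>g. g \<in> borel_measurable borel \<and> (\<forall>z. z \<notin> Z \<longrightarrow> g z = 0) \<and> (AE z in lborel. z \<in> Z \<longrightarrow> f z = g z)"
proof -
  obtain g where g: "g \<in> borel_measurable lborel" "AE z in lborel. indicator Z z * f z = g z"
    using completion_ex_borel_measurable_real[OF assms(1)] by blast
  show ?thesis
  proof (intro exI[of _ "\<lambda>z. indicator Z z * g z"] conjI allI impI)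
    show "(\<lambda>z. indicator Z z * g z) \<in> borel_measurable borel" using g(1) Z by measurable
    show "AE z in lborel. z \<in> Z \<longrightarrow> f z = indicator Z z * g z"
      using g(2) by eventually_elim auto
  qed auto
qed

text \<open>The weak gradient comes with integrability on compact subsets only; measurability on the
  whole open cylinder is recovered as a pointwise limit.\<close>

lemma measurable_of_compact_exhaustion:
  fixes f :: "'a::euclidean_space \<Rightarrow> real"
  assumes "open Z" and K: "\<And>K. compact K \<Longrightarrow> K \<subseteq> Z \<Longrightarrow> (\<lambda>z. indicator K z * f z) \<in> borel_measurable M"
  shows "(\<lambda>z. indicator Z z * f z) \<in> borel_measurable M"
proof -
  obtain C where C: "\<And>n. compact (C n)" "\<And>n. C n \<subseteq> Z" "\<And>n. C n \<subseteq> interior (C (Suc n))" "\<Union>(range C) = Z"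
    using open_Union_compact_subsets[OF assms(1)] by metis
  have inc: "incseq C"
    using C(3) interior_subset by (intro incseq_SucI) blast
  show ?thesis
  proof (rule borel_measurable_LIMSEQ_real)
    show "(\<lambda>n. indicator (C n) z * f z) \<longlonglongrightarrow> indicator Z z * f z" for z
    proof (cases "z \<in> Z")
      case True
      then obtain n where n: "z \<in> C n" using C(4) by auto
      have "\<forall>\<^sub>F k in sequentially. indicator (C k) z * f z = indicator Z z * f z"
        using eventually_ge_at_top[of n]
      proof eventually_elim
        case (elim k)
        then have "z \<in> C k" using inc n by (auto simp: incseq_def)
        then show ?case using True by simp
      qed
      then show ?thesis by (rule tendsto_eventually)
    next
      case False
      then have "z \<notin> C n" for n using C(2) by blast
      then show ?thesis using False by simp
    qed
    show "(\<lambda>z. indicator (C n) z * f z) \<in> borel_measurable M" for n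
      by (rule K[OF C(1,2)])
  qed
qed

lemma integral_lebesgue_transfer:
  fixes f g :: "'a::euclidean_space \<Rightarrow> real"
  assumes f: "f \<in> borel_measurable lebesgue" and g: "g \<in> borel_measurable borel"
    and eq: "AE z in lborel. f z = g z"
  shows "integrable lebesgue f \<longleftrightarrow> integrable lborel g" "integral\<^sup>L lebesgue f = integral\<^sup>L lborel g"
proof -
  have gl: "g \<in> borel_measurable lebesgue" using g by (intro measurable_completion) simp
  have AE: "AE z in lebesgue. f z = g z" using eq by (rule AE_completion)
  show "integrable lebesgue f \<longleftrightarrow> integrable lborel g"
    using integrable_cong_AE[OF f gl AE] integrable_completion[of g lborel] g by simp
  show "integral\<^sup>L lebesgue f = integral\<^sup>L lborel g"
    using integral_cong_AE[OF f gl AE] integral_completion[of g lborel] g by simp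
qed

text \<open>Reconciles the closed time intervals of the weak formulation with the open ones of the
  flux system.\<close>

lemma AE_snd_neq: "AE z :: 'a::euclidean_space \<times> real in lborel. snd z \<noteq> c"
proof -
  have "AE z :: 'a \<times> real in lborel \<Otimes>\<^sub>M lborel. snd z \<noteq> c"
  proof (rule lborel_pair.AE_pair_measure)
    show "{z \<in> space (lborel \<Otimes>\<^sub>M lborel). snd z \<noteq> c} \<in> sets (lborel \<Otimes>\<^sub>M lborel :: ('a \<times> real) measure)"
      by measurable
    show "AE x :: 'a in lborel. AE y in lborel. snd (x, y) \<noteq> c"
      using AE_lborel_singleton[of c] by simp
  qed
  then show ?thesis unfolding lborel_prod .
qed

text \<open>The slices are taken at fixed time, the second coordinate, so the product is swapped
  before the a.e. form of Fubini is applied.\<close>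

lemma AE_lborel_slices:
  fixes P :: "'a::euclidean_space \<times> real \<Rightarrow> bool"
  assumes "AE z in lborel. P z"
  shows "AE t in lborel. AE y in lborel. P (y, t)"
proof -
  have "AE z in lborel \<Otimes>\<^sub>M lborel. P z" unfolding lborel_prod by (rule assms)
  then have "AE z in distr (lborel \<Otimes>\<^sub>M lborel) (lborel \<Otimes>\<^sub>M lborel) (\<lambda>(x, y). (y, x)). P z"
    by (subst (asm) lborel_pair.distr_pair_swap)
  then have "AE z in (lborel \<Otimes>\<^sub>M lborel :: (real \<times> 'a) measure). P (case z of (x, y) \<Rightarrow> (y, x))"
    by (rule AE_distrD[rotated]) measurable
  from lborel_pair.AE_pair[OF this] show ?thesis by simp
qed

section \<open>Test functions in the two weak formulations\<close>

lemma set_integrable_mult_compact_support: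
  fixes f c :: "'a::euclidean_space \<Rightarrow> real"
  assumes f: "set_integrable lebesgue K f" and K: "compact K" and c: "continuous_on UNIV c" "\<And>z. z \<notin> K \<Longrightarrow> c z = 0"
  shows "integrable lebesgue (\<lambda>z. f z * c z)"
proof -
  obtain B where B: "\<And>z. \<bar>c z\<bar> \<le> B" using bounded_of_compact_support[OF c(1) K c(2)] by blast
  have eq: "(\<lambda>z. f z * c z) = (\<lambda>z. (indicator K z * f z) * c z)"
    by (rule ext) (use c(2) in \<open>auto simp: indicator_def\<close>)
  have f': "integrable lebesgue (\<lambda>z. indicator K z * f z)" using f by (simp add: set_integrable_def)
  have "c \<in> borel_measurable borel" using c(1) by (rule borel_measurable_continuous_onI)
  then have cm: "c \<in> borel_measurable lebesgue" by (intro measurable_completion) simp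
  show ?thesis unfolding eq by (rule integrable_mult_bounded[OF f' cm B])
qed

lemma gradx_inner: "i \<in> Basis \<Longrightarrow> gradx \<phi> z \<bullet> i = dderiv (i, 0) \<phi> z"
  by (simp add: gradx_def inner_sum_left inner_Basis if_distrib cong: if_cong)

text \<open>A compact set carrying the test function replaces the closure of its support, and
  unrestricted integrals replace those over U, since the test function and its derivatives vanish
  off K. Integrability is recorded because two such identities are subtracted later.\<close>

lemma weak_spatial_grad_test:
  fixes u :: "'d::euclidean_space \<times> real \<Rightarrow> real"
  assumes w: "weak_spatial_grad U u G" and i: "i \<in> Basis" and \<phi>: "Cinf_on UNIV \<phi>"
    and K: "compact K" "K \<subseteq> U" "\<And>z. z \<notin> K \<Longrightarrow> \<phi> z = 0"
  shows "integrable lebesgue (\<lambda>z. u z * dderiv (i, 0) \<phi> z)" "integrable lebesgue (\<lambda>z. (G z \<bullet> i) * \<phi> z)"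
    "(\<integral>z. u z * dderiv (i, 0) \<phi> z \<partial>lebesgue) = - (\<integral>z. (G z \<bullet> i) * \<phi> z \<partial>lebesgue)"
proof -
  have d0: "dderiv (i, 0) \<phi> z = 0" if "z \<notin> K" for z
    by (rule dderiv_eq_0_outside[of "- K"]) (use that K compact_imp_closed[OF K(1)] in auto)
  have sK: "set_integrable lebesgue K u" "set_integrable lebesgue K G"
    using w K unfolding weak_spatial_grad_def by blast+
  then have sG: "set_integrable lebesgue K (\<lambda>z. G z \<bullet> i)"
    unfolding set_integrable_def using integrable_inner_left[of i lebesgue "\<lambda>z. indicator K z *\<^sub>R G z"] by simp
  show "integrable lebesgue (\<lambda>z. u z * dderiv (i, 0) \<phi> z)"
    by (rule set_integrable_mult_compact_support[OF sK(1) K(1) Cinf_continuous_on[OF Cinf_dderiv[OF \<phi>]] d0])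
  show "integrable lebesgue (\<lambda>z. (G z \<bullet> i) * \<phi> z)"
    by (rule set_integrable_mult_compact_support[OF sG K(1) Cinf_continuous_on[OF \<phi>] K(3)])
  have cl: "closure {z. \<phi> z \<noteq> 0} \<subseteq> K"
    using K(3) by (intro closure_minimal compact_imp_closed K) auto
  then have "compact (closure {z. \<phi> z \<noteq> 0})"
    using K(1) by (meson bounded_subset closed_closure compact_eq_bounded_closed)
  then have "(LINT z:U|lebesgue. u z * (gradx \<phi> z \<bullet> i)) = - (LINT z:U|lebesgue. (G z \<bullet> i) * \<phi> z)"
    using w \<phi> cl K(2) i unfolding weak_spatial_grad_def by blast
  moreover have "(\<lambda>z. indicator U z *\<^sub>R (u z * (gradx \<phi> z \<bullet> i))) = (\<lambda>z. u z * dderiv (i, 0) \<phi> z)"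
    "(\<lambda>z. indicator U z *\<^sub>R ((G z \<bullet> i) * \<phi> z)) = (\<lambda>z. (G z \<bullet> i) * \<phi> z)"
    by (rule ext, use d0 K(2,3) in \<open>force simp: indicator_def gradx_inner[OF i]\<close>)+
  ultimately show "(\<integral>z. u z * dderiv (i, 0) \<phi> z \<partial>lebesgue) = - (\<integral>z. (G z \<bullet> i) * \<phi> z \<partial>lebesgue)"
    by (simp only: set_lebesgue_integral_def)
qed

text \<open>A test function of x alone has zero time derivative, so each identity reduces to the
  flux and the terms at times t and 0; the initial terms cancel. The integrability clauses of
  \<open>weak_identity\<close> justify subtracting the integrals.\<close>

lemma weak_identity_difference:
  fixes \<psi> :: "'d::euclidean_space \<Rightarrow> real"
  assumes w1: "\<forall>\<phi>. Cinf_on UNIV \<phi> \<longrightarrow> weak_identity \<Omega> \<rho>0 \<rho>1 m1 t \<phi>"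
    and w2: "\<forall>\<phi>. Cinf_on UNIV \<phi> \<longrightarrow> weak_identity \<Omega> \<rho>0 \<rho>2 m2 t \<phi>" and \<psi>: "Cinf_on UNIV \<psi>"
  shows "(\<integral>z. indicator (\<Omega> \<times> {0..t}) z * (\<Sum>i\<in>Basis. ((m1 z - m2 z) \<bullet> i) * dderiv i \<psi> (fst z)) \<partial>lebesgue)
      = - (\<integral>x. indicator \<Omega> x * ((\<rho>1 (x, t) - \<rho>2 (x, t)) * \<psi> x) \<partial>lebesgue)"
    and "integrable lebesgue (\<lambda>z. indicator (\<Omega> \<times> {0..t}) z * (\<Sum>i\<in>Basis. ((m1 z - m2 z) \<bullet> i) * dderiv i \<psi> (fst z)))"
    and "integrable lebesgue (\<lambda>x. indicator \<Omega> x * ((\<rho>1 (x, t) - \<rho>2 (x, t)) * \<psi> x))"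
proof -
  let ?\<phi> = "\<lambda>z :: 'd \<times> real. \<psi> (fst z + 0)"
  have C: "Cinf_on UNIV ?\<phi>" by (rule Cinf_affine[OF \<psi> bounded_linear_fst])
  have D: "frechet_derivative ?\<phi> (at z) v = dderiv (fst v) \<psi> (fst z)" for z v
    using dderiv_translate[OF \<psi> bounded_linear_fst, where v = v and b = 0 and x = z] by simp
  have "dderiv 0 \<psi> x = 0" for x
    using linear_0[OF has_derivative_linear[OF Cinf_has_derivative[OF \<psi>]]] .
  then have dt: "dt ?\<phi> z = 0" for z unfolding dt_def D by simp
  have gx: "m \<bullet> gradx ?\<phi> z = (\<Sum>i\<in>Basis. (m \<bullet> i) * dderiv i \<psi> (fst z))" for m z
    unfolding gradx_def D by (simp add: inner_sum_right mult.commute)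
  let ?S = "\<lambda>m z. \<Sum>i\<in>Basis. (m z \<bullet> i) * dderiv i \<psi> (fst z)"
  let ?I = "\<lambda>z. indicator (\<Omega> \<times> {0..t}) z :: real"
  have W: "integrable lebesgue (\<lambda>z. ?I z * ?S m z)"
    "integrable lebesgue (\<lambda>x. indicator \<Omega> x * (\<rho> (x, t) * \<psi> x))"
    "integrable lebesgue (\<lambda>x. indicator \<Omega> x * (\<rho>0 x * \<psi> x))"
    "(\<integral>z. ?I z * ?S m z \<partial>lebesgue) = (\<integral>x. indicator \<Omega> x * (\<rho>0 x * \<psi> x) \<partial>lebesgue)
       - (\<integral>x. indicator \<Omega> x * (\<rho> (x, t) * \<psi> x) \<partial>lebesgue)"
    if "\<forall>\<phi>. Cinf_on UNIV \<phi> \<longrightarrow> weak_identity \<Omega> \<rho>0 \<rho> m t \<phi>" for \<rho> m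
  proof -
    have "weak_identity \<Omega> \<rho>0 \<rho> m t ?\<phi>" using that C by blast
    then have w: "integrable lebesgue (\<lambda>z. - (?I z * ?S m z))"
      "integrable lebesgue (\<lambda>x. indicator \<Omega> x * (\<rho> (x, t) * \<psi> x))"
      "integrable lebesgue (\<lambda>x. indicator \<Omega> x * (\<rho>0 x * \<psi> x))"
      "(\<integral>z. - (?I z * ?S m z) \<partial>lebesgue) = (\<integral>x. indicator \<Omega> x * (\<rho> (x, t) * \<psi> x) \<partial>lebesgue)
        - (\<integral>x. indicator \<Omega> x * (\<rho>0 x * \<psi> x) \<partial>lebesgue)"
      unfolding weak_identity_def dt gx set_integrable_def set_lebesgue_integral_def by simp_all
    show "integrable lebesgue (\<lambda>z. ?I z * ?S m z)" using integrable_minus[OF w(1)] by simp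
    show "integrable lebesgue (\<lambda>x. indicator \<Omega> x * (\<rho> (x, t) * \<psi> x))" by (rule w(2))
    show "integrable lebesgue (\<lambda>x. indicator \<Omega> x * (\<rho>0 x * \<psi> x))" by (rule w(3))
    show "(\<integral>z. ?I z * ?S m z \<partial>lebesgue) = (\<integral>x. indicator \<Omega> x * (\<rho>0 x * \<psi> x) \<partial>lebesgue)
       - (\<integral>x. indicator \<Omega> x * (\<rho> (x, t) * \<psi> x) \<partial>lebesgue)"
      using w(4) by simp
  qed
  note W1 = W[OF w1] and W2 = W[OF w2]
  have eqS: "(\<lambda>z. ?I z * (\<Sum>i\<in>Basis. ((m1 z - m2 z) \<bullet> i) * dderiv i \<psi> (fst z))) = (\<lambda>z. ?I z * ?S m1 z - ?I z * ?S m2 z)"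
    by (simp add: inner_diff_left left_diff_distrib sum_subtractf right_diff_distrib)
  have eqr: "(\<lambda>x. indicator \<Omega> x * ((\<rho>1 (x, t) - \<rho>2 (x, t)) * \<psi> x))
      = (\<lambda>x. indicator \<Omega> x * (\<rho>1 (x, t) * \<psi> x) - indicator \<Omega> x * (\<rho>2 (x, t) * \<psi> x) :: real)"
    by (simp add: left_diff_distrib right_diff_distrib)
  show "integrable lebesgue (\<lambda>z. ?I z * (\<Sum>i\<in>Basis. ((m1 z - m2 z) \<bullet> i) * dderiv i \<psi> (fst z)))"
    unfolding eqS by (intro Bochner_Integration.integrable_diff W1(1) W2(1))
  show "integrable lebesgue (\<lambda>x. indicator \<Omega> x * ((\<rho>1 (x, t) - \<rho>2 (x, t)) * \<psi> x))"
    unfolding eqr by (intro Bochner_Integration.integrable_diff W1(2) W2(2))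
  show "(\<integral>z. ?I z * (\<Sum>i\<in>Basis. ((m1 z - m2 z) \<bullet> i) * dderiv i \<psi> (fst z)) \<partial>lebesgue)
      = - (\<integral>x. indicator \<Omega> x * ((\<rho>1 (x, t) - \<rho>2 (x, t)) * \<psi> x) \<partial>lebesgue)"
    unfolding eqS eqr Bochner_Integration.integral_diff[OF W1(1) W2(1)]
      Bochner_Integration.integral_diff[OF W1(2) W2(2)] W1(4) W2(4) by simp
qed

lemma L2fun_bounded:
  fixes g :: "'a::euclidean_space \<Rightarrow> real"
  assumes [measurable]: "g \<in> borel_measurable borel" and S: "\<And>z. z \<notin> cball 0 R \<Longrightarrow> g z = 0"
    and B: "AE z in lborel. \<bar>g z\<bar> \<le> B"
  shows "L2fun g"
proof (rule L2_bounded_support[OF assms(1) _ S])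
  have "integrable lborel (\<lambda>z :: 'a. B\<^sup>2 * indicator (cball 0 R) z)"
    by (intro integrable_mult_right integrable_real_indicator emeasure_bounded_finite) auto
  then show "integrable lborel (\<lambda>z. (g z)\<^sup>2)"
  proof (rule integrable_dominated)
    show "AE z in lborel. norm ((g z)\<^sup>2) \<le> norm (B\<^sup>2 * indicator (cball 0 R) z)"
      using B
    proof eventually_elim
      case (elim z)
      have "\<bar>g z\<bar> \<le> \<bar>B\<bar>" using elim by linarith
      then show ?case using S[of z] by (cases "z \<in> cball 0 R") (auto simp: abs_le_square_iff)
    qed
  qed measurable
qed

text \<open>Measurability of \<open>sstar\<close> along p and of the full gradient comes from the
  weak gradient clause on compacts. The bound on \<open>sstar\<close> combines its nonnegativity
  with the uniform upper bound for p below the bound of its positive part.\<close>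

lemma weak_solution_regularity:
  fixes \<Omega> :: "'d::euclidean_space set"
  assumes w: "weak_solution s \<Omega> \<rho>0 \<rho> p m" and s2: "hyp_s2 \<Omega> s" and \<Omega>: "open \<Omega>" and S: "S > 0"
  defines "Z \<equiv> \<Omega> \<times> {0<..<S}"
  shows "(\<lambda>z. indicator Z z * sstar s (p z) (fst z)) \<in> borel_measurable lebesgue"
    and "(\<lambda>z. indicator Z z * \<rho> z) \<in> borel_measurable lebesgue"
    and "(\<lambda>z. indicator Z z * (m z \<bullet> i)) \<in> borel_measurable lebesgue"
    and "(\<lambda>z. indicator Z z * ((m z + gxs s (p z) (fst z)) \<bullet> i)) \<in> borel_measurable lebesgue"
    and "\<exists>B. AE z in lborel. z \<in> Z \<longrightarrow> \<bar>\<rho> z\<bar> \<le> B"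
    and "\<exists>B. AE z in lborel. z \<in> Z \<longrightarrow> \<bar>sstar s (p z) (fst z)\<bar> \<le> B"
    and "AE z in lborel. z \<in> Z \<longrightarrow> \<rho> z = psd s (p z) (fst z)"
    and "integrable lebesgue (\<lambda>z. indicator Z z * (norm (m z))\<^sup>2)"
    and "AE t in lborel. t \<in> {0..S} \<longrightarrow> (\<forall>\<phi>. Cinf_on UNIV \<phi> \<longrightarrow> weak_identity \<Omega> \<rho>0 \<rho> m t \<phi>)"
proof -
  let ?A = "\<Omega> \<times> {0..S}"
  note g = w[unfolded weak_solution_def, THEN conjunct1]
  note h = w[unfolded weak_solution_def, THEN conjunct2, rule_format, OF S]
  have op: "open Z" unfolding Z_def by (intro open_Times \<Omega>) simp
  then have Zm: "(indicator Z :: _ \<Rightarrow> real) \<in> borel_measurable lebesgue"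
    by (intro borel_measurable_indicator sets_completionI_sets) simp
  have ZA: "z \<in> ?A" if "z \<in> Z" for z using that by (auto simp: Z_def)
  have res: "(\<lambda>z. indicator Z z * f z) \<in> borel_measurable lebesgue"
    if "set_borel_measurable lebesgue ?A f" for f :: "'d \<times> real \<Rightarrow> real"
  proof -
    have "(\<lambda>z. indicator Z z * (indicator ?A z *\<^sub>R f z)) \<in> borel_measurable lebesgue"
      using that Zm unfolding set_borel_measurable_def by (intro borel_measurable_times)
    also have "(\<lambda>z. indicator Z z * (indicator ?A z *\<^sub>R f z)) = (\<lambda>z. indicator Z z * f z)"
      by (rule ext) (use ZA in \<open>auto simp: indicator_def\<close>)
    finally show ?thesis .
  qed
  show "(\<lambda>z. indicator Z z * \<rho> z) \<in> borel_measurable lebesgue" using h by (intro res) blast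
  have mi: "set_borel_measurable lebesgue ?A (\<lambda>z. m z \<bullet> i)"
  proof -
    have "(\<lambda>z. indicator ?A z *\<^sub>R m z) \<in> borel_measurable lebesgue" using h unfolding set_borel_measurable_def by blast
    then have "(\<lambda>z. (indicator ?A z *\<^sub>R m z) \<bullet> i) \<in> borel_measurable lebesgue" by (intro borel_measurable_inner) auto
    then show ?thesis by (simp add: set_borel_measurable_def)
  qed
  show "(\<lambda>z. indicator Z z * (m z \<bullet> i)) \<in> borel_measurable lebesgue" by (rule res[OF mi])
  have KU: "K \<subseteq> \<Omega> \<times> {0<..}" if "K \<subseteq> Z" for K using that by (auto simp: Z_def)
  show "(\<lambda>z. indicator Z z * sstar s (p z) (fst z)) \<in> borel_measurable lebesgue"
  proof (rule measurable_of_compact_exhaustion[OF op])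
    fix K assume K: "compact K" "K \<subseteq> Z"
    then have "set_integrable lebesgue K (\<lambda>z. sstar s (p z) (fst z))"
      using g KU unfolding weak_spatial_grad_def by blast
    then show "(\<lambda>z. indicator K z * sstar s (p z) (fst z)) \<in> borel_measurable lebesgue"
      unfolding set_integrable_def by auto
  qed
  show "(\<lambda>z. indicator Z z * ((m z + gxs s (p z) (fst z)) \<bullet> i)) \<in> borel_measurable lebesgue"
  proof (rule measurable_of_compact_exhaustion[OF op])
    fix K assume K: "compact K" "K \<subseteq> Z"
    then have "set_integrable lebesgue K (\<lambda>z. m z + gxs s (p z) (fst z))"
      using g KU unfolding weak_spatial_grad_def by blast
    then have "(\<lambda>z. (indicator K z *\<^sub>R (m z + gxs s (p z) (fst z))) \<bullet> i) \<in> borel_measurable lebesgue"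
      unfolding set_integrable_def by (intro borel_measurable_inner) auto
    then show "(\<lambda>z. indicator K z * ((m z + gxs s (p z) (fst z)) \<bullet> i)) \<in> borel_measurable lebesgue" by simp
  qed
  show "\<exists>B. AE z in lborel. z \<in> Z \<longrightarrow> \<bar>\<rho> z\<bar> \<le> B"
  proof -
    obtain B where "AE z in lebesgue. z \<in> ?A \<longrightarrow> \<bar>\<rho> z\<bar> \<le> B" using h by blast
    then have "AE z in lborel. z \<in> ?A \<longrightarrow> \<bar>\<rho> z\<bar> \<le> B" by (simp only: AE_completion_iff)
    then have "AE z in lborel. z \<in> Z \<longrightarrow> \<bar>\<rho> z\<bar> \<le> B" by eventually_elim (use ZA in blast)
    then show ?thesis by blast
  qed
  show "\<exists>B. AE z in lborel. z \<in> Z \<longrightarrow> \<bar>sstar s (p z) (fst z)\<bar> \<le> B"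
  proof -
    obtain b where "AE z in lebesgue. z \<in> ?A \<longrightarrow> \<bar>max (p z) 0\<bar> \<le> b" using h by blast
    then have b: "AE z in lborel. z \<in> ?A \<longrightarrow> \<bar>max (p z) 0\<bar> \<le> b" by (simp only: AE_completion_iff)
    obtain K where K: "\<forall>x\<in>\<Omega>. \<forall>p z. p \<le> b \<longrightarrow> ereal (p * z) - s z x \<le> ereal K"
      using legendre_upper_bound[OF s2] by blast
    have "AE z in lborel. z \<in> Z \<longrightarrow> \<bar>sstar s (p z) (fst z)\<bar> \<le> K"
      using b
    proof eventually_elim
      case (elim z)
      show ?case
      proof
        assume z: "z \<in> Z"
        then have x: "fst z \<in> \<Omega>" by (auto simp: Z_def)
        have "p z \<le> b" using elim ZA[OF z] by auto
        then have "sstar s (p z) (fst z) \<le> K" using K x by (intro sstar_least[OF s2 x]) blast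
        then show "\<bar>sstar s (p z) (fst z)\<bar> \<le> K" using ereal_sstar(2)[OF s2 x, of "p z"] by simp
      qed
    qed
    then show ?thesis by blast
  qed
  show "AE z in lborel. z \<in> Z \<longrightarrow> \<rho> z = psd s (p z) (fst z)"
  proof -
    have "AE z in lebesgue. z \<in> ?A \<longrightarrow> p z \<in> subdiff s (\<rho> z) (fst z) \<and> \<rho> z = psd s (p z) (fst z)" using h by blast
    then have "AE z in lborel. z \<in> ?A \<longrightarrow> p z \<in> subdiff s (\<rho> z) (fst z) \<and> \<rho> z = psd s (p z) (fst z)"
      by (simp only: AE_completion_iff)
    then show ?thesis by eventually_elim (use ZA in blast)
  qed
  show "integrable lebesgue (\<lambda>z. indicator Z z * (norm (m z))\<^sup>2)"
  proof -
    have i: "integrable lebesgue (\<lambda>z. indicator ?A z *\<^sub>R (norm (m z))\<^sup>2)"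
      using h unfolding set_integrable_def by blast
    show ?thesis
    proof (rule integrable_dominated[OF i])
      show "(\<lambda>z. indicator Z z * (norm (m z))\<^sup>2) \<in> borel_measurable lebesgue"
        using i by (intro res) (auto simp: set_borel_measurable_def)
      show "AE z in lebesgue. norm (indicator Z z * (norm (m z))\<^sup>2) \<le> norm (indicator ?A z *\<^sub>R (norm (m z))\<^sup>2)"
        using ZA by (intro AE_I2) (auto simp: indicator_def)
    qed
  qed
  show "AE t in lborel. t \<in> {0..S} \<longrightarrow> (\<forall>\<phi>. Cinf_on UNIV \<phi> \<longrightarrow> weak_identity \<Omega> \<rho>0 \<rho> m t \<phi>)"
    using h by blast
qed

section \<open>Two weak solutions give rise to a flux system\<close>

theorem theorem7p3:
  fixes \<Omega> :: "'d::euclidean_space set"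
    and s :: "real \<Rightarrow> 'd \<Rightarrow> ereal"
    and \<rho>0 :: "'d \<Rightarrow> real"
    and \<rho>1 p1 \<rho>2 p2 :: "'d \<times> real \<Rightarrow> real"
    and m1 m2 :: "'d \<times> real \<Rightarrow> 'd"
    and T :: real
  assumes "smooth_bounded_domain \<Omega>"
    and "hyp_s1 \<Omega> s" and "hyp_s2 \<Omega> s" and "hyp_s3 \<Omega> s" and "hyp_s4 \<Omega> s" and "hyp_s5 \<Omega> s"
    and "\<exists>C>0. \<forall>x\<in>\<Omega>. \<forall>q1 q2.
           (norm (gxs s q1 x - gxs s q2 x))\<^sup>2
             \<le> C * \<bar>psd s q1 x - psd s q2 x\<bar> * \<bar>sstar s q1 x - sstar s q2 x\<bar>"
    and "weak_solution s \<Omega> \<rho>0 \<rho>1 p1 m1"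
    and "weak_solution s \<Omega> \<rho>0 \<rho>2 p2 m2"
    and "T > 0"
  shows "AE z in lebesgue. z \<in> \<Omega> \<times> {0..T} \<longrightarrow> \<rho>1 z = \<rho>2 z \<and> m1 z = m2 z"
proof -
  note s2 = assms(3) and s3 = assms(4) and T = assms(10)
  obtain C where C: "C > 0" "\<And>x q1 q2. x \<in> \<Omega> \<Longrightarrow> (norm (gxs s q1 x - gxs s q2 x))\<^sup>2
       \<le> C * \<bar>psd s q1 x - psd s q2 x\<bar> * \<bar>sstar s q1 x - sstar s q2 x\<bar>" using assms(7) by blast
  have \<Omega>: "open \<Omega>" "bounded \<Omega>" using assms(1) by (auto simp: smooth_bounded_domain_def)
  \<comment> \<open>One unit of time beyond T is available because the weak formulation holds for
    every final time. The open interval makes Z open, hence exhaustible by compact sets.\<close>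
  define Z where "Z = \<Omega> \<times> {0<..<T + 1}"
  have Zo: "open Z" unfolding Z_def by (intro open_Times \<Omega>) simp
  then have Zb: "Z \<in> sets borel" by simp
  have "bounded Z" unfolding Z_def by (intro bounded_Times \<Omega>) simp
  then obtain R where "Z \<subseteq> ball 0 R" using bounded_subset_ballD by blast
  then have R: "Z \<subseteq> cball 0 R" using ball_subset_cball by blast
  have T1: "T + 1 > 0" using T by simp
  note W1 = weak_solution_regularity[OF assms(8) s2 \<Omega>(1) T1, folded Z_def]
  note W2 = weak_solution_regularity[OF assms(9) s2 \<Omega>(1) T1, folded Z_def]
  let ?S1 = "\<lambda>z. sstar s (p1 z) (fst z)" and ?S2 = "\<lambda>z. sstar s (p2 z) (fst z)"
  let ?G1 = "\<lambda>z. m1 z + gxs s (p1 z) (fst z)" and ?G2 = "\<lambda>z. m2 z + gxs s (p2 z) (fst z)"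
  have dm: "(\<lambda>z. indicator Z z * (f z - g z)) \<in> borel_measurable lebesgue"
    if "(\<lambda>z. indicator Z z * f z) \<in> borel_measurable lebesgue" "(\<lambda>z. indicator Z z * g z) \<in> borel_measurable lebesgue"
    for f g :: "'d \<times> real \<Rightarrow> real"
    using borel_measurable_diff[OF that] by (simp add: right_diff_distrib)
  from borel_representative[OF dm[OF W1(1) W2(1)] Zb]
  obtain u where "u \<in> borel_measurable borel \<and> (\<forall>z. z \<notin> Z \<longrightarrow> u z = 0) \<and> (AE z in lborel. z \<in> Z \<longrightarrow> ?S1 z - ?S2 z = u z)" ..
  then have u: "u \<in> borel_measurable borel" "\<And>z. z \<notin> Z \<Longrightarrow> u z = 0"
    "AE z in lborel. z \<in> Z \<longrightarrow> ?S1 z - ?S2 z = u z" by blast+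
  from borel_representative[OF dm[OF W1(2) W2(2)] Zb]
  obtain r where "r \<in> borel_measurable borel \<and> (\<forall>z. z \<notin> Z \<longrightarrow> r z = 0) \<and> (AE z in lborel. z \<in> Z \<longrightarrow> \<rho>1 z - \<rho>2 z = r z)" ..
  then have r: "r \<in> borel_measurable borel" "\<And>z. z \<notin> Z \<Longrightarrow> r z = 0"
    "AE z in lborel. z \<in> Z \<longrightarrow> \<rho>1 z - \<rho>2 z = r z" by blast+
  have "\<forall>i. \<exists>g. g \<in> borel_measurable borel \<and> (\<forall>z. z \<notin> Z \<longrightarrow> g z = 0) \<and> (AE z in lborel. z \<in> Z \<longrightarrow> m1 z \<bullet> i - m2 z \<bullet> i = g z)"
    by (intro allI borel_representative[OF dm[OF W1(3) W2(3)] Zb])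
  from choice[OF this] obtain M where "\<forall>i. M i \<in> borel_measurable borel \<and> (\<forall>z. z \<notin> Z \<longrightarrow> M i z = 0) \<and> (AE z in lborel. z \<in> Z \<longrightarrow> m1 z \<bullet> i - m2 z \<bullet> i = M i z)" ..
  then have M: "\<And>i. M i \<in> borel_measurable borel" "\<And>i z. z \<notin> Z \<Longrightarrow> M i z = 0"
    "\<And>i. AE z in lborel. z \<in> Z \<longrightarrow> m1 z \<bullet> i - m2 z \<bullet> i = M i z" by blast+
  have "\<forall>i. \<exists>g. g \<in> borel_measurable borel \<and> (\<forall>z. z \<notin> Z \<longrightarrow> g z = 0) \<and> (AE z in lborel. z \<in> Z \<longrightarrow> ?G1 z \<bullet> i - ?G2 z \<bullet> i = g z)"
    by (intro allI borel_representative[OF dm[OF W1(4) W2(4)] Zb])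
  from choice[OF this] obtain D where "\<forall>i. D i \<in> borel_measurable borel \<and> (\<forall>z. z \<notin> Z \<longrightarrow> D i z = 0) \<and> (AE z in lborel. z \<in> Z \<longrightarrow> ?G1 z \<bullet> i - ?G2 z \<bullet> i = D i z)" ..
  then have D: "\<And>i. D i \<in> borel_measurable borel" "\<And>i z. z \<notin> Z \<Longrightarrow> D i z = 0"
    "\<And>i. AE z in lborel. z \<in> Z \<longrightarrow> ?G1 z \<bullet> i - ?G2 z \<bullet> i = D i z" by blast+
  note [measurable] = u(1) r(1) M(1) D(1)
  have out: "z \<notin> Z" if "z \<notin> cball 0 R" for z using that R by blast
  have L2: "L2fun g"
    if g: "g \<in> borel_measurable borel" "\<And>z. z \<notin> Z \<Longrightarrow> g z = 0"
      "AE z in lborel. z \<in> Z \<longrightarrow> f1 z - f2 z = g z"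
      and f: "\<exists>B. AE z in lborel. z \<in> Z \<longrightarrow> \<bar>f1 z\<bar> \<le> B" "\<exists>B. AE z in lborel. z \<in> Z \<longrightarrow> \<bar>f2 z\<bar> \<le> B"
    for f1 f2 g :: "'d \<times> real \<Rightarrow> real"
  proof -
    obtain B1 B2 where B: "AE z in lborel. z \<in> Z \<longrightarrow> \<bar>f1 z\<bar> \<le> B1" "AE z in lborel. z \<in> Z \<longrightarrow> \<bar>f2 z\<bar> \<le> B2"
      using f by blast
    have "AE z in lborel. \<bar>g z\<bar> \<le> max 0 (B1 + B2)"
      using g(3) B
    proof eventually_elim
      case (elim z)
      then show ?case using g(2)[of z] by (cases "z \<in> Z") auto
    qed
    then show ?thesis using g out by (intro L2fun_bounded[of g R]) auto
  qed
  have L2u: "L2fun u" by (rule L2[OF u(1) _ u(3) W1(6) W2(6)]) (rule u(2))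
  have L2r: "L2fun r" by (rule L2[OF r(1) _ r(3) W1(5) W2(5)]) (rule r(2))
  have L2M: "L2fun (M i)" if i: "i \<in> Basis" for i
  proof (rule L2_bounded_support[OF M(1)])
    have "integrable lebesgue (\<lambda>z. 2 * (indicator Z z * (norm (m1 z))\<^sup>2) + 2 * (indicator Z z * (norm (m2 z))\<^sup>2))"
      using W1(8) W2(8) by simp
    then have "integrable lebesgue (\<lambda>z. (M i z)\<^sup>2)"
    proof (rule integrable_dominated)
      show "(\<lambda>z. (M i z)\<^sup>2) \<in> borel_measurable lebesgue" by (intro measurable_completion) simp
      show "AE z in lebesgue. norm ((M i z)\<^sup>2) \<le> norm (2 * (indicator Z z * (norm (m1 z))\<^sup>2) + 2 * (indicator Z z * (norm (m2 z))\<^sup>2))"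
        using AE_completion[OF M(3)[of i]]
      proof eventually_elim
        case (elim z)
        show ?case
        proof (cases "z \<in> Z")
          case True
          have "(M i z)\<^sup>2 = (m1 z \<bullet> i - m2 z \<bullet> i)\<^sup>2" using elim True by simp
          also have "\<dots> \<le> 2 * (m1 z \<bullet> i)\<^sup>2 + 2 * (m2 z \<bullet> i)\<^sup>2"
            using zero_le_power2[of "m1 z \<bullet> i + m2 z \<bullet> i"] by (simp add: power2_eq_square algebra_simps)
          also have "\<dots> \<le> 2 * (norm (m1 z))\<^sup>2 + 2 * (norm (m2 z))\<^sup>2"
            using Basis_le_norm[OF i, of "m1 z"] Basis_le_norm[OF i, of "m2 z"]
            by (intro add_mono mult_left_mono) (auto simp: abs_le_square_iff[symmetric])
          finally show ?thesis using True by simp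
        qed (use M(2) in simp)
      qed
    qed
    then show "integrable lborel (\<lambda>z. (M i z)\<^sup>2)" by (subst (asm) integrable_completion) simp_all
    show "M i z = 0" if "z \<notin> cball 0 R" for z using M(2) out[OF that] by blast
  qed
  have coercive: "AE z in lborel. 0 \<le> r z * u z \<and> (\<Sum>i\<in>Basis. (D i z - M i z)\<^sup>2) \<le> C * (r z * u z)"
  proof -
    have "AE z in lborel. \<forall>i\<in>Basis. z \<in> Z \<longrightarrow> m1 z \<bullet> i - m2 z \<bullet> i = M i z"
      by (subst AE_finite_all) (auto intro: M(3))
    moreover have "AE z in lborel. \<forall>i\<in>Basis. z \<in> Z \<longrightarrow> ?G1 z \<bullet> i - ?G2 z \<bullet> i = D i z"
      by (subst AE_finite_all) (auto intro: D(3))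
    ultimately show ?thesis
      using u(3) r(3) W1(7) W2(7)
    proof eventually_elim
      case (elim z)
      show ?case
      proof (cases "z \<in> Z")
        case True
        then have x: "fst z \<in> \<Omega>" by (auto simp: Z_def)
        let ?g = "gxs s (p1 z) (fst z) - gxs s (p2 z) (fst z)"
        \<comment> \<open>Both densities are given by \<open>psd\<close> along their p, so
          \<open>r\<close> times \<open>u\<close> is the product that monotonicity makes
          nonnegative, and the right-hand side of the extra hypothesis is C times its absolute
          value.\<close>
        have ru: "r z * u z = (psd s (p1 z) (fst z) - psd s (p2 z) (fst z)) * (?S1 z - ?S2 z)"
          using elim True by simp
        then have nn: "0 \<le> r z * u z" using psd_sstar_product_nonneg[OF s2 s3 x] by simp
        have "(\<Sum>i\<in>Basis. (D i z - M i z)\<^sup>2) = (\<Sum>i\<in>Basis. (?g \<bullet> i)\<^sup>2)"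
        proof (rule sum.cong[OF refl])
          fix i :: 'd assume i: "i \<in> Basis"
          have "D i z - M i z = ?g \<bullet> i"
            unfolding elim(1)[rule_format, OF i True, symmetric] elim(2)[rule_format, OF i True, symmetric]
            by (simp add: inner_diff_left inner_add_left)
          then show "(D i z - M i z)\<^sup>2 = (?g \<bullet> i)\<^sup>2" by simp
        qed
        also have "\<dots> = (norm ?g)\<^sup>2"
          unfolding power2_norm_eq_inner by (subst euclidean_inner) (simp add: power2_eq_square)
        also have "\<dots> \<le> C * \<bar>psd s (p1 z) (fst z) - psd s (p2 z) (fst z)\<bar> * \<bar>?S1 z - ?S2 z\<bar>" by (rule C(2)[OF x])
        also have "\<dots> = C * \<bar>r z * u z\<bar>" unfolding ru abs_mult by simp
        finally show ?thesis using nn by simp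
      qed (use u(2) r(2) M(2) D(2) in simp)
    qed
  qed
  have iru: "integrable lborel (\<lambda>z. r z * u z)"
    using L2u L2r by (auto simp: L2fun_def intro!: integrable_mult_L2)
  have L2D: "L2fun (D i)" if i: "i \<in> Basis" for i
  proof (rule L2_bounded_support[OF D(1)])
    \<comment> \<open>Square integrability of \<open>D\<close> is obtained from \<open>D\<close> =
      \<open>M\<close> + (\<open>D\<close> - \<open>M\<close>), the second part being dominated
      through \<open>coercive\<close> by an integrable product.\<close>
    have "integrable lborel (\<lambda>z. 2 * (C * (r z * u z)) + 2 * (M i z)\<^sup>2)"
      using iru L2M[OF i] by (simp add: L2fun_def)
    then show "integrable lborel (\<lambda>z. (D i z)\<^sup>2)"
    proof (rule integrable_dominated)
      show "AE z in lborel. norm ((D i z)\<^sup>2) \<le> norm (2 * (C * (r z * u z)) + 2 * (M i z)\<^sup>2)"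
        using coercive
      proof eventually_elim
        case (elim z)
        have "(D i z - M i z)\<^sup>2 \<le> (\<Sum>i\<in>Basis. (D i z - M i z)\<^sup>2)"
          using i by (intro member_le_sum) auto
        then have "2 * (D i z - M i z)\<^sup>2 \<le> 2 * (C * (r z * u z))" using elim by linarith
        moreover have "(D i z)\<^sup>2 \<le> 2 * (D i z - M i z)\<^sup>2 + 2 * (M i z)\<^sup>2"
          using zero_le_power2[of "D i z - 2 * M i z"] by (simp add: power2_eq_square algebra_simps)
        ultimately show ?case by simp
      qed
    qed measurable
    show "D i z = 0" if "z \<notin> cball 0 R" for z using D(2) out[OF that] by blast
  qed
  have "flux_system \<Omega> T R C u r D M"
  proof
    show "smooth_bounded_domain \<Omega>" "T > 0" "C > 0" "L2fun u" "L2fun r" by fact+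
    show "L2fun (D i)" "L2fun (M i)" if "i \<in> Basis" for i by (rule L2D[OF that], rule L2M[OF that])
    show "\<Omega> \<times> {0<..<T + 1} \<subseteq> cball 0 R" using R by (simp add: Z_def)
    show "u z = 0" "r z = 0" "D i z = 0" "M i z = 0" if "z \<notin> \<Omega> \<times> {0<..<T + 1}" for z i
      using u(2) r(2) D(2) M(2) that by (auto simp: Z_def)
    show "AE z in lborel. 0 \<le> r z * u z \<and> (\<Sum>i\<in>Basis. (D i z - M i z)\<^sup>2) \<le> C * (r z * u z)" by (rule coercive)
  next
    fix i :: 'd and \<phi> :: "'d \<times> real \<Rightarrow> real" and K
    assume i: "i \<in> Basis" and \<phi>: "Cinf_on UNIV \<phi>" and K: "compact K" "K \<subseteq> \<Omega> \<times> {0<..<T + 1}" "\<And>z. z \<notin> K \<Longrightarrow> \<phi> z = 0"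
    have KU: "K \<subseteq> \<Omega> \<times> {0<..}" using K(2) by auto
    have d0: "dderiv (i, 0) \<phi> z = 0" if "z \<notin> K" for z
      by (rule dderiv_eq_0_outside[of "- K"]) (use that K(3) compact_imp_closed[OF K(1)] in auto)
    note t1 = weak_spatial_grad_test[OF assms(8)[unfolded weak_solution_def, THEN conjunct1] i \<phi> K(1) KU K(3)]
    note t2 = weak_spatial_grad_test[OF assms(9)[unfolded weak_solution_def, THEN conjunct1] i \<phi> K(1) KU K(3)]
    note [measurable] = Cinf_borel[OF \<phi>] Cinf_borel[OF Cinf_dderiv[OF \<phi>]]
    have "(\<integral>z. u z * dderiv (i, 0) \<phi> z \<partial>lborel) = (\<integral>z. ?S1 z * dderiv (i, 0) \<phi> z - ?S2 z * dderiv (i, 0) \<phi> z \<partial>lebesgue)"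
    proof (rule integral_lebesgue_transfer(2)[symmetric])
      show "(\<lambda>z. ?S1 z * dderiv (i, 0) \<phi> z - ?S2 z * dderiv (i, 0) \<phi> z) \<in> borel_measurable lebesgue"
        using t1(1) t2(1) by (intro borel_measurable_diff) auto
      show "AE z in lborel. ?S1 z * dderiv (i, 0) \<phi> z - ?S2 z * dderiv (i, 0) \<phi> z = u z * dderiv (i, 0) \<phi> z"
        using u(3)
      proof eventually_elim
        case (elim z)
        show ?case
        proof (cases "z \<in> K")
          case True
          then have "z \<in> Z" using K(2) by (auto simp: Z_def)
          then show ?thesis using elim by (simp flip: left_diff_distrib)
        qed (use d0 in simp)
      qed
    qed measurable
    also have "\<dots> = - (\<integral>z. (?G1 z \<bullet> i) * \<phi> z - (?G2 z \<bullet> i) * \<phi> z \<partial>lebesgue)"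
    proof -
      have "(\<integral>z. ?S1 z * dderiv (i, 0) \<phi> z - ?S2 z * dderiv (i, 0) \<phi> z \<partial>lebesgue)
          = (\<integral>z. ?S1 z * dderiv (i, 0) \<phi> z \<partial>lebesgue) - (\<integral>z. ?S2 z * dderiv (i, 0) \<phi> z \<partial>lebesgue)"
        by (rule Bochner_Integration.integral_diff[OF t1(1) t2(1)])
      moreover have "(\<integral>z. (?G1 z \<bullet> i) * \<phi> z - (?G2 z \<bullet> i) * \<phi> z \<partial>lebesgue)
          = (\<integral>z. (?G1 z \<bullet> i) * \<phi> z \<partial>lebesgue) - (\<integral>z. (?G2 z \<bullet> i) * \<phi> z \<partial>lebesgue)"
        by (rule Bochner_Integration.integral_diff[OF t1(2) t2(2)])
      ultimately show ?thesis using t1(3) t2(3) by linarith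
    qed
    also have "(\<integral>z. (?G1 z \<bullet> i) * \<phi> z - (?G2 z \<bullet> i) * \<phi> z \<partial>lebesgue) = (\<integral>z. D i z * \<phi> z \<partial>lborel)"
    proof (rule integral_lebesgue_transfer(2))
      show "(\<lambda>z. (?G1 z \<bullet> i) * \<phi> z - (?G2 z \<bullet> i) * \<phi> z) \<in> borel_measurable lebesgue"
        using t1(2) t2(2) by (intro borel_measurable_diff) auto
      show "AE z in lborel. (?G1 z \<bullet> i) * \<phi> z - (?G2 z \<bullet> i) * \<phi> z = D i z * \<phi> z"
        using D(3)[of i]
      proof eventually_elim
        case (elim z)
        show ?case
        proof (cases "z \<in> K")
          case True
          then have "z \<in> Z" using K(2) by (auto simp: Z_def)
          then show ?thesis using elim by (simp flip: left_diff_distrib)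
        qed (use K(3) in simp)
      qed
    qed measurable
    finally show "(\<integral>z. u z * dderiv (i, 0) \<phi> z \<partial>lborel) = - (\<integral>z. D i z * \<phi> z \<partial>lborel)" .
  next
    show "AE t in lborel. 0 < t \<longrightarrow> t < T + 1 \<longrightarrow> (\<forall>\<psi>. Cinf_on UNIV \<psi> \<longrightarrow>
        (\<integral>y. r (y, t) * \<psi> y \<partial>lborel)
          = - (\<Sum>i\<in>Basis. \<integral>w. indicator {..<t} (snd w) * M i w * dderiv i \<psi> (fst w) \<partial>lborel))"
      \<comment> \<open>The weak identities evaluate the densities at single times; at a.e. such
        time the slice of the Borel representative \<open>r\<close> agrees a.e. with the difference
        of the densities.\<close>
      using W1(9) W2(9) AE_lborel_slices[OF r(3)]
    proof eventually_elim
      case (elim t)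
      show ?case
      proof (intro impI allI)
        fix \<psi> :: "'d \<Rightarrow> real" assume t: "0 < t" "t < T + 1" and \<psi>: "Cinf_on UNIV \<psi>"
        then have t': "t \<in> {0..T + 1}" by simp
        note w = weak_identity_difference[OF mp[OF elim(1) t'] mp[OF elim(2) t'] \<psi>]
        have "(\<integral>x. indicator \<Omega> x * ((\<rho>1 (x, t) - \<rho>2 (x, t)) * \<psi> x) \<partial>lebesgue) = (\<integral>y. r (y, t) * \<psi> y \<partial>lborel)"
        proof (rule integral_lebesgue_transfer(2))
          show "(\<lambda>x. indicator \<Omega> x * ((\<rho>1 (x, t) - \<rho>2 (x, t)) * \<psi> x)) \<in> borel_measurable lebesgue"
            using w(3) by auto
          have "(\<lambda>y. r (y, t)) \<in> borel_measurable borel"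
            by (rule measurable_compose[OF borel_measurable_continuous_onI r(1)]) (intro continuous_intros)
          then show "(\<lambda>y. r (y, t) * \<psi> y) \<in> borel_measurable borel"
            using Cinf_borel[OF \<psi>] by (intro borel_measurable_times)
          show "AE x in lborel. indicator \<Omega> x * ((\<rho>1 (x, t) - \<rho>2 (x, t)) * \<psi> x) = r (x, t) * \<psi> x"
            using elim(3)
          proof eventually_elim
            case (elim x)
            then show ?case using t r(2)[of "(x, t)"] by (cases "x \<in> \<Omega>") (auto simp: Z_def)
          qed
        qed
        moreover have "(\<integral>z. indicator (\<Omega> \<times> {0..t}) z * (\<Sum>i\<in>Basis. ((m1 z - m2 z) \<bullet> i) * dderiv i \<psi> (fst z)) \<partial>lebesgue)
            = (\<integral>w. (\<Sum>i\<in>Basis. indicator {..<t} (snd w) * M i w * dderiv i \<psi> (fst w)) \<partial>lborel)"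
        proof (rule integral_lebesgue_transfer(2))
          show "(\<lambda>z. indicator (\<Omega> \<times> {0..t}) z * (\<Sum>i\<in>Basis. ((m1 z - m2 z) \<bullet> i) * dderiv i \<psi> (fst z))) \<in> borel_measurable lebesgue"
            using w(2) by auto
          have "(\<lambda>w. indicator {..<t} (snd w) * M i w * dderiv i \<psi> (fst w)) \<in> borel_measurable borel" if "i \<in> Basis" for i
            using borel_measurable_integrable[OF integrable_cut_test[OF L2M[OF that] M(2)[OF out]
                  Cinf_dderiv[OF \<psi>]]] by simp
          then show "(\<lambda>w. \<Sum>i\<in>Basis. indicator {..<t} (snd w) * M i w * dderiv i \<psi> (fst w)) \<in> borel_measurable borel"
            by (intro borel_measurable_sum)
          have "AE z in lborel. \<forall>i\<in>Basis. z \<in> Z \<longrightarrow> m1 z \<bullet> i - m2 z \<bullet> i = M i z"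
            by (subst AE_finite_all) (auto intro: M(3))
          then show "AE z in lborel. indicator (\<Omega> \<times> {0..t}) z * (\<Sum>i\<in>Basis. ((m1 z - m2 z) \<bullet> i) * dderiv i \<psi> (fst z))
              = (\<Sum>i\<in>Basis. indicator {..<t} (snd z) * M i z * dderiv i \<psi> (fst z))"
            \<comment> \<open>One side integrates over [0,t], the other over times before t with
              \<open>M\<close> zero at times up to 0. They differ only on the null slices at 0 and
              t.\<close>
            using AE_snd_neq[of 0] AE_snd_neq[of t]
          proof eventually_elim
            case (elim z)
            show ?case
            proof (cases "z \<in> \<Omega> \<times> {0..t}")
              case True
              then have z: "z \<in> Z" "snd z < t" using elim t by (auto simp: Z_def mem_Times_iff)
              have "((m1 z - m2 z) \<bullet> i) * dderiv i \<psi> (fst z) = indicator {..<t} (snd z) * M i z * dderiv i \<psi> (fst z)"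
                if "i \<in> Basis" for i
                using elim(1) that z by (simp add: inner_diff_left)
              then have "(\<Sum>i\<in>Basis. ((m1 z - m2 z) \<bullet> i) * dderiv i \<psi> (fst z))
                  = (\<Sum>i\<in>Basis. indicator {..<t} (snd z) * M i z * dderiv i \<psi> (fst z))"
                by (rule sum.cong[OF refl])
              then show ?thesis using True by simp
            next
              case False
              then have "indicator {..<t} (snd z) * M i z = 0" for i
                using M(2)[of z i] by (auto simp: Z_def indicator_def mem_Times_iff)
              then have "indicator {..<t} (snd z) * M i z * dderiv i \<psi> (fst z) = 0" for i by simp
              then show ?thesis by (simp only: indicator_simps(2)[OF False] sum.neutral_const mult_zero_left)
            qed
          qed
        qed
        moreover have "\<dots> = (\<Sum>i\<in>Basis. \<integral>w. indicator {..<t} (snd w) * M i w * dderiv i \<psi> (fst w) \<partial>lborel)"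
          by (intro Bochner_Integration.integral_sum integrable_cut_test[OF L2M M(2)[OF out]]
              Cinf_dderiv[OF \<psi>])
        ultimately show "(\<integral>y. r (y, t) * \<psi> y \<partial>lborel)
          = - (\<Sum>i\<in>Basis. \<integral>w. indicator {..<t} (snd w) * M i w * dderiv i \<psi> (fst w) \<partial>lborel)"
          using w(1) by linarith
      qed
    qed
  qed
  then interpret flux_system \<Omega> T R C u r D M .
  have "AE z in lborel. \<forall>i\<in>Basis. z \<in> Z \<longrightarrow> m1 z \<bullet> i - m2 z \<bullet> i = M i z"
    by (subst AE_finite_all) (auto intro: M(3))
  moreover have "AE z in lborel. \<forall>i\<in>Basis. snd z \<in> {0<..<T} \<longrightarrow> M i z = 0"
    by (subst AE_finite_all) (use flux_zero in auto)
  ultimately have "AE z in lborel. z \<in> \<Omega> \<times> {0..T} \<longrightarrow> \<rho>1 z = \<rho>2 z \<and> m1 z = m2 z"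
    using product_zero u(3) r(3) W1(7) W2(7) AE_snd_neq[of 0] AE_snd_neq[of T]
  proof eventually_elim
    case (elim z)
    show ?case
    proof
      assume "z \<in> \<Omega> \<times> {0..T}"
      then have z: "z \<in> Z" "snd z \<in> {0<..<T}" "fst z \<in> \<Omega>" using elim(8,9) by (auto simp: Z_def mem_Times_iff)
      have \<rho>: "\<rho>1 z = psd s (p1 z) (fst z)" "\<rho>2 z = psd s (p2 z) (fst z)"
        using elim(6,7) z(1) by blast+
      have "r z * u z = 0" using elim(3) z(2) by blast
      moreover have "r z = \<rho>1 z - \<rho>2 z" "u z = ?S1 z - ?S2 z" using elim(4,5) z(1) by auto
      ultimately have "(psd s (p1 z) (fst z) - psd s (p2 z) (fst z)) * (?S1 z - ?S2 z) = 0"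
        by (simp only: \<rho>)
      then have "\<rho>1 z = \<rho>2 z" unfolding \<rho> by (rule psd_eq_of_product_zero[OF s2 s3 z(3)])
      moreover have "m1 z = m2 z"
      proof (rule euclidean_eqI)
        fix i :: 'd assume i: "i \<in> Basis"
        have "m1 z \<bullet> i - m2 z \<bullet> i = M i z" "M i z = 0"
          using elim(1,2) i z by blast+
        then show "m1 z \<bullet> i = m2 z \<bullet> i" by simp
      qed
      ultimately show "\<rho>1 z = \<rho>2 z \<and> m1 z = m2 z" ..
    qed
  qed
  then show ?thesis by (rule AE_completion)
qed



end
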